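(* Let $b$ be a prime, let $m,s\in\mathbb N$, $\alpha>1/2$, $\boldsymbol\gamma=(\gamma_1,\gamma_2,\ldots)\in[0,1]^{\mathbb N}$ and $\tau\in(0,1)$. Assume $$b^m-1\ \ge\ \inf_{1/2\le\lambda'<\alpha}\ \frac1{1-\tau}\sum_{\emptyset\ne u\subseteq\{1,\ldots,s\}}\gamma_u^{1/\lambda'}\left(\frac{b-1}{b^{\alpha/\lambda'}-b}\right)^{|u|}.$$ Then for any $1/2<\lambda<\alpha$ and $0<\delta<\min(\lambda-1/2,1)$, the randomized error of the randomized rank-1 polynomial lattice rule $A_{m,\tau}$ satisfies $$e^{\mathrm{rand}}(H^{\mathrm{wal}}_{s,\alpha,\boldsymbol\gamma},A_{m,\tau})\ \le\ \frac{C_{\lambda,\delta,\tau}}{(b^m-1)^{\lambda+1/2-\delta}}\left(\sum_{\emptyset\ne u\subseteq\{1,\ldots,s\}}\gamma_u^{1/\lambda}\left(\frac{b-1}{b^{\alpha/\lambda}-b}\right)^{|u|}\right)^{\lambda-\delta},$$ where $C_{\lambda,\delta,\tau}>0$ is a constant depending only on $\lambda,\delta,\tau$ (and possibly the fixed prime $b$).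
   Context: Notation: $b$ is a fixed prime, $\mathbb F_b$ the field of order $b$ identified with $\{0,\ldots,b-1\}$, $\mathbb N_0=\{0,1,2,\ldots\}$, $\gamma_u=\prod_{j\in u}\gamma_j$, $I(f)=\int_{[0,1)^s}f(\boldsymbol x)\,d\boldsymbol x$. For $k\in\mathbb N_0$ with $b$-adic expansion $k=\kappa_0+\kappa_1b+\cdots$, let $k(x)=\kappa_0+\kappa_1x+\cdots\in\mathbb F_b[x]$; for vectors this is applied componentwise. Walsh functions. With $\omega_b=e^{2\pi i/b}$, $\mathrm{wal}_k(x)=\omega_b^{\kappa_0\xi_1+\kappa_1\xi_2+\cdots}$ for $x=\xi_1/b+\xi_2/b^2+\cdots\in[0,1)$ (the expansion with infinitely many $\xi_i\ne b-1$), and $\mathrm{wal}_{\boldsymbol k}(\boldsymbol x)=\prod_j\mathrm{wal}_{k_j}(x_j)$. Weighted Walsh space. For $k\in\mathbb N$ let $\mu(k)$ be the number of $b$-adic digits of $k$, i.e. $b^{\mu(k)-1}\le k<b^{\mu(k)}$. For $\boldsymbol k\in\mathbb N_0^{\ell}$ put $\tilde r_{\alpha,\boldsymbol\gamma}(\boldsymbol k)=\prod_{j:\,k_j\ne0}b^{\alpha\mu(k_j)}/\gamma_j$ (empty product $=1$; $1/\tilde r=0$ if $k_j\ne0$ and $\gamma_j=0$ for some $j$). $H^{\mathrm{wal}}_{s,\alpha,\boldsymbol\gamma}$ is the space of functions $f:[0,1)^s\to\mathbb R$ given by absolutely convergent Walsh series $f=\sum_{\boldsymbol k\in\mathbb N_0^s}\tilde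 f(\boldsymbol k)\mathrm{wal}_{\boldsymbol k}$, $\tilde f(\boldsymbol k)=\int f\,\overline{\mathrm{wal}_{\boldsymbol k}}$, with finite norm $\|f\|^{\mathrm{wal}}_{s,\alpha,\boldsymbol\gamma}=\bigl(\sum_{\boldsymbol k}\tilde r_{\alpha,\boldsymbol\gamma}(\boldsymbol k)^2|\tilde f(\boldsymbol k)|^2\bigr)^{1/2}$ (if $\gamma_j=0$, then $\tilde f(\boldsymbol k)=0$ is required whenever $k_j\neq0$). Polynomial lattice rules. For $p\in\mathbb F_b[x]$ with $\deg p=m$, $\boldsymbol q\in(\mathbb F_b[x])^{\ell}$ with $\deg q_j<m$, and $d\in\mathbb N$, let $P_{m,p,\boldsymbol q,d}$ be the multiset of the $b^m$ points $\bigl(\phi_d(n(x)q_1(x)/p(x)),\ldots,\phi_d(n(x)q_{\ell}(x)/p(x))\bigr)$, $n=0,\ldots,b^m-1$, where for a formal Laurent series $\phi_d(\sum_{i\ge w}a_ix^{-i})=\sum_{i=\max(1,w)}^{d}a_ib^{-i}$. Put $I(f;P_{m,p,\boldsymbol q,d})=b^{-m}\sum_{\boldsymbol x\in P_{m,p,\boldsymbol q,d}}f(\boldsymbol x)$ and $I(f;P_{m,p,\boldsymbol q})=\lim_{d\to\infty}I(f;P_{m,p,\boldsymbol q,d})$. The dual polynomial lattice is $P^\perp_{m,p,\boldsymbol q}=\{\boldsymbol k\in\mathbb N_0^{\ell}:\boldsymbol k(x)\cdot\boldsymbol q(x)\equiv0\pmod{p(x)}\}$, and $\tilde R_{\alpha,\boldsymbol\gamma}(p,\boldsymbol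 q)=\sum_{\boldsymbol k\in P^\perp_{m,p,\boldsymbol q}\setminus\{\boldsymbol0\}}\tilde r_{\alpha,\boldsymbol\gamma}(\boldsymbol k)^{-2}$. Randomized component-by-component algorithm. Let $G_m=\{q\in\mathbb F_b[x]:q\ne0,\deg q<m\}$ (with a fixed total order used to break ties) and let $\tilde{\mathbb P}_m$ be the set of monic irreducible polynomials of degree $m$ over $\mathbb F_b$. (1) Pick $p\in\tilde{\mathbb P}_m$ uniformly at random. (2) Set $q_1=1$. (3) For $\ell=2,\ldots,s$, given $\boldsymbol q_{\ell-1}=(q_1,\ldots,q_{\ell-1})$, let $Z_\ell\subset G_m$ consist of the $\lceil\tau(b^m-1)\rceil$ elements $q$ with the smallest values of $\tilde R_{\alpha,\boldsymbol\gamma}(p,(\boldsymbol q_{\ell-1},q))$, and pick $q_\ell\in Z_\ell$ uniformly at random. For $p\in\tilde{\mathbb P}_m$, $\mathcal Q_{p,\tau}\subseteq G_m^s$ denotes the set of all vectors $\boldsymbol q$ that steps (2)–(3) can produce. The randomized algorithm is $A_{m,\tau}(f)=I(f;P_{m,p,\boldsymbol q})$ with $p$ uniform in $\tilde{\mathbb P}_m$ and $\boldsymbol q$ uniform in $\mathcal Q_{p,\tau}$, and $$e^{\mathrm{rand}}(H^{\mathrm{wal}}_{s,\alpha,\boldsymbol\gamma},A_{m,\tau})=\sup_{\|f\|^{\mathrm{wal}}_{s,\alpha,\boldsymbol\gamma}\le1}\frac1{|\tilde{\mathbb P}_m|}\sum_{p\in\tilde{\mathbb P}_m}\frac1{|\mathcal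 Q_{p,\tau}|}\sum_{\boldsymbol q\in\mathcal Q_{p,\tau}}|I(f;P_{m,p,\boldsymbol q})-I(f)|.$$ *)

theory Defs
  imports
    "HOL-Analysis.Analysis"
    "HOL-Library.Log_Nat"
    "HOL-Computational_Algebra.Formal_Laurent_Series"
    "HOL-Number_Theory.Cong"
    "Berlekamp_Zassenhaus.Finite_Field"
begin

text \<open>
  The prime \<open>b\<close> is the cardinality of a type \<open>'b :: prime_card\<close>, and the field of order \<open>b\<close> is
  \<open>'b mod_ring\<close>, whose elements are identified with \<open>0, \<dots>, b - 1\<close> by \<^const>\<open>to_int_mod_ring\<close>.
  A vector with \<open>s\<close> components in a set \<open>A\<close> is an element of \<open>{1..s} \<rightarrow>\<^sub>E A\<close>; the weights form an
  infinite sequence \<open>\<gamma> 1, \<gamma> 2, \<dots>\<close> (the value \<open>\<gamma> 0\<close> is never used).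
\<close>

section \<open>Walsh functions\<close>

definition nat_digit :: "nat \<Rightarrow> nat \<Rightarrow> nat \<Rightarrow> nat" where
  "nat_digit b k i = (k div b ^ i) mod b"

text \<open>
  The digit \<open>\<xi>\<^sub>i\<close>, \<open>i \<ge> 1\<close>, of \<open>x \<in> [0,1)\<close>. Taking floors selects the expansion that has infinitely
  many digits different from \<open>b - 1\<close>, see \<open>frac_digit_unique\<close> below.
\<close>
definition frac_digit :: "nat \<Rightarrow> real \<Rightarrow> nat \<Rightarrow> nat" where
  "frac_digit b x i = nat (\<lfloor>x * real b ^ i\<rfloor> mod int b)"

text \<open>The digits of \<open>k\<close> with index at least \<open>floorlog b k\<close> vanish, so that the sum is complete.\<close>
definition wal :: "nat \<Rightarrow> nat \<Rightarrow> real \<Rightarrow> complex" where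
  "wal b k x = exp (2 * of_real pi * \<i> / of_nat b) ^
     (\<Sum>i<floorlog b k. nat_digit b k i * frac_digit b x (Suc i))"

definition wal_vec :: "nat \<Rightarrow> nat \<Rightarrow> (nat \<Rightarrow> nat) \<Rightarrow> (nat \<Rightarrow> real) \<Rightarrow> complex" where
  "wal_vec b s k x = (\<Prod>j\<in>{1..s}. wal b (k j) (x j))"

section \<open>The weighted Walsh space\<close>

definition unit_cube :: "nat \<Rightarrow> (nat \<Rightarrow> real) set" where
  "unit_cube s = {1..s} \<rightarrow>\<^sub>E {0..<1}"

definition cube_integral :: "nat \<Rightarrow> ((nat \<Rightarrow> real) \<Rightarrow> 'a) \<Rightarrow> 'a::{banach, second_countable_topology}"
  where "cube_integral s f = (LINT x:unit_cube s|(\<Pi>\<^sub>M j\<in>{1..s}. lborel). f x)"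

definition walsh_coeff :: "nat \<Rightarrow> nat \<Rightarrow> ((nat \<Rightarrow> real) \<Rightarrow> real) \<Rightarrow> (nat \<Rightarrow> nat) \<Rightarrow> complex" where
  "walsh_coeff b s f k = cube_integral s (\<lambda>x. of_real (f x) * cnj (wal_vec b s k x))"

abbreviation nat_vecs :: "nat \<Rightarrow> (nat \<Rightarrow> nat) set" where
  "nat_vecs s \<equiv> {1..s} \<rightarrow>\<^sub>E UNIV"

text \<open>
  The number \<open>\<mu>(k)\<close> of \<open>b\<close>-adic digits of \<open>k > 0\<close> is \<open>floorlog b k\<close>. If \<open>k j \<noteq> 0\<close> and \<open>\<gamma> j = 0\<close> for
  some \<open>j\<close>, then division by zero makes both \<open>r_wal\<close> and its inverse equal to \<open>0\<close>; the latter is the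
  usual convention, and \<open>walsh_space\<close> requires the corresponding Walsh coefficients to vanish.
\<close>
definition r_wal :: "nat \<Rightarrow> real \<Rightarrow> (nat \<Rightarrow> real) \<Rightarrow> nat \<Rightarrow> (nat \<Rightarrow> nat) \<Rightarrow> real" where
  "r_wal b \<alpha> \<gamma> s k =
     (\<Prod>j\<in>{j\<in>{1..s}. k j \<noteq> 0}. real b powr (\<alpha> * real (floorlog b (k j))) / \<gamma> j)"

text \<open>
  Membership and norm depend only on the values of the function on the unit cube.
\<close>
definition walsh_space :: "nat \<Rightarrow> nat \<Rightarrow> real \<Rightarrow> (nat \<Rightarrow> real) \<Rightarrow> ((nat \<Rightarrow> real) \<Rightarrow> real) set" where
  "walsh_space b s \<alpha> \<gamma> = {f.
     (\<lambda>k. cmod (walsh_coeff b s f k)) summable_on nat_vecs s \<and>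
     (\<forall>x\<in>unit_cube s.
        ((\<lambda>k. walsh_coeff b s f k * wal_vec b s k x) has_sum of_real (f x)) (nat_vecs s)) \<and>
     (\<forall>k\<in>nat_vecs s. (\<exists>j\<in>{1..s}. k j \<noteq> 0 \<and> \<gamma> j = 0) \<longrightarrow> walsh_coeff b s f k = 0) \<and>
     (\<lambda>k. (r_wal b \<alpha> \<gamma> s k)\<^sup>2 * (cmod (walsh_coeff b s f k))\<^sup>2) summable_on nat_vecs s}"

definition walsh_norm :: "nat \<Rightarrow> nat \<Rightarrow> real \<Rightarrow> (nat \<Rightarrow> real) \<Rightarrow> ((nat \<Rightarrow> real) \<Rightarrow> real) \<Rightarrow> real" where
  "walsh_norm b s \<alpha> \<gamma> f =
     sqrt (\<Sum>\<^sub>\<infinity>k\<in>nat_vecs s. (r_wal b \<alpha> \<gamma> s k)\<^sup>2 * (cmod (walsh_coeff b s f k))\<^sup>2)"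

section \<open>Polynomial lattice rules\<close>

definition nat_poly :: "nat \<Rightarrow> 'b::prime_card mod_ring poly" where
  "nat_poly k = (\<Sum>i<floorlog CARD('b) k. Polynomial.monom (of_nat (nat_digit CARD('b) k i)) i)"

text \<open>
  Formal Laurent series in \<open>x\<^sup>-\<^sup>1\<close>: the variable of the type \<open>fls\<close> plays the role of \<open>x\<^sup>-\<^sup>1\<close>, so \<open>x\<close>
  itself is \<^const>\<open>fls_X_inv\<close> and the coefficient of \<open>x\<^sup>-\<^sup>i\<close> in \<open>L\<close> is \<open>fls_nth L i\<close>.
\<close>
definition poly_to_laurent :: "'b::prime_card mod_ring poly \<Rightarrow> 'b mod_ring fls" where
  "poly_to_laurent p = poly (map_poly fls_const p) fls_X_inv"

text \<open>Starting the sum at \<open>1\<close> agrees with \<open>max 1 w\<close>, the coefficients below the order \<open>w\<close> being zero.\<close>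
definition phi :: "nat \<Rightarrow> 'b::prime_card mod_ring fls \<Rightarrow> real" where
  "phi d L = (\<Sum>i=1..d. real_of_int (to_int_mod_ring (fls_nth L (int i))) / real CARD('b) ^ i)"

definition lattice_point ::
  "nat \<Rightarrow> 'b::prime_card mod_ring poly \<Rightarrow> (nat \<Rightarrow> 'b mod_ring poly) \<Rightarrow> nat \<Rightarrow> nat \<Rightarrow> (nat \<Rightarrow> real)"
  where "lattice_point l p q d n =
    (\<lambda>j\<in>{1..l}. phi d (poly_to_laurent (nat_poly n * q j) / poly_to_laurent p))"

definition poly_lattice ::
  "nat \<Rightarrow> nat \<Rightarrow> 'b::prime_card mod_ring poly \<Rightarrow> (nat \<Rightarrow> 'b mod_ring poly) \<Rightarrow> nat \<Rightarrow> (nat \<Rightarrow> real) multiset"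
  where "poly_lattice l m p q d =
    image_mset (lattice_point l p q d) (mset_set {..<CARD('b) ^ m})"

definition lattice_rule_trunc ::
  "nat \<Rightarrow> nat \<Rightarrow> ((nat \<Rightarrow> real) \<Rightarrow> real) \<Rightarrow> 'b::prime_card mod_ring poly \<Rightarrow>
   (nat \<Rightarrow> 'b mod_ring poly) \<Rightarrow> nat \<Rightarrow> real"
  where "lattice_rule_trunc l m f p q d =
    (\<Sum>x\<in>#poly_lattice l m p q d. f x) / real CARD('b) ^ m"

definition lattice_rule ::
  "nat \<Rightarrow> nat \<Rightarrow> ((nat \<Rightarrow> real) \<Rightarrow> real) \<Rightarrow> 'b::prime_card mod_ring poly \<Rightarrow>
   (nat \<Rightarrow> 'b mod_ring poly) \<Rightarrow> real"
  where "lattice_rule l m f p q = lim (\<lambda>d. lattice_rule_trunc l m f p q d)"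

definition dual_lattice ::
  "nat \<Rightarrow> 'b::prime_card mod_ring poly \<Rightarrow> (nat \<Rightarrow> 'b mod_ring poly) \<Rightarrow> (nat \<Rightarrow> nat) set"
  where "dual_lattice l p q =
    {k \<in> nat_vecs l. [(\<Sum>j\<in>{1..l}. nat_poly (k j) * q j) = 0] (mod p)}"

definition R_wal ::
  "real \<Rightarrow> (nat \<Rightarrow> real) \<Rightarrow> nat \<Rightarrow> 'b::prime_card mod_ring poly \<Rightarrow> (nat \<Rightarrow> 'b mod_ring poly) \<Rightarrow> real"
  where "R_wal \<alpha> \<gamma> l p q =
    (\<Sum>\<^sub>\<infinity>k\<in>dual_lattice l p q - {\<lambda>j\<in>{1..l}. 0}. (inverse (r_wal CARD('b) \<alpha> \<gamma> l k))\<^sup>2)"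

section \<open>Randomized component-by-component algorithm\<close>

definition gen_polys :: "nat \<Rightarrow> 'b::prime_card mod_ring poly set" where
  "gen_polys m = {q. q \<noteq> 0 \<and> degree q < m}"

definition monic_irreducibles :: "nat \<Rightarrow> 'b::prime_card mod_ring poly set" where
  "monic_irreducibles m = {p. lead_coeff p = 1 \<and> Factorial_Ring.irreducible p \<and> degree p = m}"

text \<open>
  The \<open>N\<close> elements of \<open>A\<close> with the smallest values of \<open>v\<close>; ties are broken by the (reflexive) linear
  order \<open>ord\<close>. These are the elements that have fewer than \<open>N\<close> predecessors.
\<close>
definition smallest :: "('a \<times> 'a) set \<Rightarrow> ('a \<Rightarrow> real) \<Rightarrow> 'a set \<Rightarrow> nat \<Rightarrow> 'a set" where
  "smallest ord v A N =
     {x\<in>A. card {y\<in>A. v y < v x \<or> (v y = v x \<and> y \<noteq> x \<and> (y, x) \<in> ord)} < N}"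

definition cbc_candidates ::
  "('b::prime_card mod_ring poly \<times> 'b mod_ring poly) set \<Rightarrow> nat \<Rightarrow> real \<Rightarrow> (nat \<Rightarrow> real) \<Rightarrow> real \<Rightarrow>
   'b mod_ring poly \<Rightarrow> nat \<Rightarrow> (nat \<Rightarrow> 'b mod_ring poly) \<Rightarrow> 'b mod_ring poly set"
  where "cbc_candidates ord m \<alpha> \<gamma> \<tau> p l q =
    smallest ord (\<lambda>z. R_wal \<alpha> \<gamma> l p (q(l := z))) (gen_polys m)
      (nat \<lceil>\<tau> * (real CARD('b) ^ m - 1)\<rceil>)"

text \<open>
  \<open>cbc_reachable ord m \<alpha> \<gamma> \<tau> p s q\<close>: the vector \<open>q\<close> of \<open>s\<close> components is a possible output.
\<close>
inductive cbc_reachable ::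
  "('b::prime_card mod_ring poly \<times> 'b mod_ring poly) set \<Rightarrow> nat \<Rightarrow> real \<Rightarrow> (nat \<Rightarrow> real) \<Rightarrow> real \<Rightarrow>
   'b mod_ring poly \<Rightarrow> nat \<Rightarrow> (nat \<Rightarrow> 'b mod_ring poly) \<Rightarrow> bool"
  for ord m \<alpha> \<gamma> \<tau> p
where
  first: "cbc_reachable ord m \<alpha> \<gamma> \<tau> p 1 (\<lambda>j\<in>{1}. 1)"
| step: "cbc_reachable ord m \<alpha> \<gamma> \<tau> p l q \<Longrightarrow> z \<in> cbc_candidates ord m \<alpha> \<gamma> \<tau> p (Suc l) q \<Longrightarrow>
    cbc_reachable ord m \<alpha> \<gamma> \<tau> p (Suc l) (q(Suc l := z))"

definition cbc_vectors ::
  "('b::prime_card mod_ring poly \<times> 'b mod_ring poly) set \<Rightarrow> nat \<Rightarrow> nat \<Rightarrow> real \<Rightarrow> (nat \<Rightarrow> real) \<Rightarrow>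
   real \<Rightarrow> 'b mod_ring poly \<Rightarrow> (nat \<Rightarrow> 'b mod_ring poly) set"
  where "cbc_vectors ord m s \<alpha> \<gamma> \<tau> p = {q. cbc_reachable ord m \<alpha> \<gamma> \<tau> p s q}"

text \<open>The worst-case expected error, as a supremum in the extended reals.\<close>
definition rand_error ::
  "('b::prime_card mod_ring poly \<times> 'b mod_ring poly) set \<Rightarrow> nat \<Rightarrow> nat \<Rightarrow> real \<Rightarrow> (nat \<Rightarrow> real) \<Rightarrow>
   real \<Rightarrow> ereal"
  where "rand_error ord m s \<alpha> \<gamma> \<tau> =
    (SUP f \<in> {f \<in> walsh_space CARD('b) s \<alpha> \<gamma>. walsh_norm CARD('b) s \<alpha> \<gamma> f \<le> 1}.
       ereal (1 / real (card (monic_irreducibles m :: 'b mod_ring poly set)) *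
         (\<Sum>p\<in>(monic_irreducibles m :: 'b mod_ring poly set).
            1 / real (card (cbc_vectors ord m s \<alpha> \<gamma> \<tau> p)) *
            (\<Sum>q\<in>cbc_vectors ord m s \<alpha> \<gamma> \<tau> p.
               \<bar>lattice_rule s m f p q - cube_integral s f\<bar>))))"

definition weight_sum :: "nat \<Rightarrow> nat \<Rightarrow> real \<Rightarrow> (nat \<Rightarrow> real) \<Rightarrow> real \<Rightarrow> real" where
  "weight_sum b s \<alpha> \<gamma> lam =
     (\<Sum>u\<in>Pow {1..s} - {{}}. (\<Prod>j\<in>u. \<gamma> j) powr (1 / lam) *
        ((real b - 1) / (real b powr (\<alpha> / lam) - real b)) ^ card u)"

section \<open>Consistency of the definitions\<close>

lemma frac_digit_unique:
  fixes \<xi> :: "nat \<Rightarrow> nat"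
  assumes b: "b > 1" and dig: "\<And>i. \<xi> i < b" and inf: "\<exists>\<^sub>\<infinity>i. \<xi> i \<noteq> b - 1"
    and sums: "(\<lambda>i. real (\<xi> (Suc i)) / real b ^ Suc i) sums x"
  shows "frac_digit b x (Suc i) = \<xi> (Suc i)"
proof -
  define N where "N n = (\<Sum>i<n. int (\<xi> (Suc i)) * int b ^ (n - Suc i))" for n
  define T where "T n = (\<Sum>i. real (\<xi> (Suc (i + n))) / real b ^ Suc i)" for n
  have geo: "(\<lambda>i. (real b - 1) / real b ^ Suc i) sums 1"
  proof -
    have "(\<lambda>i. (real b - 1) / real b * (1 / real b) ^ i) sums ((real b - 1) / real b * (1 / (1 - 1 / real b)))"
      by (intro sums_mult geometric_sums) (use b in auto)
    moreover have "(real b - 1) / real b * (1 / (1 - 1 / real b)) = 1"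
      using b by (simp add: field_simps)
    ultimately show ?thesis using b by (simp add: power_divide split: if_splits)
  qed
  have le: "real (\<xi> j) \<le> real b - 1" for j
    using dig[of j] by linarith
  have summ: "summable (\<lambda>i. real (\<xi> (Suc (i + n))) / real b ^ Suc i)" for n
    by (rule summable_comparison_test[OF _ sums_summable[OF geo]])
       (use le b in \<open>auto intro!: exI[of _ 0] divide_right_mono\<close>)
  have T0: "T n \<ge> 0" for n
    unfolding T_def by (intro suminf_nonneg summ) auto
  have T1: "T n < 1" for n
  proof -
    obtain j where j: "j > n" "\<xi> j \<noteq> b - 1"
      using inf unfolding INFM_nat by blast
    obtain i where i: "j = Suc (i + n)" using j(1) less_iff_Suc_add[of n j] by (auto simp: add.commute)
    let ?g = "\<lambda>i. (real b - 1) / real b ^ Suc i - real (\<xi> (Suc (i + n))) / real b ^ Suc i"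
    have "real (\<xi> j) < real b - 1" using j(2) dig[of j] b by linarith
    hence "0 < suminf ?g"
      by (intro suminf_pos2[of ?g i] summable_diff sums_summable[OF geo] summ)
         (use le b i in \<open>auto simp: divide_right_mono divide_strict_right_mono\<close>)
    also have "suminf ?g = 1 - T n"
      unfolding T_def using suminf_diff[OF sums_summable[OF geo] summ[of n]] sums_unique[OF geo] by simp
    finally show ?thesis by simp
  qed
  have eq: "x * real b ^ n = real_of_int (N n) + T n" for n
  proof -
    have "x = (\<Sum>i. real (\<xi> (Suc (i + n))) / real b ^ Suc (i + n)) + (\<Sum>i<n. real (\<xi> (Suc i)) / real b ^ Suc i)"
      using suminf_split_initial_segment[OF sums_summable[OF sums], of n] sums_unique[OF sums] by simp
    moreover have "(\<Sum>i. real (\<xi> (Suc (i + n))) / real b ^ Suc (i + n)) = T n / real b ^ n"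
      unfolding T_def using suminf_divide[OF summ[of n], of "real b ^ n"]
      by (simp add: power_add mult_ac)
    moreover have "(\<Sum>i<n. real (\<xi> (Suc i)) / real b ^ Suc i) * real b ^ n = real_of_int (N n)"
      unfolding N_def sum_distrib_right of_int_sum
    proof (intro sum.cong refl)
      fix i assume "i \<in> {..<n}"
      hence "real b ^ n = real b ^ Suc i * real b ^ (n - Suc i)"
        by (subst power_add[symmetric]) auto
      thus "real (\<xi> (Suc i)) / real b ^ Suc i * real b ^ n =
          real_of_int (int (\<xi> (Suc i)) * int b ^ (n - Suc i))"
        using b by simp
    qed
    ultimately show ?thesis using b by (simp add: field_simps)
  qed
  have "\<lfloor>x * real b ^ Suc i\<rfloor> = N (Suc i)"
    using eq[of "Suc i"] T0[of "Suc i"] T1[of "Suc i"] by (simp add: floor_eq_iff)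
  moreover have "N (Suc i) mod int b = int (\<xi> (Suc i))"
  proof -
    have "N (Suc i) = int b * N i + int (\<xi> (Suc i))"
      by (auto simp: N_def sum_distrib_left Suc_diff_le mult_ac intro!: sum.cong)
         (metis Suc_diff_Suc power_Suc mult.assoc mult.commute)
    thus ?thesis using dig[of "Suc i"] by simp
  qed
  ultimately show ?thesis by (simp add: frac_digit_def)
qed

end

theory Submission
  imports Defs "Berlekamp_Zassenhaus.Distinct_Degree_Factorization"
begin

hide_const (open) up_ring.coeff up_ring.monom Module.smult

text \<open>
  For \<open>f\<close> in the Walsh space, the character property of polynomial lattices gives
  \<open>\<bar>I(f; P) - I(f)\<bar> \<le> \<Sum>\<bar>c(k)\<bar>\<close>, the sum being over the nonzero dual vectors \<open>k\<close> and \<open>c(k)\<close> being the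
  Walsh coefficients. Hence the randomized error is at most \<open>\<Sum> \<omega>(k) \<bar>c(k)\<bar>\<close>, where \<open>\<omega>(k)\<close> is the
  probability that \<open>k\<close> is a dual vector. Two facts about \<open>\<omega>\<close> are combined. First, \<open>\<omega>(k)\<close> is of order
  \<open>\<mu>(k\<^sub>i) / (b\<^sup>m - 1)\<close> whenever \<open>k\<^sub>i \<noteq> 0\<close>: either \<open>p\<close> divides \<open>k\<^sub>i(x)\<close>, which is rare because \<open>k\<^sub>i(x)\<close> has at
  most \<open>\<mu>(k\<^sub>i) / m\<close> of the at least \<open>b\<^sup>m / (2m)\<close> possible divisors \<open>p\<close>, or at most one choice of the
  last component that matters is bad. Secondly, \<open>\<omega>(k) = 0\<close> unless the weight
  \<open>r(k) powr (- 1 / lam)\<close> is at most \<open>W / ((1 - \<tau>) (b\<^sup>m - 1))\<close>, \<open>W\<close> being the weight sum, by the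
  component-by-component bound on the worst-case criterion. As these weights sum up to \<open>W\<close>, the
  Cauchy-Schwarz inequality yields the rate; the factor \<open>\<mu>(k\<^sub>i)\<close> is absorbed by the \<open>\<delta>\<close>-th power of
  the weight.
\<close>

section \<open>Polynomials over the prime field and base-\<open>b\<close> digits\<close>

text \<open>The estimates are made for the weights \<open>V = r powr (- 1 / lam)\<close> instead of
  \<open>r\<close>. With \<open>c = \<alpha> / lam > 1\<close> they are products of summable
  one-dimensional weights, so both their total \<open>1 + W\<close> and the effect of one more
  component are explicit. The criterion is the sum of \<open>V powr (2 * lam)\<close> over the dual
  lattice, and \<open>2 * lam > 1\<close> allows it to be compared with a power of the sum of
  \<open>V\<close>. The exponents arise as follows, with \<open>M = b ^ m - 1\<close>. Up to
  constants, \<open>(\<omega>(k) * V powr lam)^2\<close> is at most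
  \<open>V powr (2 * lam - 2 * \<delta>) / M^2\<close>. One factor \<open>V\<close> is reserved for
  the summation over \<open>k\<close>, which gives \<open>W\<close>; the remaining power
  \<open>2 * lam - 2 * \<delta> - 1\<close> is positive because \<open>\<delta> < lam - 1/2\<close>
  and is bounded by the threshold on the support of \<omega>. So the probability contributes a full
  factor \<open>1 / M\<close>, while the factor reserved for the summation costs only
  \<open>M powr (1/2)\<close>: this is the gain of 1/2 in the rate. A further obstacle is that the
  rule is a limit over truncations \<open>d\<close>, whereas the number of digits needed to evaluate
  a Walsh function exactly grows with its index; the limit is exchanged with the Walsh series by
  dominated convergence.\<close>

lemma card_gt_1: "1 < CARD('b::prime_card)"
  by (rule nontriv)

lemma to_int_of_nat: "to_int_mod_ring (of_nat n :: 'b::prime_card mod_ring) = int (n mod CARD('b))"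
proof -
  have "(of_nat n :: 'b mod_ring) = of_int_mod_ring (int n)"
    by (simp add: of_nat_of_int_mod_ring)
  then show ?thesis
    by (simp add: of_int_mod_ring.rep_eq to_int_mod_ring.rep_eq zmod_int)
qed

lemma of_nat_to_int: "of_nat (nat (to_int_mod_ring (a :: 'b::prime_card mod_ring))) = a"
proof -
  have "to_int_mod_ring a \<ge> 0"
    using range_to_int_mod_ring[where ?'a = 'b] by (metis atLeastLessThan_iff rangeI)
  then show ?thesis
    by (simp add: of_nat_of_int_mod_ring)
qed

lemma to_int_bounds:
  "0 \<le> to_int_mod_ring (a :: 'b::prime_card mod_ring)"
  "to_int_mod_ring (a :: 'b::prime_card mod_ring) < int CARD('b)"
  using range_to_int_mod_ring[where ?'a = 'b] by (metis atLeastLessThan_iff rangeI)+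

lemma coeff_nat_poly:
  "coeff (nat_poly k :: 'b::prime_card mod_ring poly) i = of_nat (nat_digit CARD('b) k i)"
proof -
  have z: "nat_digit CARD('b) k i = 0" if "\<not> i < floorlog CARD('b) k"
  proof -
    have "k < CARD('b) ^ i"
      using that floorlog_leD[of "CARD('b)" k i] card_gt_1 by auto
    then show ?thesis by (simp add: nat_digit_def)
  qed
  show ?thesis
    by (auto simp: nat_poly_def coeff_sum z sum.delta if_distrib cong: if_cong)
qed

lemma nat_poly_0 [simp]: "nat_poly 0 = 0"
  by (simp add: nat_poly_def floorlog_def)

text \<open>Horner's form of the digit encoding; the inductions on \<open>k\<close> peel off the
  lowest digit with it.\<close>

lemma nat_poly_rec:
  "(nat_poly k :: 'b::prime_card mod_ring poly) = pCons (of_nat (k mod CARD('b))) (nat_poly (k div CARD('b)))"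
  by (intro poly_eqI) (auto simp: coeff_nat_poly coeff_pCons nat_digit_def div_mult2_eq split: nat.splits)

lemma nat_poly_eq_iff: "(nat_poly k :: 'b::prime_card mod_ring poly) = nat_poly l \<longleftrightarrow> k = l"
proof
  show "(nat_poly k :: 'b mod_ring poly) = nat_poly l \<Longrightarrow> k = l"
  proof (induction k arbitrary: l rule: less_induct)
    case (less k)
    have *: "(of_nat (k mod CARD('b)) :: 'b mod_ring) = of_nat (l mod CARD('b))"
      "(nat_poly (k div CARD('b)) :: 'b mod_ring poly) = nat_poly (l div CARD('b))"
      using less.prems nat_poly_rec[of k, where 'b = 'b] nat_poly_rec[of l, where 'b = 'b] by auto
    have m: "k mod CARD('b) = l mod CARD('b)"
      using arg_cong[OF *(1), of to_int_mod_ring] by (simp add: to_int_of_nat)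
    show ?case
    proof (cases "k = 0")
      case False
      then have "k div CARD('b) < k" using card_gt_1[where 'b = 'b] by simp
      from less.IH[OF this *(2)] m show ?thesis by (metis div_mult_mod_eq)
    next
      case True
      have "coeff (nat_poly l :: 'b mod_ring poly) i = 0" for i
        using less.prems True by simp
      then have "(of_nat (nat_digit CARD('b) l i) :: 'b mod_ring) = 0" for i
        by (simp only: coeff_nat_poly)
      from arg_cong[OF this, of to_int_mod_ring] have d: "nat_digit CARD('b) l i = 0" for i
        unfolding to_int_of_nat by (simp add: nat_digit_def)
      have "l = 0"
      proof (rule ccontr)
        assume "l \<noteq> 0"
        \<comment> \<open>The index of the leading digit, which cannot vanish.\<close>
        let ?i = "floorlog CARD('b) l - 1"
        have "CARD('b) ^ ?i \<le> l" "l < CARD('b) ^ floorlog CARD('b) l"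
          using floorlog_bounds[of l "CARD('b)"] \<open>l \<noteq> 0\<close> card_gt_1[where 'b = 'b] by auto
        moreover have "floorlog CARD('b) l = Suc ?i"
          using \<open>l \<noteq> 0\<close> card_gt_1[where 'b = 'b] by (simp add: floorlog_def)
        ultimately have "0 < l div CARD('b) ^ ?i" "l div CARD('b) ^ ?i < CARD('b)"
          by (auto simp: div_greater_zero_iff intro!: less_mult_imp_div_less) (metis power_Suc mult.commute)
        then show False using d[of ?i] by (simp add: nat_digit_def)
      qed
      then show ?thesis using True by simp
    qed
  qed
qed auto

lemma bij_nat_poly: "bij (nat_poly :: nat \<Rightarrow> 'b::prime_card mod_ring poly)"
proof (rule bijI)
  show "inj (nat_poly :: nat \<Rightarrow> 'b mod_ring poly)"
    by (auto simp: inj_def nat_poly_eq_iff)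
  have "\<exists>k. nat_poly k = f" for f :: "'b mod_ring poly"
  proof (induction f)
    case 0
    show ?case by (rule exI[of _ 0]) simp
  next
    case (pCons a f)
    then obtain k where k: "nat_poly k = f" by blast
    let ?c = "nat (to_int_mod_ring a)"
    have c: "?c < CARD('b)" using to_int_bounds[of a] by linarith
    have "nat_poly (?c + CARD('b) * k) = pCons a f"
      using c by (subst nat_poly_rec) (simp add: k of_nat_to_int)
    then show ?case by blast
  qed
  then show "surj (nat_poly :: nat \<Rightarrow> 'b mod_ring poly)"
    by (metis surjI)
qed

lemma nat_poly_eq_0_iff [simp]: "(nat_poly k :: 'b::prime_card mod_ring poly) = 0 \<longleftrightarrow> k = 0"
  using nat_poly_eq_iff[of k 0, where 'b = 'b] by simp

text \<open>Turns digit counts into degrees, so that multiplying by a polynomial of degree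
  \<open>m\<close> adds exactly \<open>m\<close> digits.\<close>

lemma floorlog_eq_degree:
  assumes "k \<noteq> 0"
  shows "floorlog CARD('b) k = Suc (degree (nat_poly k :: 'b::prime_card mod_ring poly))"
  using assms
proof (induction k rule: less_induct)
  case (less k)
  have lt: "k div CARD('b) < k" using card_gt_1[where 'b = 'b] less.prems by simp
  have rec: "floorlog CARD('b) k = Suc (floorlog CARD('b) (k div CARD('b)))"
    using less.prems card_gt_1[where 'b = 'b] by (subst compute_floorlog) auto
  show ?case
  proof (cases "k div CARD('b) = 0")
    case True
    then have "degree (nat_poly k :: 'b mod_ring poly) = 0"
      by (subst nat_poly_rec) simp
    then show ?thesis using rec True by (simp add: floorlog_def)
  next
    case False
    then show ?thesis
      using less.IH[OF lt False] rec by (subst nat_poly_rec) simp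
  qed
qed

lemma image_nat_poly_less:
  "(nat_poly :: nat \<Rightarrow> 'b::prime_card mod_ring poly) ` {..<CARD('b) ^ m} = {f. f = 0 \<or> degree f < m}"
proof -
  have iff: "k < CARD('b) ^ m \<longleftrightarrow> (nat_poly k :: 'b mod_ring poly) = 0 \<or> degree (nat_poly k :: 'b mod_ring poly) < m" for k
    using floorlog_le_iff[of "CARD('b)" k m] card_gt_1[where 'b = 'b] floorlog_eq_degree[of k, where 'b = 'b]
    by (cases "k = 0") auto
  show ?thesis
  proof (intro equalityI subsetI)
    fix f :: "'b mod_ring poly" assume f: "f \<in> {f. f = 0 \<or> degree f < m}"
    obtain k where "f = nat_poly k" using bij_nat_poly by (metis bij_pointE)
    then show "f \<in> nat_poly ` {..<CARD('b) ^ m}" using f iff[of k] by auto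
  next
    fix f :: "'b mod_ring poly" assume "f \<in> nat_poly ` {..<CARD('b) ^ m}"
    then obtain k where "k < CARD('b) ^ m" "f = nat_poly k" by blast
    then show "f \<in> {f. f = 0 \<or> degree f < m}" using iff[of k] by blast
  qed
qed

lemma gen_polys_image: "gen_polys m = (nat_poly :: nat \<Rightarrow> 'b::prime_card mod_ring poly) ` {..<CARD('b) ^ m} - {0}"
  unfolding image_nat_poly_less by (auto simp: gen_polys_def)

lemma finite_gen_polys: "finite (gen_polys m :: 'b::prime_card mod_ring poly set)"
  by (simp add: gen_polys_image)

lemma card_gen_polys: "card (gen_polys m :: 'b::prime_card mod_ring poly set) = CARD('b) ^ m - 1"
proof -
  have "inj_on (nat_poly :: nat \<Rightarrow> 'b mod_ring poly) {..<CARD('b) ^ m}"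
    by (auto simp: inj_on_def nat_poly_eq_iff)
  then have "card ((nat_poly :: nat \<Rightarrow> 'b mod_ring poly) ` {..<CARD('b) ^ m}) = CARD('b) ^ m"
    by (simp add: card_image)
  moreover have "(0 :: 'b mod_ring poly) \<in> nat_poly ` {..<CARD('b) ^ m}"
    unfolding image_nat_poly_less by simp
  ultimately show ?thesis
    unfolding gen_polys_image by (simp add: card_Diff_singleton)
qed

section \<open>Counting irreducible polynomials\<close>

lemma prime_elem_dvd_prod:
  fixes P :: "'a::comm_semiring_1"
  assumes "finite S" "prime_elem P" "P dvd \<Prod>S"
  shows "\<exists>Q\<in>S. P dvd Q"
  using assms
proof (induction S)
  case empty
  then show ?case by (simp add: prime_elem_def)
next
  case (insert Q S)
  then show ?case by (auto simp: prime_elem_dvd_mult_iff)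
qed

text \<open>Distinct monic irreducibles are coprime: a prime dividing the product divides one of its
  factors, and monic associates coincide.\<close>

lemma prod_monic_irreducibles_dvd:
  fixes F :: "'a::field poly"
  assumes "finite S" "\<And>P. P \<in> S \<Longrightarrow> Factorial_Ring.irreducible P \<and> lead_coeff P = 1 \<and> P dvd F"
  shows "\<Prod>S dvd F"
  using assms
proof (induction S)
  case empty
  show ?case by simp
next
  case (insert P S)
  then have "\<Prod>S dvd F" by simp
  then obtain G where G: "F = \<Prod>S * G" by (rule dvdE)
  have P': "Factorial_Ring.irreducible P" "lead_coeff P = 1" "P dvd F"
    using insert.prems[of P, OF insertI1] by simp_all
  have P: "prime_elem P" by (rule field_poly_irreducible_imp_prime[OF P'(1)])
  have "\<not> P dvd \<Prod>S"
  proof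
    assume "P dvd \<Prod>S"
    from prime_elem_dvd_prod[OF insert.hyps(1) P this]
    obtain Q where Q: "Q \<in> S" "P dvd Q" by (elim bexE)
    have Q': "Factorial_Ring.irreducible Q" "lead_coeff Q = 1"
      using insert.prems[of Q, OF insertI2[OF Q(1)]] by simp_all
    have "Q dvd P"
      using irreducibleD'[OF Q'(1) Q(2)] prime_elem_not_unit[OF P] by (elim disjE) simp_all
    with Q(2) have "P = Q"
      by (intro poly_dvd_antisym) (simp_all only: P' Q')
    with insert.hyps Q(1) show False by simp
  qed
  moreover have "P dvd \<Prod>S * G" using P'(3) by (simp only: G)
  ultimately have "P dvd G" by (metis P prime_elem_dvd_multD)
  then have "\<Prod>S * P dvd \<Prod>S * G" by (rule mult_dvd_mono[OF dvd_refl])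
  moreover have "\<Prod>(insert P S) = \<Prod>S * P"
    using insert.hyps by (subst prod.insert) (auto simp: mult.commute)
  ultimately show ?case by (simp only: G)
qed

section \<open>The factorization of \<open>X ^ (b ^ m) - X\<close>\<close>

lemma irreducible_degree_dvd:
  fixes P :: "'b::prime_card mod_ring poly"
  assumes P: "Factorial_Ring.irreducible P" and dvd: "P dvd monom 1 1 ^ (CARD('b) ^ m) - monom 1 1"
  shows "degree P dvd m"
proof (rule ccontr)
  assume ndvd: "\<not> degree P dvd m"
  define d r where "d = degree P" and "r = m mod d"
  let ?X = "monom 1 1 :: 'b mod_ring poly"
  have d0: "d > 0" using irreducible_degree_field[OF P] by (simp add: d_def)
  have r: "1 \<le> r" "r < d" using ndvd d0 by (auto simp: r_def d_def dvd_eq_mod_eq_0)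
  \<comment> \<open>Modulo \<open>P\<close>, raising to the power \<open>b ^ d\<close> fixes
    \<open>X\<close>, so the exponent \<open>m\<close> may be reduced to \<open>r\<close>. A
    remainder \<open>1 \<le> r < d\<close> contradicts the minimality of \<open>d\<close>.\<close>
  have base: "[?X ^ (CARD('b) ^ d) = ?X] (mod P)"
    using degree_divisor(1)[OF P refl] by (simp add: cong_iff_dvd_diff d_def)
  have k: "[?X ^ (CARD('b) ^ (d * k)) = ?X] (mod P)" for k
  proof (induction k)
    case (Suc k)
    have "?X ^ (CARD('b) ^ (d * Suc k)) = (?X ^ (CARD('b) ^ d)) ^ (CARD('b) ^ (d * k))"
      by (simp add: power_add power_mult)
    then show ?case using cong_pow[OF base, of "CARD('b) ^ (d * k)"] Suc cong_trans by auto
  qed auto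
  have "m = d * (m div d) + r" by (simp add: r_def)
  then have "?X ^ (CARD('b) ^ m) = (?X ^ (CARD('b) ^ (d * (m div d)))) ^ (CARD('b) ^ r)"
    by (metis power_add power_mult)
  then have "[?X ^ (CARD('b) ^ m) = ?X ^ (CARD('b) ^ r)] (mod P)"
    using cong_pow[OF k] by simp
  moreover have "[?X ^ (CARD('b) ^ m) = ?X] (mod P)"
    using dvd by (simp add: cong_iff_dvd_diff)
  ultimately have "[?X ^ (CARD('b) ^ r) = ?X] (mod P)"
    using cong_sym cong_trans by blast
  then have "P dvd ?X ^ (CARD('b) ^ r) - ?X" by (simp add: cong_iff_dvd_diff)
  then show False using degree_divisor(2)[OF P refl r(1)] r(2) by (simp add: d_def)
qed

lemma degree_Frobenius_poly:
  assumes "m \<ge> 1"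
  shows "degree (monom 1 1 ^ (CARD('b) ^ m) - monom 1 1 :: 'b::prime_card mod_ring poly) = CARD('b) ^ m"
proof -
  have "1 < CARD('b) ^ m" using card_gt_1[where 'b='b] assms by (intro one_less_power) auto
  then have "degree (monom 1 1 :: 'b mod_ring poly) < degree (monom 1 1 ^ (CARD('b) ^ m) :: 'b mod_ring poly)"
    unfolding x_pow_n by (simp add: degree_monom_eq)
  then have "degree (monom 1 1 ^ (CARD('b) ^ m) - monom 1 1 :: 'b mod_ring poly) = degree (monom 1 1 ^ (CARD('b) ^ m) :: 'b mod_ring poly)"
    unfolding diff_conv_add_uminus by (intro degree_add_eq_left) simp
  then show ?thesis unfolding x_pow_n by (simp add: degree_monom_eq)
qed

text \<open>In characteristic \<open>b\<close> the derivative of this polynomial is -1, whereas a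
  double factor would divide it.\<close>

lemma not_square_dvd_Frobenius_poly:
  fixes P :: "'b::prime_card mod_ring poly"
  assumes P: "Factorial_Ring.irreducible P" and m: "m \<ge> 1"
  shows "\<not> P * P dvd monom 1 1 ^ (CARD('b) ^ m) - monom 1 1"
proof
  assume "P * P dvd monom 1 1 ^ (CARD('b) ^ m) - monom 1 1"
  then obtain G where G: "monom 1 1 ^ (CARD('b) ^ m) - monom 1 1 = P * P * G" by (elim dvdE)
  have "(of_nat (CARD('b) ^ m) :: 'b mod_ring) = 0" using m by simp
  then have "pderiv (monom 1 1 ^ (CARD('b) ^ m) - monom 1 1 :: 'b mod_ring poly) = - 1"
    unfolding x_pow_n by (simp add: pderiv_diff pderiv_monom del: of_nat_power)
  moreover have "P dvd pderiv (P * P * G)"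
    by (simp add: pderiv_mult)
  ultimately have "P dvd 1" using G by (simp only: dvd_minus_iff)
  then show False using P irreducible_not_unit by blast
qed

lemma finite_monic_irreducibles [simp]:
  "finite (monic_irreducibles m :: 'b::prime_card mod_ring poly set)"
proof (rule finite_subset)
  show "(monic_irreducibles m :: 'b mod_ring poly set) \<subseteq> nat_poly ` {..<CARD('b) ^ Suc m}"
    unfolding image_nat_poly_less by (auto simp: monic_irreducibles_def)
qed auto

text \<open>The product of these divisors still divides \<open>F\<close>, and its degree is
  \<open>m\<close> times their number.\<close>

lemma card_monic_irreducible_divisors:
  fixes F :: "'b::prime_card mod_ring poly"
  assumes "F \<noteq> 0"
  shows "m * card {P \<in> monic_irreducibles m. P dvd F} \<le> degree F"
proof -
  let ?S = "{P \<in> monic_irreducibles m. P dvd F}"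
  have fin: "finite ?S" by (rule finite_subset[OF _ finite_monic_irreducibles[of m]]) auto
  have "degree (\<Prod>?S) = (\<Sum>P\<in>?S. degree P)"
    by (intro degree_prod_eq_sum_degree) (auto simp: monic_irreducibles_def)
  also have "\<dots> = m * card ?S" by (simp add: monic_irreducibles_def)
  finally have "m * card ?S = degree (\<Prod>?S)" by simp
  also have "\<Prod>?S dvd F"
    by (rule prod_monic_irreducibles_dvd[OF fin]) (auto simp: monic_irreducibles_def)
  then have "degree (\<Prod>?S) \<le> degree F" using assms by (rule dvd_imp_degree_le)
  finally show ?thesis .
qed

lemma card_monic_irreducibles_le:
  assumes "m \<ge> 1"
  shows "m * card (monic_irreducibles m :: 'b::prime_card mod_ring poly set) \<le> CARD('b) ^ m"
proof -
  let ?F = "monom 1 1 ^ (CARD('b) ^ m) - monom 1 1 :: 'b mod_ring poly"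
  have deg: "degree ?F = CARD('b) ^ m" by (rule degree_Frobenius_poly[OF assms])
  then have "?F \<noteq> 0" using card_gt_1[where 'b='b] by (metis degree_0 power_not_zero not_one_less_zero)
  then have "m * card {P \<in> monic_irreducibles m. P dvd ?F} \<le> CARD('b) ^ m"
    using card_monic_irreducible_divisors[of ?F m] deg by simp
  moreover have "{P \<in> monic_irreducibles m. P dvd ?F} = monic_irreducibles m"
    using degree_divisor(1) by (auto simp: monic_irreducibles_def)
  ultimately show ?thesis by simp
qed

text \<open>One half of Gauss's formula for the number of irreducible polynomials: \<open>F\<close>
  is squarefree, and each of its irreducible factors has a degree dividing \<open>m\<close>.\<close>

lemma sum_degrees_Frobenius_divisors:
  fixes m :: nat
  defines "F \<equiv> monom 1 1 ^ (CARD('b) ^ m) - monom 1 1 :: 'b::prime_card mod_ring poly"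
  assumes m: "m \<ge> 1"
  shows "CARD('b) ^ m \<le> (\<Sum>d | d dvd m. d * card (monic_irreducibles d :: 'b mod_ring poly set))"
proof -
  define S where "S = {P. Factorial_Ring.irreducible P \<and> lead_coeff P = 1 \<and> P dvd F}"
  have deg: "degree F = CARD('b) ^ m" unfolding F_def by (rule degree_Frobenius_poly[OF m])
  then have F0: "F \<noteq> 0" using card_gt_1[where 'b='b] by (metis degree_0 power_not_zero not_one_less_zero)
  have sub: "S \<subseteq> (\<Union>d\<in>{d. d dvd m}. monic_irreducibles d)"
    using irreducible_degree_dvd by (auto simp: S_def monic_irreducibles_def F_def)
  have fin: "finite {d. d dvd m}" using m by simp
  then have finS: "finite S" using sub finite_subset by (metis (no_types, lifting) finite_UN finite_monic_irreducibles)
  have "\<Prod>S dvd F" by (rule prod_monic_irreducibles_dvd) (use finS in \<open>auto simp: S_def\<close>)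
  then obtain G where G: "F = \<Prod>S * G" by (elim dvdE)
  \<comment> \<open>\<open>S\<close> already exhausts the monic irreducible factors, so an
    irreducible factor of the cofactor \<open>G\<close> would divide \<open>F\<close> twice.\<close>
  have "degree G = 0"
  proof (rule ccontr)
    assume "degree G \<noteq> 0"
    then obtain P R where P: "Factorial_Ring.irreducible P" "G = P * R" "lead_coeff P = 1"
      using irreducible_monic_factor[of G] by auto
    have "P dvd F" by (subst G, subst P(2)) simp
    with P have "P \<in> S" by (simp add: S_def)
    then have "P dvd \<Prod>S" using finS by (rule dvd_prodI[rotated])
    then have "P * P dvd \<Prod>S * (P * R)" by (intro mult_dvd_mono dvd_triv_left)
    then have "P * P dvd F" by (simp only: G flip: P(2))
    then show False using not_square_dvd_Frobenius_poly[OF P(1) m] by (simp add: F_def)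
  qed
  then have "CARD('b) ^ m = degree (\<Prod>S)"
    using F0 G deg by (metis add.right_neutral degree_mult_eq mult_zero_left mult_zero_right)
  also have "\<dots> = (\<Sum>P\<in>S. degree P)"
    by (intro degree_prod_eq_sum_degree) (auto simp: S_def)
  also have "\<dots> \<le> (\<Sum>P\<in>(\<Union>d\<in>{d. d dvd m}. monic_irreducibles d). degree (P :: 'b mod_ring poly))"
    using sub fin by (intro sum_mono2) auto
  also have "\<dots> = (\<Sum>d | d dvd m. \<Sum>P\<in>monic_irreducibles d. degree (P :: 'b mod_ring poly))"
    using fin by (intro sum.UNION_disjoint ballI impI finite_monic_irreducibles)
      (auto simp: monic_irreducibles_def)
  also have "\<dots> = (\<Sum>d | d dvd m. d * card (monic_irreducibles d :: 'b mod_ring poly set))"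
    by (intro sum.cong refl) (simp add: monic_irreducibles_def)
  finally show ?thesis .
qed

text \<open>In Gauss's formula a proper divisor of \<open>m\<close> is at most
  \<open>m div 2\<close>, so all of them together account for at most half of
  \<open>b ^ m\<close>.\<close>

lemma card_monic_irreducibles_ge:
  assumes m: "m \<ge> 1"
  shows "CARD('b) ^ m \<le> 2 * m * card (monic_irreducibles m :: 'b::prime_card mod_ring poly set)"
proof -
  let ?b = "CARD('b)"
  define h where "h = m div 2"
  have b: "2 \<le> ?b" using card_gt_1[where 'b='b] by simp
  have geo: "(\<Sum>d=1..h. ?b ^ d) + 2 \<le> 2 * ?b ^ h" for h
  proof (induction h)
    case (Suc h)
    have "2 * ?b ^ h \<le> ?b * ?b ^ h" using b by (rule mult_right_mono) simp
    with Suc have "(\<Sum>d=1..h. ?b ^ d) + 2 \<le> ?b * ?b ^ h" by (rule le_trans)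
    then show ?case by simp
  qed auto
  have small: "2 * (\<Sum>d=1..h. ?b ^ d) \<le> ?b ^ m"
  proof -
    \<comment> \<open>The generic estimate loses a factor 4, to be paid by \<open>b ^ 2\<close>; the
      two smallest \<open>m\<close> leave no room for it.\<close>
    consider "m = 1" | "m = 2" | "h + 2 \<le> m" using m unfolding h_def by linarith
    then show ?thesis
    proof cases
      case 3
      have "4 \<le> ?b ^ 2" using power_mono[OF b, of 2] by simp
      have "2 * (\<Sum>d=1..h. ?b ^ d) \<le> 4 * ?b ^ h" using geo[of h] by simp
      also have "\<dots> \<le> ?b ^ 2 * ?b ^ h" using \<open>4 \<le> ?b ^ 2\<close> by (rule mult_right_mono) simp
      also have "\<dots> = ?b ^ (h + 2)" by (simp add: power_add power2_eq_square mult.commute)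
      also have "\<dots> \<le> ?b ^ m" using 3 b by (intro power_increasing) simp_all
      finally show ?thesis .
    qed (use b in \<open>auto simp: h_def power2_eq_square\<close>)
  qed
  have split: "{d. d dvd m} = insert m {d. d dvd m \<and> d \<noteq> m}" by auto
  have fin: "finite {d. d dvd m \<and> d \<noteq> m}" using m by (intro finite_subset[of "{d. d dvd m \<and> d \<noteq> m}" "{d. d dvd m}"]) auto
  have "?b ^ m \<le> (\<Sum>d | d dvd m. d * card (monic_irreducibles d :: 'b mod_ring poly set))"
    by (rule sum_degrees_Frobenius_divisors[OF m])
  also have "\<dots> = m * card (monic_irreducibles m :: 'b mod_ring poly set)
     + (\<Sum>d | d dvd m \<and> d \<noteq> m. d * card (monic_irreducibles d :: 'b mod_ring poly set))"
    using fin by (subst split) simp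
  also have "(\<Sum>d | d dvd m \<and> d \<noteq> m. d * card (monic_irreducibles d :: 'b mod_ring poly set))
     \<le> (\<Sum>d | d dvd m \<and> d \<noteq> m. ?b ^ d)"
  proof (intro sum_mono card_monic_irreducibles_le)
    fix d assume "d \<in> {d. d dvd m \<and> d \<noteq> m}"
    then have "d dvd m" by simp
    with m have "0 < d" by (intro dvd_pos_nat[of m d]) simp_all
    then show "1 \<le> d" by simp
  qed
  also have "\<dots> \<le> (\<Sum>d=1..h. ?b ^ d)"
  proof (intro sum_mono2)
    show "{d. d dvd m \<and> d \<noteq> m} \<subseteq> {1..h}"
    proof
      fix d assume "d \<in> {d. d dvd m \<and> d \<noteq> m}"
      then have d: "d dvd m" "d \<noteq> m" by simp_all
      from d(1) obtain k where k: "m = d * k" by (rule dvdE)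
      have "d \<noteq> 0" "k \<noteq> 0" using k m by (intro notI; simp)+
      moreover have "k \<noteq> 1" using k d(2) by (intro notI) simp
      ultimately have "1 \<le> d" "2 \<le> k" by linarith+
      then have "d * 2 \<le> m" unfolding k by (intro mult_le_mono2)
      with \<open>1 \<le> d\<close> show "d \<in> {1..h}" by (simp add: h_def)
    qed
  qed auto
  finally show ?thesis using small by linarith
qed

section \<open>Laurent series and additive characters\<close>

lemma poly_to_laurent_0 [simp]: "poly_to_laurent 0 = 0"
  by (simp add: poly_to_laurent_def)

lemma poly_to_laurent_pCons:
  "poly_to_laurent (pCons a p) = fls_const a + fls_X_inv * poly_to_laurent (p :: 'b::prime_card mod_ring poly)"
  by (cases "p = 0 \<and> a = 0") (auto simp: poly_to_laurent_def map_poly_pCons)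

lemma poly_to_laurent_add:
  "poly_to_laurent (p + q) = poly_to_laurent p + poly_to_laurent (q :: 'b::prime_card mod_ring poly)"
  by (induction p q rule: poly_induct2) (simp_all add: poly_to_laurent_pCons algebra_simps flip: fls_plus_const)

lemma poly_to_laurent_smult:
  "poly_to_laurent (smult c p) = fls_const c * poly_to_laurent (p :: 'b::prime_card mod_ring poly)"
  by (induction p) (simp_all add: poly_to_laurent_pCons algebra_simps flip: fls_const_mult_const)

lemma poly_to_laurent_mult:
  "poly_to_laurent (p * q) = poly_to_laurent p * poly_to_laurent (q :: 'b::prime_card mod_ring poly)"
  by (induction p) (simp_all add: poly_to_laurent_pCons poly_to_laurent_add poly_to_laurent_smult algebra_simps)

lemma poly_to_laurent_sum:
  "poly_to_laurent (\<Sum>i\<in>A. f i :: 'b::prime_card mod_ring poly) = (\<Sum>i\<in>A. poly_to_laurent (f i))"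
  by (induction A rule: infinite_finite_induct) (simp_all add: poly_to_laurent_add)

lemma poly_to_laurent_monom:
  "poly_to_laurent (monom c i :: 'b::prime_card mod_ring poly) = fls_const c * fls_X_inv ^ i"
  by (induction i) (simp_all add: monom_0 monom_Suc poly_to_laurent_pCons)

lemma fls_nth_poly_to_laurent:
  "fls_nth (poly_to_laurent (p :: 'b::prime_card mod_ring poly)) i = (if i \<le> 0 then coeff p (nat (- i)) else 0)"
proof (induction p arbitrary: i)
  case (pCons a p)
  show ?case
    by (auto simp: poly_to_laurent_pCons fls_X_inv_times_conv_shift pCons.IH coeff_pCons nat_diff_distrib split: nat.splits)
qed simp

lemma poly_to_laurent_eq_0_iff [simp]:
  "poly_to_laurent (p :: 'b::prime_card mod_ring poly) = 0 \<longleftrightarrow> p = 0"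
proof
  assume "poly_to_laurent p = 0"
  then have "coeff p i = 0" for i
    using fls_nth_poly_to_laurent[of p "- int i"] by simp
  then show "p = 0" by (simp add: poly_eq_iff)
qed simp

lemma subdegree_poly_to_laurent:
  assumes "p \<noteq> 0"
  shows "fls_subdegree (poly_to_laurent (p :: 'b::prime_card mod_ring poly)) = - int (degree p)"
proof (rule fls_subdegree_eqI)
  show "fls_nth (poly_to_laurent p) (- int (degree p)) \<noteq> 0"
    using assms by (simp add: fls_nth_poly_to_laurent)
  show "fls_nth (poly_to_laurent p) k = 0" if "k < - int (degree p)" for k
    using that by (auto simp: fls_nth_poly_to_laurent intro!: coeff_eq_0)
qed

lemma fls_nth_monom_mult:
  "fls_nth (poly_to_laurent (monom c i) * L) n = c * fls_nth (L :: 'b::prime_card mod_ring fls) (n + int i)"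
  by (simp add: poly_to_laurent_monom mult.assoc fls_X_inv_power_times_conv_shift(1))

text \<open>The digit pairing in the exponent of a Walsh function is a single coefficient, that of
  \<open>1/x\<close>, of the product \<open>k(x) L\<close>. In this form it is visibly linear in
  \<open>L\<close>.\<close>

lemma fls_nth_nat_poly_mult:
  "fls_nth (poly_to_laurent (nat_poly k) * L) 1 =
    (\<Sum>i<floorlog CARD('b) k. of_nat (nat_digit CARD('b) k i) * fls_nth (L :: 'b::prime_card mod_ring fls) (int (Suc i)))"
  by (simp add: nat_poly_def poly_to_laurent_sum sum_distrib_right fls_nth_sum fls_nth_monom_mult add.commute)

section \<open>The additive character of the prime field and Walsh functions at lattice
  points\<close>

definition add_char :: "'b::prime_card mod_ring \<Rightarrow> complex" where
  "add_char a = exp (2 * of_real pi * \<i> / of_nat CARD('b)) ^ nat (to_int_mod_ring a)"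

text \<open>The base is a \<open>b\<close>-th root of unity, so any representative of the residue
  class may serve as exponent.\<close>

lemma add_char_of_nat:
  "add_char (of_nat n :: 'b::prime_card mod_ring) = exp (2 * of_real pi * \<i> / of_nat CARD('b)) ^ n"
proof -
  let ?w = "exp (2 * of_real pi * \<i> / of_nat CARD('b)) :: complex"
  have "?w ^ CARD('b) = 1" by (simp flip: exp_of_nat_mult)
  then have "?w ^ (CARD('b) * (n div CARD('b)) + n mod CARD('b)) = ?w ^ (n mod CARD('b))"
    by (simp only: power_add power_mult power_one mult_1_left)
  then show ?thesis by (simp add: add_char_def to_int_of_nat)
qed

lemma add_char_0 [simp]: "add_char 0 = 1"
  by (simp add: add_char_def)

lemma add_char_add: "add_char (a + b) = add_char a * add_char (b :: 'b::prime_card mod_ring)"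
proof -
  have "add_char (of_nat x + of_nat y :: 'b mod_ring) = add_char (of_nat x :: 'b mod_ring) * add_char (of_nat y :: 'b mod_ring)" for x y
    by (simp only: add_char_of_nat power_add flip: of_nat_add)
  from this[of "nat (to_int_mod_ring a)" "nat (to_int_mod_ring b)"] show ?thesis
    by (simp only: of_nat_to_int)
qed

lemma add_char_sum: "add_char (\<Sum>i\<in>A. f i :: 'b::prime_card mod_ring) = (\<Prod>i\<in>A. add_char (f i))"
  by (induction A rule: infinite_finite_induct) (simp_all add: add_char_add)

lemma add_char_neq_1:
  assumes "(a :: 'b::prime_card mod_ring) \<noteq> 0"
  shows "add_char a \<noteq> 1"
proof
  assume *: "add_char a = 1"
  define j where "j = nat (to_int_mod_ring a)"
  have j: "j < CARD('b)" using to_int_bounds[of a] by (simp add: j_def nat_less_iff)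
  have "exp (2 * of_real pi * \<i> * of_nat j / of_nat CARD('b) :: complex) = 1"
    using * by (simp add: add_char_def j_def mult_ac flip: exp_of_nat_mult)
  then have "CARD('b) dvd j"
    using complex_root_unity_eq_1[of "CARD('b)" j] card_gt_1[where 'b='b] by simp
  with j have "j = 0" by (metis nat_dvd_not_less neq0_conv)
  then have "a = 0" using of_nat_to_int[of a] by (simp add: j_def)
  with assms show False by simp
qed

lemma phi_bounds:
  "0 \<le> phi d (L :: 'b::prime_card mod_ring fls)" "phi d L < 1"
proof -
  show "0 \<le> phi d L"
    unfolding phi_def by (intro sum_nonneg divide_nonneg_nonneg) (auto simp: to_int_bounds)
  have "phi d L \<le> 1 - 1 / real CARD('b) ^ d"
  proof (induction d)
    case (Suc d)
    let ?c = "real_of_int (to_int_mod_ring (fls_nth L (int (Suc d))))"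
    have "?c \<le> real CARD('b) - 1"
      using to_int_bounds(2)[of "fls_nth L (int (Suc d))"] by linarith
    then have "?c / real CARD('b) ^ Suc d \<le> (real CARD('b) - 1) / real CARD('b) ^ Suc d"
      by (intro divide_right_mono) auto
    also have "\<dots> = 1 / real CARD('b) ^ d - 1 / real CARD('b) ^ Suc d"
      by (simp add: diff_divide_distrib)
    finally show ?case using Suc by (simp add: phi_def)
  qed (simp add: phi_def)
  moreover have "0 < 1 / real CARD('b) ^ d" by simp
  ultimately show "phi d L < 1" by linarith
qed

text \<open>A finite expansion ends in zeros, which differ from \<open>b - 1\<close>, so it is the
  one selected by \<open>frac_digit_unique\<close>.\<close>

lemma frac_digit_phi:
  assumes "i < d"
  shows "frac_digit CARD('b) (phi d L) (Suc i) = nat (to_int_mod_ring (fls_nth (L :: 'b::prime_card mod_ring fls) (int (Suc i))))"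
proof -
  define \<xi> where "\<xi> j = (if 1 \<le> j \<and> j \<le> d then nat (to_int_mod_ring (fls_nth L (int j))) else 0)" for j
  have "frac_digit CARD('b) (phi d L) (Suc i) = \<xi> (Suc i)"
  proof (rule frac_digit_unique)
    show "1 < CARD('b)" by (rule card_gt_1)
    show "\<xi> i < CARD('b)" for i
      using to_int_bounds[of "fls_nth L (int i)"] by (auto simp: \<xi>_def nat_less_iff)
    have "\<xi> j \<noteq> CARD('b) - 1" if "j > d" for j
      using that card_gt_1[where 'b='b] by (simp add: \<xi>_def)
    then show "\<exists>\<^sub>\<infinity>i. \<xi> i \<noteq> CARD('b) - 1"
      unfolding INFM_nat by (metis gt_ex less_imp_le max.strict_coboundedI1 max.strict_coboundedI2 dual_order.strict_trans linorder_less_linear less_trans)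
    have "(\<lambda>i. real (\<xi> (Suc i)) / real CARD('b) ^ Suc i) sums (\<Sum>i<d. real (\<xi> (Suc i)) / real CARD('b) ^ Suc i)"
      by (intro sums_finite) (auto simp: \<xi>_def)
    also have "(\<Sum>i<d. real (\<xi> (Suc i)) / real CARD('b) ^ Suc i) = (\<Sum>i=1..d. real (\<xi> i) / real CARD('b) ^ i)"
      by (rule sum.reindex_bij_witness[of _ "\<lambda>i. i - 1" Suc]) auto
    also have "\<dots> = phi d L"
      unfolding phi_def by (intro sum.cong) (auto simp: \<xi>_def to_int_bounds)
    finally show "(\<lambda>i. real (\<xi> (Suc i)) / real CARD('b) ^ Suc i) sums phi d L" .
  qed
  also have "\<dots> = nat (to_int_mod_ring (fls_nth L (int (Suc i))))"
    using assms by (simp add: \<xi>_def)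
  finally show ?thesis .
qed

text \<open>The bound on \<open>d\<close> ensures that truncation removes no digit entering the
  Walsh function.\<close>

lemma wal_phi:
  assumes "floorlog CARD('b) k \<le> d"
  shows "wal CARD('b) k (phi d L) = add_char (fls_nth (poly_to_laurent (nat_poly k) * (L :: 'b::prime_card mod_ring fls)) 1)"
proof -
  have "wal CARD('b) k (phi d L) = add_char (of_nat (\<Sum>i<floorlog CARD('b) k. nat_digit CARD('b) k i * frac_digit CARD('b) (phi d L) (Suc i)) :: 'b mod_ring)"
    by (simp only: wal_def add_char_of_nat)
  also have "(of_nat (\<Sum>i<floorlog CARD('b) k. nat_digit CARD('b) k i * frac_digit CARD('b) (phi d L) (Suc i)) :: 'b mod_ring)
      = (\<Sum>i<floorlog CARD('b) k. of_nat (nat_digit CARD('b) k i) * fls_nth L (int (Suc i)))"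
    unfolding of_nat_sum
    by (intro sum.cong refl) (use assms in \<open>auto simp: frac_digit_phi of_nat_to_int simp del: of_nat_Suc\<close>)
  finally show ?thesis by (simp only: fls_nth_nat_poly_mult)
qed

lemma lattice_point_in_unit_cube: "lattice_point s (p :: 'b::prime_card mod_ring poly) q d n \<in> unit_cube s"
  by (auto simp: lattice_point_def unit_cube_def phi_bounds)

lemma wal_vec_lattice_point:
  fixes p :: "'b::prime_card mod_ring poly"
  assumes "\<And>j. j \<in> {1..s} \<Longrightarrow> floorlog CARD('b) (k j) \<le> d"
  shows "wal_vec CARD('b) s k (lattice_point s p q d n) =
    add_char (fls_nth (poly_to_laurent (nat_poly n * (\<Sum>j\<in>{1..s}. nat_poly (k j) * q j)) / poly_to_laurent p) 1)"
proof -
  have "wal_vec CARD('b) s k (lattice_point s p q d n) =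
      (\<Prod>j\<in>{1..s}. add_char (fls_nth (poly_to_laurent (nat_poly (k j)) * (poly_to_laurent (nat_poly n * q j) / poly_to_laurent p)) 1))"
    unfolding wal_vec_def by (intro prod.cong refl) (simp add: lattice_point_def wal_phi assms)
  also have "\<dots> = add_char (fls_nth (\<Sum>j\<in>{1..s}. poly_to_laurent (nat_poly (k j)) * (poly_to_laurent (nat_poly n * q j) / poly_to_laurent p)) 1)"
    by (simp add: add_char_sum fls_nth_sum)
  also have "(\<Sum>j\<in>{1..s}. poly_to_laurent (nat_poly (k j)) * (poly_to_laurent (nat_poly n * q j) / poly_to_laurent p))
     = poly_to_laurent (nat_poly n * (\<Sum>j\<in>{1..s}. nat_poly (k j) * q j)) / poly_to_laurent p"
    by (simp add: poly_to_laurent_mult poly_to_laurent_sum sum_distrib_left sum_divide_distrib mult_ac)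
  finally show ?thesis .
qed

text \<open>Orthogonality: summing over the additive group of polynomials of degree below
  \<open>m\<close> kills every nontrivial character, so it is enough to find one \<open>f0\<close>
  where the character is not 1.\<close>

lemma add_char_sum_eq_0:
  fixes p H :: "'b::prime_card mod_ring poly"
  assumes p: "degree p = m" "p \<noteq> 0" and H: "\<not> p dvd H"
  shows "(\<Sum>n<CARD('b) ^ m. add_char (fls_nth (poly_to_laurent (nat_poly n * H) / poly_to_laurent p) 1)) = 0"
proof -
  let ?V = "{f. f = 0 \<or> degree f < m} :: 'b mod_ring poly set"
  let ?c = "\<lambda>f. add_char (fls_nth (poly_to_laurent (f * H) / poly_to_laurent p) 1)"
  define r where "r = H mod p"
  have r0: "r \<noteq> 0" using H by (simp add: r_def mod_eq_0_iff_dvd)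
  then have dr: "degree r < m" using degree_mod_less[of p H] p by (simp add: r_def)
  \<comment> \<open>With \<open>r = H mod p\<close>, the leading term of \<open>r / p\<close> stands
    at index \<open>m - degree r\<close>; multiplication by \<open>f0\<close> moves it to index 1,
    where the character reads it off. The polynomial part of \<open>H / p\<close> does not reach
    positive indices.\<close>
  define f0 where "f0 = (monom 1 (m - 1 - degree r) :: 'b mod_ring poly)"
  have f0V: "f0 \<in> ?V" using dr by (simp add: f0_def degree_monom_eq)
  let ?R = "poly_to_laurent r / poly_to_laurent p"
  have "H = p * (H div p) + r" by (simp add: r_def)
  then have eq: "poly_to_laurent H / poly_to_laurent p = poly_to_laurent (H div p) + ?R"
    using p by (metis poly_to_laurent_add poly_to_laurent_mult add_divide_distrib nonzero_mult_div_cancel_left poly_to_laurent_eq_0_iff)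
  have "fls_nth (poly_to_laurent (f0 * H) / poly_to_laurent p) 1
      = fls_nth (poly_to_laurent f0 * (poly_to_laurent H / poly_to_laurent p)) 1"
    by (simp only: poly_to_laurent_mult times_divide_eq_right)
  also have "\<dots> = fls_nth (poly_to_laurent H / poly_to_laurent p) (int (m - degree r))"
    using dr unfolding f0_def fls_nth_monom_mult by (simp add: of_nat_diff)
  also have "\<dots> = fls_nth ?R (int (m - degree r))"
    using dr by (simp add: eq fls_nth_poly_to_laurent)
  also have "int (m - degree r) = fls_subdegree ?R"
    using r0 p dr by (simp add: fls_divide_subdegree subdegree_poly_to_laurent of_nat_diff)
  also have "fls_nth ?R (fls_subdegree ?R) \<noteq> 0" using r0 p by simp
  finally have ne: "?c f0 \<noteq> 1" by (rule add_char_neq_1)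
  \<comment> \<open>Translation by \<open>f0\<close> permutes the group and multiplies the sum by
    \<open>?c f0\<close>, which is not 1.\<close>
  have "(\<Sum>f\<in>?V. ?c f) = (\<Sum>f\<in>?V. ?c (f + f0))"
    by (rule sum.reindex_bij_witness[of _ "\<lambda>f. f + f0" "\<lambda>f. f - f0"])
      (use f0V in \<open>auto intro: degree_add_less degree_diff_less\<close>)
  also have "\<dots> = (\<Sum>f\<in>?V. ?c f0 * ?c f)"
    by (intro sum.cong refl)
      (simp only: distrib_right poly_to_laurent_add add_divide_distrib fls_plus_nth add_char_add
        mult.commute[of "?c f0"])
  also have "\<dots> = ?c f0 * (\<Sum>f\<in>?V. ?c f)"
    by (simp only: sum_distrib_left)
  finally have "(\<Sum>f\<in>?V. ?c f) = 0" using ne by simp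
  moreover have "(\<Sum>n<CARD('b) ^ m. ?c (nat_poly n)) = (\<Sum>f\<in>?V. ?c f)"
    unfolding image_nat_poly_less[symmetric] by (subst sum.reindex) (auto simp: inj_on_def nat_poly_eq_iff)
  ultimately show ?thesis by simp
qed

lemma add_char_sum_dvd:
  fixes p H :: "'b::prime_card mod_ring poly"
  assumes p: "p \<noteq> 0" and H: "p dvd H"
  shows "add_char (fls_nth (poly_to_laurent (nat_poly n * H) / poly_to_laurent p) 1) = 1"
proof -
  obtain G where "nat_poly n * H = p * G" using H by (metis dvd_mult dvdE)
  then show ?thesis using p by (simp add: poly_to_laurent_mult fls_nth_poly_to_laurent)
qed

section \<open>The error of a lattice rule and the dual lattice\<close>

text \<open>Otherwise the simplifier turns the index set \<open>{1..s}\<close> into \<open>{Suc 0..s}\<close> in some facts only.\<close>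
declare One_nat_def [simp del]

lemma has_sum_finite_sum:
  fixes f :: "'i \<Rightarrow> 'k \<Rightarrow> 'c::topological_comm_monoid_add"
  assumes "\<And>i. i \<in> I \<Longrightarrow> (f i has_sum S i) A"
  shows "((\<lambda>x. \<Sum>i\<in>I. f i x) has_sum (\<Sum>i\<in>I. S i)) A"
  using assms by (induction I rule: infinite_finite_induct) (auto intro!: has_sum_add)

text \<open>Here pointwise convergence is eventual equality. A finite \<open>F\<close> captures all
  but \<open>e / 2\<close> of the sum of \<open>M\<close>; for large \<open>d\<close> the terms
  agree on \<open>F\<close>, and outside \<open>F\<close> they differ by at most
  \<open>2 * M k\<close>.\<close>

lemma infsum_dominated_convergence:
  fixes a :: "nat \<Rightarrow> 'k \<Rightarrow> 'c::banach"
  assumes M: "M summable_on A" and le: "\<And>d k. k \<in> A \<Longrightarrow> norm (a d k) \<le> M k"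
    and ev: "\<And>k. k \<in> A \<Longrightarrow> eventually (\<lambda>d. a d k = b k) sequentially"
  shows "(\<lambda>d. infsum (a d) A) \<longlonglongrightarrow> infsum b A"
proof (rule LIMSEQ_I)
  fix e :: real assume e: "e > 0"
  have leb: "norm (b k) \<le> M k" if k: "k \<in> A" for k
  proof -
    obtain N where "\<And>d. d \<ge> N \<Longrightarrow> a d k = b k"
      using ev[OF k] unfolding eventually_sequentially by blast
    from this[of N] show ?thesis using le[OF k, of N] by simp
  qed
  have sa: "a d summable_on A" for d
    by (rule abs_summable_summable, rule summable_on_comparison_test[OF M]) (use le in auto)
  have sb: "b summable_on A"
    by (rule abs_summable_summable, rule summable_on_comparison_test[OF M]) (use leb in auto)
  have "(M has_sum infsum M A) A" using M by simp
  then have "eventually (\<lambda>F. dist (sum M F) (infsum M A) < e / 2) (finite_subsets_at_top A)"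
    unfolding has_sum_def using tendstoD e half_gt_zero by blast
  then obtain F where F: "finite F" "F \<subseteq> A" "dist (sum M F) (infsum M A) < e / 2"
    unfolding eventually_finite_subsets_at_top by blast
  have MD: "M summable_on (A - F)" using summable_on_subset_banach[OF M] by blast
  have "infsum M (A - F) = infsum M A - sum M F"
    using infsum_Diff[OF M _ F(2)] F(1) by simp
  with F(3) have small: "infsum M (A - F) < e / 2" unfolding dist_real_def by linarith
  have "eventually (\<lambda>d. \<forall>k\<in>F. a d k = b k) sequentially"
    using F ev by (intro eventually_ball_finite) auto
  then obtain N where N: "\<And>d k. d \<ge> N \<Longrightarrow> k \<in> F \<Longrightarrow> a d k = b k"
    unfolding eventually_sequentially by blast
  have "norm (infsum (a d) A - infsum b A) < e" if "d \<ge> N" for d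
  proof -
    have le2: "norm (a d k - b k) \<le> 2 * M k" if "k \<in> A" for k
      using norm_triangle_ineq4[of "a d k" "b k"] le[OF that, of d] leb[OF that] by simp
    have "((\<lambda>k. - b k) has_sum - infsum b A) A"
      using sb by (simp add: has_sum_uminus)
    from has_sum_add[OF has_sum_infsum[OF sa] this]
    have "((\<lambda>k. a d k - b k) has_sum (infsum (a d) A - infsum b A)) A" by simp
    then have sd: "((\<lambda>k. a d k - b k) has_sum (infsum (a d) A - infsum b A)) (A - F)"
      by (rule iffD1[OF has_sum_cong_neutral, rotated -1]) (use N[OF that] in auto)
    have "norm (infsum (a d) A - infsum b A) \<le> infsum (\<lambda>k. 2 * M k) (A - F)"
      by (rule norm_infsum_le[OF sd has_sum_infsum])
        (use summable_on_cmult_right[OF MD, of 2] le2 in auto)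
    also have "\<dots> = 2 * infsum M (A - F)" by (rule infsum_cmult_right) (use MD in simp)
    finally show ?thesis using small by simp
  qed
  then show "\<exists>N. \<forall>d\<ge>N. norm (infsum (a d) A - infsum b A) < e" by blast
qed

lemma norm_wal_vec [simp]: "cmod (wal_vec b s k x) = 1"
proof -
  have "cmod (exp (2 * of_real pi * \<i> / of_nat b)) = 1"
    using norm_exp_i_times[of "2 * pi / b"] by (simp add: mult_ac)
  then show ?thesis by (simp add: wal_vec_def wal_def norm_power flip: prod_norm)
qed

lemma walsh_coeff_zero:
  "walsh_coeff b s f (\<lambda>j\<in>{1..s}. 0) = of_real (cube_integral s f)"
proof -
  have "wal_vec b s (\<lambda>j\<in>{1..s}. 0) x = 1" for x
    by (simp add: wal_vec_def wal_def floorlog_def)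
  then show ?thesis
    unfolding walsh_coeff_def cube_integral_def set_lebesgue_integral_def
    by (simp add: scaleR_conv_of_real flip: of_real_mult)
qed

lemma zero_in_dual_lattice: "(\<lambda>j\<in>{1..s}. 0) \<in> dual_lattice s p q"
  by (simp add: dual_lattice_def)

lemma dual_lattice_iff:
  "k \<in> dual_lattice s p q \<longleftrightarrow> k \<in> nat_vecs s \<and> p dvd (\<Sum>j\<in>{1..s}. nat_poly (k j) * q j)"
  by (simp add: dual_lattice_def cong_0_iff)

text \<open>For \<open>d\<close> large in terms of \<open>k\<close>, the rule integrates the Walsh
  function of \<open>k\<close> to 1 or 0 according to whether \<open>k\<close> is dual. As this
  threshold is not uniform in \<open>k\<close>, the absolute convergence of the Walsh series is
  needed as a majorant.\<close>

lemma lattice_rule_tendsto: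
  fixes p :: "'b::prime_card mod_ring poly"
  assumes f: "f \<in> walsh_space CARD('b) s \<alpha> \<gamma>" and p: "degree p = m" "p \<noteq> 0"
  shows "(\<lambda>d. complex_of_real (lattice_rule_trunc s m f p q d)) \<longlonglongrightarrow>
    infsum (walsh_coeff CARD('b) s f) (dual_lattice s p q)"
proof -
  let ?c = "walsh_coeff CARD('b) s f"
  let ?x = "lattice_point s p q"
  define B where "B = CARD('b) ^ m"
  have B: "B > 0" by (simp add: B_def)
  define a where "a d k = (\<Sum>n<B. ?c k * wal_vec CARD('b) s k (?x d n)) / of_nat B" for d k
  define L where "L k = (if k \<in> dual_lattice s p q then ?c k else 0)" for k
  have summ: "(\<lambda>k. cmod (?c k)) summable_on nat_vecs s"
    and rep: "\<And>x. x \<in> unit_cube s \<Longrightarrow> ((\<lambda>k. ?c k * wal_vec CARD('b) s k x) has_sum of_real (f x)) (nat_vecs s)"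
    using f by (simp_all add: walsh_space_def)
  have sum_eq: "infsum (a d) (nat_vecs s) = of_real (lattice_rule_trunc s m f p q d)" for d
  proof -
    have "((\<lambda>k. \<Sum>n<B. ?c k * wal_vec CARD('b) s k (?x d n)) has_sum (\<Sum>n<B. of_real (f (?x d n)))) (nat_vecs s)"
      by (intro has_sum_finite_sum rep lattice_point_in_unit_cube)
    then have "(a d has_sum (\<Sum>n<B. of_real (f (?x d n))) / of_nat B) (nat_vecs s)"
      unfolding a_def divide_inverse by (rule has_sum_cmult_left)
    then have "infsum (a d) (nat_vecs s) = (\<Sum>n<B. of_real (f (?x d n))) / of_nat B"
      by (rule infsumI)
    also have "\<dots> = of_real (lattice_rule_trunc s m f p q d)"
      by (simp add: lattice_rule_trunc_def poly_lattice_def B_def sum_unfold_sum_mset multiset.map_comp comp_def)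
    finally show ?thesis .
  qed
  have bound: "norm (a d k) \<le> cmod (?c k)" for d k
  proof -
    have "norm (\<Sum>n<B. ?c k * wal_vec CARD('b) s k (?x d n)) \<le> (\<Sum>n<B. cmod (?c k))"
      by (rule sum_norm_le) (simp add: norm_mult)
    then show ?thesis using B by (simp add: a_def norm_divide field_simps)
  qed
  have limit: "eventually (\<lambda>d. a d k = L k) sequentially" if k: "k \<in> nat_vecs s" for k
  proof -
    let ?H = "\<Sum>j\<in>{1..s}. nat_poly (k j) * q j"
    \<comment> \<open>The sum of the digit counts is a convenient bound for all of them at
      once.\<close>
    have "a d k = L k" if d: "d \<ge> (\<Sum>j\<in>{1..s}. floorlog CARD('b) (k j))" for d
    proof -
      have "floorlog CARD('b) (k j) \<le> d" if "j \<in> {1..s}" for j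
        using member_le_sum[of j "{1..s}" "\<lambda>j. floorlog CARD('b) (k j)"] that d by simp
      then have w: "wal_vec CARD('b) s k (?x d n) = add_char (fls_nth (poly_to_laurent (nat_poly n * ?H) / poly_to_laurent p) 1)" for n
        by (rule wal_vec_lattice_point)
      show ?thesis
      proof (cases "p dvd ?H")
        case True
        then have "wal_vec CARD('b) s k (?x d n) = 1" for n
          unfolding w by (rule add_char_sum_dvd[OF p(2)])
        then show ?thesis using True k B by (simp add: a_def L_def dual_lattice_iff)
      next
        case False
        then have "(\<Sum>n<B. wal_vec CARD('b) s k (?x d n)) = 0"
          unfolding w B_def by (rule add_char_sum_eq_0[OF p])
        then show ?thesis using False k by (simp add: a_def L_def dual_lattice_iff flip: sum_distrib_left)
      qed
    qed
    then show ?thesis unfolding eventually_sequentially by blast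
  qed
  have "(\<lambda>d. infsum (a d) (nat_vecs s)) \<longlonglongrightarrow> infsum L (nat_vecs s)"
    by (rule infsum_dominated_convergence[OF summ bound limit])
  moreover have "infsum L (nat_vecs s) = infsum ?c (dual_lattice s p q)"
    by (rule infsum_cong_neutral) (auto simp: L_def dual_lattice_iff)
  ultimately show ?thesis by (simp add: sum_eq)
qed

lemma lattice_rule_error:
  fixes p :: "'b::prime_card mod_ring poly"
  assumes f: "f \<in> walsh_space CARD('b) s \<alpha> \<gamma>" and p: "degree p = m" "p \<noteq> 0"
  shows "\<bar>lattice_rule s m f p q - cube_integral s f\<bar> \<le>
    (\<Sum>\<^sub>\<infinity>k\<in>dual_lattice s p q - {\<lambda>j\<in>{1..s}. 0}. cmod (walsh_coeff CARD('b) s f k))"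
proof -
  let ?c = "walsh_coeff CARD('b) s f" and ?z = "\<lambda>j\<in>{1..s}. 0 :: nat"
  let ?D = "dual_lattice s p q"
  define S where "S = infsum ?c ?D"
  have lim: "(\<lambda>d. complex_of_real (lattice_rule_trunc s m f p q d)) \<longlonglongrightarrow> S"
    unfolding S_def by (rule lattice_rule_tendsto[OF f p])
  then have "lattice_rule_trunc s m f p q \<longlonglongrightarrow> Re S"
    using tendsto_Re[OF lim] by simp
  then have rule: "lattice_rule s m f p q = Re S"
    unfolding lattice_rule_def by (rule limI)
  \<comment> \<open>A limit of real numbers is real, so the complex sum \<open>S\<close> equals the
    value of the rule.\<close>
  have "Im S = 0" using tendsto_Im[OF lim] by (simp add: LIMSEQ_const_iff)
  then have S: "S = of_real (lattice_rule s m f p q)" by (simp add: rule complex_eq_iff)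
  have sub: "?D \<subseteq> nat_vecs s" by (auto simp: dual_lattice_def)
  have "(\<lambda>k. cmod (?c k)) summable_on nat_vecs s"
    using f by (simp add: walsh_space_def)
  from summable_on_subset_banach[OF this sub]
  have absD: "(\<lambda>k. cmod (?c k)) summable_on ?D" .
  from summable_on_subset_banach[OF this Diff_subset]
  have abs: "(\<lambda>k. cmod (?c k)) summable_on ?D - {?z}" .
  have has: "(?c has_sum S) ?D"
    unfolding S_def by (rule has_sum_infsum[OF abs_summable_summable[OF absD]])
  have "(?c has_sum (S - ?c ?z)) (?D - {?z})"
    by (rule has_sum_Diff[OF has]) (simp_all add: zero_in_dual_lattice has_sum_finiteI)
  then have "(?c has_sum (of_real (lattice_rule s m f p q - cube_integral s f))) (?D - {?z})"
    by (simp only: S walsh_coeff_zero of_real_diff)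
  from norm_infsum_le[OF this has_sum_infsum[OF abs]] show ?thesis
    by (simp only: norm_of_real order_refl)
qed

section \<open>Random generating vectors\<close>

lemma smallest_subset: "smallest ord v A N \<subseteq> A"
  by (auto simp: smallest_def)

text \<open>Ties being broken linearly, the number of predecessors is a bijection from \<open>A\<close> to \<open>{..<card A}\<close>.\<close>
lemma card_smallest:
  assumes lin: "linear_order_on A ord" and fin: "finite A" and N: "N \<le> card A"
  shows "card (smallest ord v A N) = N"
proof -
  define pred where "pred y x \<longleftrightarrow> v y < v x \<or> (v y = v x \<and> y \<noteq> x \<and> (y, x) \<in> ord)" for y x
  define rk where "rk x = card {y\<in>A. pred y x}" for x
  have tot: "pred y x \<or> pred x y" if "x \<in> A" "y \<in> A" "x \<noteq> y" for x y
    using lin that unfolding linear_order_on_def total_on_def pred_def by (metis linorder_neqE)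
  have irr: "\<not> pred x x" for x by (simp add: pred_def)
  have antis: "antisym ord" "trans ord"
    using lin by (simp_all add: linear_order_on_def partial_order_on_def preorder_on_def)
  have trans: "pred z x" if "pred z y" "pred y x" for x y z
  proof -
    have "v z \<le> v y" "v y \<le> v x" using that by (auto simp: pred_def)
    show ?thesis
    proof (cases "v z < v x")
      case False
      then have eq: "v z = v y" "v y = v x" using \<open>v z \<le> v y\<close> \<open>v y \<le> v x\<close> by linarith+
      then have o: "(z, y) \<in> ord" "(y, x) \<in> ord" "z \<noteq> y" using that by (auto simp: pred_def)
      then have "(z, x) \<in> ord" using antis(2) by (meson transE)
      moreover have "z \<noteq> x" using o antis(1) by (meson antisymD)
      ultimately show ?thesis using eq by (simp add: pred_def)
    qed (simp add: pred_def)
  qed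
  have rk_less: "rk y < rk x" if "x \<in> A" "y \<in> A" "pred y x" for x y
    unfolding rk_def
  proof (rule psubset_card_mono)
    show "finite {y \<in> A. pred y x}" using fin by simp
    have "{z \<in> A. pred z y} \<subseteq> {z \<in> A. pred z x}" using trans[OF _ that(3)] by blast
    moreover have "y \<in> {z \<in> A. pred z x}" "y \<notin> {z \<in> A. pred z y}" using that irr by auto
    ultimately show "{z \<in> A. pred z y} \<subset> {z \<in> A. pred z x}" by blast
  qed
  have inj: "inj_on rk A"
    by (rule inj_onI) (metis rk_less tot less_irrefl)
  have "rk ` A \<subseteq> {..<card A}"
  proof
    fix i assume "i \<in> rk ` A"
    then obtain x where x: "x \<in> A" "i = rk x" by blast
    have "{y \<in> A. pred y x} \<subset> A" using x irr by blast
    then show "i \<in> {..<card A}" using psubset_card_mono[OF fin] x by (simp add: rk_def)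
  qed
  then have im: "rk ` A = {..<card A}"
    by (rule card_subset_eq[OF finite_lessThan]) (simp add: card_image[OF inj])
  have sm: "smallest ord v A N = {x\<in>A. rk x < N}"
    by (simp add: smallest_def rk_def pred_def)
  have "rk ` {x\<in>A. rk x < N} = {i \<in> rk ` A. i < N}" by blast
  also have "\<dots> = {..<N}" using N by (auto simp: im)
  finally have "card (rk ` {x\<in>A. rk x < N}) = N" by simp
  moreover have "inj_on rk {x\<in>A. rk x < N}" by (rule inj_on_subset[OF inj]) blast
  ultimately show ?thesis by (simp add: sm card_image)
qed

text \<open>Fewer than \<open>N\<close> elements have a value strictly below that of a selected
  \<open>x\<close>. This is the counting input for Markov's inequality.\<close>

lemma card_ge_smallest:
  assumes fin: "finite A" and x: "x \<in> smallest ord v A N"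
  shows "card A < card {y\<in>A. v x \<le> v y} + N"
proof -
  have xA: "x \<in> A" and c: "card {y\<in>A. v y < v x \<or> (v y = v x \<and> y \<noteq> x \<and> (y, x) \<in> ord)} < N"
    using x by (auto simp: smallest_def)
  have "card {y\<in>A. v y < v x} \<le> card {y\<in>A. v y < v x \<or> (v y = v x \<and> y \<noteq> x \<and> (y, x) \<in> ord)}"
    by (rule card_mono) (use fin in auto)
  moreover have "{y\<in>A. v x \<le> v y} \<union> {y\<in>A. v y < v x} = A" by auto
  then have "card A \<le> card {y\<in>A. v x \<le> v y} + card {y\<in>A. v y < v x}"
    using card_Un_le[of "{y\<in>A. v x \<le> v y}" "{y\<in>A. v y < v x}"] by simp
  ultimately show ?thesis using c by linarith
qed

section \<open>Counting the possible outputs of the component-by-component construction\<close>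

lemma cbc_reachable_pos: "cbc_reachable ord m \<alpha> \<gamma> \<tau> p l q \<Longrightarrow> 1 \<le> l"
  by (induction rule: cbc_reachable.induct) auto

lemma cbc_vectors_1: "cbc_vectors ord m 1 \<alpha> \<gamma> \<tau> p = {\<lambda>j\<in>{1}. 1}"
proof -
  have "cbc_reachable ord m \<alpha> \<gamma> \<tau> p 1 q \<longleftrightarrow> q = (\<lambda>j\<in>{1}. 1)" for q
  proof
    assume "cbc_reachable ord m \<alpha> \<gamma> \<tau> p 1 q"
    then show "q = (\<lambda>j\<in>{1}. 1)"
      by cases (use cbc_reachable_pos in fastforce)+
  qed (simp add: cbc_reachable.first)
  then show ?thesis by (auto simp: cbc_vectors_def)
qed

lemma cbc_vectors_Suc:
  assumes "l \<ge> 1"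
  shows "cbc_vectors ord m (Suc l) \<alpha> \<gamma> \<tau> p =
    (\<lambda>(q, z). q(Suc l := z)) ` (SIGMA q:cbc_vectors ord m l \<alpha> \<gamma> \<tau> p. cbc_candidates ord m \<alpha> \<gamma> \<tau> p (Suc l) q)"
proof (intro equalityI subsetI)
  fix q assume "q \<in> cbc_vectors ord m (Suc l) \<alpha> \<gamma> \<tau> p"
  then have "cbc_reachable ord m \<alpha> \<gamma> \<tau> p (Suc l) q" by (simp add: cbc_vectors_def)
  then show "q \<in> (\<lambda>(q, z). q(Suc l := z)) ` (SIGMA q:cbc_vectors ord m l \<alpha> \<gamma> \<tau> p. cbc_candidates ord m \<alpha> \<gamma> \<tau> p (Suc l) q)"
    by cases (use assms in \<open>force simp: cbc_vectors_def One_nat_def\<close>)+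
qed (auto simp: cbc_vectors_def intro: cbc_reachable.step)

lemma cbc_candidates_subset: "cbc_candidates ord m \<alpha> \<gamma> \<tau> p l q \<subseteq> gen_polys m"
  unfolding cbc_candidates_def by (rule smallest_subset)

lemma cbc_vectors_in:
  assumes "m \<ge> 1" "l \<ge> 1"
  shows "cbc_vectors ord m l \<alpha> \<gamma> \<tau> p \<subseteq> {1..l} \<rightarrow>\<^sub>E gen_polys m"
proof -
  have "q \<in> {1..l} \<rightarrow>\<^sub>E gen_polys m" if "cbc_reachable ord m \<alpha> \<gamma> \<tau> p l q" for q
    using that
  proof (induction rule: cbc_reachable.induct)
    case first
    show ?case
      unfolding atLeastAtMost_singleton restrict_PiE_iff using assms by (simp add: gen_polys_def)
  next
    case (step l q z)
    have "z \<in> gen_polys m" by (rule subsetD[OF cbc_candidates_subset step.hyps(2)])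
    moreover have "{1..Suc l} = insert (Suc l) {1..l}" by auto
    ultimately show ?case using step.IH by (metis fun_upd_in_PiE PiE_fun_upd)
  qed
  then show ?thesis by (auto simp: cbc_vectors_def)
qed

text \<open>The \<open>itself\<close> argument is there only to name the field, since
  \<open>b\<close> is the cardinality of a type.\<close>

definition cbc_num :: "'b::prime_card itself \<Rightarrow> nat \<Rightarrow> real \<Rightarrow> nat" where
  "cbc_num _ m \<tau> = nat \<lceil>\<tau> * (real CARD('b) ^ m - 1)\<rceil>"

lemma card_cbc_candidates:
  assumes "linear_order_on (gen_polys m :: 'b::prime_card mod_ring poly set) ord" "\<tau> \<le> 1"
  shows "card (cbc_candidates ord m \<alpha> \<gamma> \<tau> (p :: 'b::prime_card mod_ring poly) l q) = cbc_num TYPE('b) m \<tau>"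
proof -
  have b1: "1 \<le> CARD('b) ^ m" using card_gt_1[where 'b='b] by (intro one_le_power) simp
  then have c: "real (CARD('b) ^ m - 1) = real CARD('b) ^ m - 1" by (simp add: of_nat_diff)
  have "\<tau> * (real CARD('b) ^ m - 1) \<le> real (CARD('b) ^ m - 1)"
    unfolding c[symmetric] using assms(2) by (intro mult_left_le_one_le mult_right_mono[of \<tau> 1, simplified]) simp_all
  then have "cbc_num TYPE('b) m \<tau> \<le> card (gen_polys m :: 'b mod_ring poly set)"
    unfolding card_gen_polys cbc_num_def by (simp add: nat_le_iff ceiling_le_iff)
  then show ?thesis
    unfolding cbc_candidates_def cbc_num_def
    by (rule card_smallest[OF assms(1) finite_gen_polys])
qed

text \<open>Vectors are extensional, so entry \<open>Suc l\<close> is \<open>undefined\<close>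
  before the update and the update can be undone.\<close>

lemma inj_on_cbc_step:
  assumes lin: "linear_order_on (gen_polys m :: 'b::prime_card mod_ring poly set) ord" "\<tau> \<le> 1" and m: "m \<ge> 1" "l \<ge> 1"
  shows "inj_on (\<lambda>(q, z). q(Suc l := z)) (SIGMA q:cbc_vectors ord m l \<alpha> \<gamma> \<tau> (p :: 'b mod_ring poly). cbc_candidates ord m \<alpha> \<gamma> \<tau> p (Suc l) q)"
    (is "inj_on ?f ?S")
proof (rule inj_onI)
  fix x y assume xy: "x \<in> ?S" "y \<in> ?S" "?f x = ?f y"
  obtain q z where x: "x = (q, z)" by (cases x)
  obtain q' z' where y: "y = (q', z')" by (cases y)
  have "q \<in> {1..l} \<rightarrow>\<^sub>E gen_polys m" "q' \<in> {1..l} \<rightarrow>\<^sub>E gen_polys m"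
    using xy x y cbc_vectors_in[OF m] by blast+
  then have u: "q (Suc l) = undefined" "q' (Suc l) = undefined" by (auto simp: PiE_def extensional_def)
  have eq: "q(Suc l := z) = q'(Suc l := z')" using xy(3) x y by simp
  have "z = z'" using fun_cong[OF eq, of "Suc l"] by simp
  moreover have "q = q'"
    using eq u by (metis fun_upd_triv fun_upd_upd)
  ultimately show "x = y" by (simp add: x y)
qed

lemma finite_cbc_vectors:
  assumes "m \<ge> 1" "l \<ge> 1"
  shows "finite (cbc_vectors ord m l \<alpha> \<gamma> \<tau> (p :: 'b::prime_card mod_ring poly))"
  by (rule finite_subset[OF cbc_vectors_in[OF assms]]) (intro finite_PiE finite_atLeastAtMost finite_gen_polys)

lemma card_cbc_vectors_Suc:
  assumes lin: "linear_order_on (gen_polys m :: 'b::prime_card mod_ring poly set) ord" "\<tau> \<le> 1" and m: "m \<ge> 1" "l \<ge> 1"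
  shows "card {q \<in> cbc_vectors ord m (Suc l) \<alpha> \<gamma> \<tau> (p :: 'b mod_ring poly). Q q} =
     (\<Sum>q\<in>cbc_vectors ord m l \<alpha> \<gamma> \<tau> p. card {z \<in> cbc_candidates ord m \<alpha> \<gamma> \<tau> p (Suc l) q. Q (q(Suc l := z))})"
proof -
  let ?f = "\<lambda>(q, z). q(Suc l := z)"
  let ?V = "cbc_vectors ord m l \<alpha> \<gamma> \<tau> p" and ?C = "\<lambda>q. cbc_candidates ord m \<alpha> \<gamma> \<tau> p (Suc l) q"
  let ?T = "SIGMA q:?V. {z \<in> ?C q. Q (q(Suc l := z))}"
  have "{q \<in> cbc_vectors ord m (Suc l) \<alpha> \<gamma> \<tau> p. Q q} = ?f ` ?T"
    unfolding cbc_vectors_Suc[OF m(2)] by force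
  moreover have "inj_on ?f ?T"
    by (rule inj_on_subset[OF inj_on_cbc_step[OF assms]]) auto
  ultimately have "card {q \<in> cbc_vectors ord m (Suc l) \<alpha> \<gamma> \<tau> p. Q q} = card ?T"
    by (simp add: card_image)
  also have "finite (?C q)" for q
    unfolding cbc_candidates_def by (rule finite_subset[OF smallest_subset finite_gen_polys])
  then have "card ?T = (\<Sum>q\<in>?V. card {z \<in> ?C q. Q (q(Suc l := z))})"
    using finite_cbc_vectors[OF m] by (intro card_SigmaI) auto
  finally show ?thesis .
qed

text \<open>Every stage offers the same number of candidates, whatever was chosen before. Hence a
  uniformly distributed vector is the same as uniform choices at each stage.\<close>

lemma card_cbc_vectors:
  assumes lin: "linear_order_on (gen_polys m :: 'b::prime_card mod_ring poly set) ord" "\<tau> \<le> 1" and m: "m \<ge> 1" "l \<ge> 1"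
  shows "card (cbc_vectors ord m l \<alpha> \<gamma> \<tau> (p :: 'b mod_ring poly)) = cbc_num TYPE('b) m \<tau> ^ (l - 1)"
  using m(2)
proof (induction l rule: dec_induct)
  case base
  show ?case by (simp add: cbc_vectors_1)
next
  case (step l)
  have "card (cbc_vectors ord m (Suc l) \<alpha> \<gamma> \<tau> p) = cbc_num TYPE('b) m \<tau> ^ (l - 1) * cbc_num TYPE('b) m \<tau>"
    using card_cbc_vectors_Suc[OF lin m(1), of l \<alpha> \<gamma> p "\<lambda>_. True"] step
    by (simp add: card_cbc_candidates[OF lin])
  then show ?case using step(1) by (cases l) (simp_all add: mult.commute)
qed

text \<open>\<open>p\<close> would divide the difference of two solutions, whose degree is too
  small.\<close>

lemma gen_polys_unique_root:
  fixes p :: "'b::prime_card mod_ring poly"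
  assumes p: "p \<in> monic_irreducibles m" and K: "\<not> p dvd K"
    and z: "z \<in> gen_polys m" "z' \<in> gen_polys m" "p dvd H + K * z" "p dvd H + K * z'"
  shows "z = z'"
proof (rule ccontr)
  assume "z \<noteq> z'"
  have "p dvd (H + K * z) - (H + K * z')" using z(3,4) by (rule dvd_diff)
  then have "p dvd K * (z - z')" by (simp add: algebra_simps)
  moreover have "prime_elem p"
    using p by (intro field_poly_irreducible_imp_prime) (simp add: monic_irreducibles_def)
  ultimately have "p dvd z - z'" using prime_elem_dvd_multD[of p K "z - z'"] K by simp
  then have "degree p \<le> degree (z - z')" using \<open>z \<noteq> z'\<close> by (intro dvd_imp_degree_le) auto
  also have "\<dots> < m" using z(1,2) by (intro degree_diff_less) (auto simp: gen_polys_def)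
  finally show False using p by (simp add: monic_irreducibles_def)
qed

lemma gen_polys_not_dvd:
  assumes "(p :: 'b::prime_card mod_ring poly) \<in> monic_irreducibles m" "z \<in> gen_polys m"
  shows "\<not> p dvd z"
  using assms dvd_imp_degree_le[of p z] by (auto simp: monic_irreducibles_def gen_polys_def)

lemma sum_fun_upd_Suc:
  fixes F :: "nat \<Rightarrow> 'a::comm_semiring_0"
  shows "(\<Sum>j\<in>{1..Suc l}. F j * (q(Suc l := z)) j) = (\<Sum>j\<in>{1..l}. F j * q j) + F (Suc l) * z"
  by (simp add: One_nat_def)

text \<open>The last index \<open>j\<close> with \<open>\<not> p dvd K j\<close> decides. Later
  components do not influence divisibility, and once the earlier ones are fixed at most one of the
  \<open>cbc_num\<close> candidates for component \<open>j\<close> is bad.\<close>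

lemma card_cbc_vectors_dual:
  fixes p :: "'b::prime_card mod_ring poly"
  assumes lin: "linear_order_on (gen_polys m :: 'b mod_ring poly set) ord" "\<tau> \<le> 1" and m: "m \<ge> 1" "l \<ge> 1"
    and p: "p \<in> monic_irreducibles m" and ex: "\<exists>j\<in>{1..l}. \<not> p dvd K j"
  shows "cbc_num TYPE('b) m \<tau> * card {q \<in> cbc_vectors ord m l \<alpha> \<gamma> \<tau> p. p dvd (\<Sum>j\<in>{1..l}. K j * q j)}
    \<le> card (cbc_vectors ord m l \<alpha> \<gamma> \<tau> p)"
  using m(2) ex
proof (induction l rule: dec_induct)
  case base
  \<comment> \<open>The first component is always 1, so the sum is \<open>K 1\<close> and nothing is
    left to chance.\<close>
  then have "{q \<in> cbc_vectors ord m 1 \<alpha> \<gamma> \<tau> p. p dvd (\<Sum>j\<in>{1..1}. K j * q j)} = {}"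
    by (auto simp: cbc_vectors_1)
  then show ?case by (simp only: card.empty mult_0_right le0)
next
  case (step l)
  let ?V = "cbc_vectors ord m l \<alpha> \<gamma> \<tau> p" and ?C = "\<lambda>q. cbc_candidates ord m \<alpha> \<gamma> \<tau> p (Suc l) q"
  let ?N = "cbc_num TYPE('b) m \<tau>"
  let ?D = "\<lambda>q. p dvd (\<Sum>j\<in>{1..l}. K j * q j)"
  have cC: "card (?C q) = ?N" for q by (rule card_cbc_candidates[OF lin])
  have cV: "card (cbc_vectors ord m (Suc l) \<alpha> \<gamma> \<tau> p) = card ?V * ?N"
    using card_cbc_vectors_Suc[OF lin m(1) step(1), of \<alpha> \<gamma> p "\<lambda>_. True"] by (simp add: cC)
  have Csub: "?C q \<subseteq> gen_polys m" for q unfolding cbc_candidates_def by (rule smallest_subset)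
  have eq: "card {q \<in> cbc_vectors ord m (Suc l) \<alpha> \<gamma> \<tau> p. p dvd (\<Sum>j\<in>{1..Suc l}. K j * q j)}
     = (\<Sum>q\<in>?V. card {z \<in> ?C q. p dvd (\<Sum>j\<in>{1..l}. K j * q j) + K (Suc l) * z})"
    by (subst card_cbc_vectors_Suc[OF lin m(1) step(1)]) (simp only: sum_fun_upd_Suc)
  show ?case
  proof (cases "p dvd K (Suc l)")
    case False
    have "card {z \<in> ?C q. p dvd (\<Sum>j\<in>{1..l}. K j * q j) + K (Suc l) * z} \<le> 1" for q
    proof (rule card_le_Suc0_iff_eq[THEN iffD2, folded One_nat_def])
      show "finite {z \<in> ?C q. p dvd (\<Sum>j\<in>{1..l}. K j * q j) + K (Suc l) * z}"
        using finite_subset[OF Csub finite_gen_polys] by simp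
    next
      show "\<forall>a1\<in>{z \<in> ?C q. p dvd (\<Sum>j\<in>{1..l}. K j * q j) + K (Suc l) * z}.
            \<forall>a2\<in>{z \<in> ?C q. p dvd (\<Sum>j\<in>{1..l}. K j * q j) + K (Suc l) * z}. a1 = a2"
        using gen_polys_unique_root[OF p False] Csub by blast
    qed
    then have "(\<Sum>q\<in>?V. card {z \<in> ?C q. p dvd (\<Sum>j\<in>{1..l}. K j * q j) + K (Suc l) * z}) \<le> (\<Sum>q\<in>?V. 1)"
      by (intro sum_mono)
    then show ?thesis unfolding eq cV by (simp add: mult.commute)
  next
    case True
    then have ex: "\<exists>j\<in>{1..l}. \<not> p dvd K j" using step.prems by (metis atLeastAtMost_iff le_Suc_eq)
    have "p dvd (\<Sum>j\<in>{1..l}. K j * q j) + K (Suc l) * z \<longleftrightarrow> ?D q" for q z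
      using True by (simp add: dvd_add_left_iff)
    then have "(\<Sum>q\<in>?V. card {z \<in> ?C q. p dvd (\<Sum>j\<in>{1..l}. K j * q j) + K (Suc l) * z})
        = (\<Sum>q\<in>?V. if ?D q then ?N else 0)"
      by (intro sum.cong refl) (simp add: cC)
    also have "\<dots> = ?N * card {q \<in> ?V. ?D q}"
      using finite_cbc_vectors[OF m(1) step(1), of ord \<alpha> \<gamma> \<tau> p] by (simp add: sum.If_cases Int_def mult.commute)
    finally show ?thesis unfolding eq cV using step.IH[OF ex] by (simp add: mult.commute)
  qed
qed

section \<open>Weights of frequency vectors\<close>

lemma powr_superadditive:
  fixes x y e :: real
  assumes "0 \<le> x" "0 \<le> y" "1 \<le> e"
  shows "x powr e + y powr e \<le> (x + y) powr e"
proof -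
  have split: "z powr e = z * z powr (e - 1)" if "0 \<le> z" for z :: real
    using that by (cases "z = 0") (simp_all add: powr_mult_base)
  have "x powr e + y powr e = x * x powr (e - 1) + y * y powr (e - 1)"
    using assms by (simp add: split)
  also have "\<dots> \<le> x * (x + y) powr (e - 1) + y * (x + y) powr (e - 1)"
    using assms by (intro add_mono mult_left_mono powr_mono2) auto
  also have "\<dots> = (x + y) powr e"
    using assms by (simp add: split[of "x + y"] distrib_right)
  finally show ?thesis .
qed

text \<open>Every term is at most the total \<open>S\<close>, so \<open>S powr (e - 1)\<close> can
  be pulled out of \<open>G k powr e\<close>. Applied with \<open>e = 2 * lam\<close>, this compares
  the criterion with the sum of the weights.\<close>

lemma infsum_powr_le:
  fixes G :: "'k \<Rightarrow> real"
  assumes G: "G summable_on A" "\<And>k. k \<in> A \<Longrightarrow> 0 \<le> G k" and e: "1 \<le> e"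
  shows "(\<lambda>k. G k powr e) summable_on A" "infsum (\<lambda>k. G k powr e) A \<le> infsum G A powr e"
proof -
  define S where "S = infsum G A"
  have le: "G k \<le> S" if "k \<in> A" for k
    using finite_sum_le_infsum[OF G(1), of "{k}"] G(2) that by (simp add: S_def)
  have split: "z powr e = z * z powr (e - 1)" if "0 \<le> z" for z :: real
    using that by (cases "z = 0") (simp_all add: powr_mult_base)
  have S0: "0 \<le> S" unfolding S_def by (rule infsum_nonneg[OF G(2)])
  have bd: "G k powr e \<le> G k * S powr (e - 1)" if "k \<in> A" for k
    unfolding split[OF G(2)[OF that]]
    using le[OF that] G(2)[OF that] e by (intro mult_left_mono powr_mono2) auto
  have s: "(\<lambda>k. G k * S powr (e - 1)) summable_on A" by (rule summable_on_cmult_left[OF G(1)])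
  show sm: "(\<lambda>k. G k powr e) summable_on A"
    by (rule summable_on_comparison_test[OF s]) (use bd in auto)
  have "infsum (\<lambda>k. G k powr e) A \<le> infsum (\<lambda>k. G k * S powr (e - 1)) A"
    by (rule infsum_mono[OF sm s bd])
  also have "\<dots> = S * S powr (e - 1)" by (simp add: infsum_cmult_left G S_def)
  also have "\<dots> = S powr e" by (simp add: split[OF S0])
  finally show "infsum (\<lambda>k. G k powr e) A \<le> infsum G A powr e" by (simp add: S_def)
qed

section \<open>Sums over numbers, grouped by their digit count\<close>

definition geo_const :: "nat \<Rightarrow> real \<Rightarrow> real" where
  "geo_const b c = (real b - 1) / (real b powr c - real b)"

definition digit_decay :: "nat \<Rightarrow> real \<Rightarrow> nat \<Rightarrow> real" where
  "digit_decay b c n = real b powr (- c * real (floorlog b n))"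

lemma digit_decay_nonneg [simp]: "0 \<le> digit_decay b c n"
  by (simp add: digit_decay_def)

lemma geo_const_pos: "b \<ge> 2 \<Longrightarrow> c > 1 \<Longrightarrow> 0 < geo_const b c"
  using powr_less_mono[of 1 c "real b"] by (simp add: geo_const_def)

text \<open>There are \<open>b ^ Suc n - b ^ n\<close> numbers with \<open>Suc n\<close> digits, so
  grouping by digit count gives a geometric series of ratio \<open>b / b powr c\<close>.\<close>

lemma has_sum_digit_decay:
  assumes b: "b \<ge> 2" and c: "c > 1"
  shows "(digit_decay b c has_sum geo_const b c) {1..}"
proof -
  let ?B = "\<lambda>n. {b ^ n..<b ^ Suc n}"
  let ?S = "SIGMA n:UNIV. ?B n"
  let ?g = "\<lambda>n. (real b - 1) / real b powr c * (real b / real b powr c) ^ n"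
  have bc: "real b < real b powr c" using powr_less_mono[of 1 c "real b"] b c by simp
  have fl: "floorlog b k = Suc n" if "k \<in> ?B n" for n k
  proof (rule antisym)
    show "floorlog b k \<le> Suc n" using that b by (intro floorlog_leI) auto
    show "Suc n \<le> floorlog b k" using that b by (intro floorlog_ge_SucI) auto
  qed
  have inner: "((\<lambda>k. digit_decay b c (snd (n, k))) has_sum ?g n) (?B n)" for n
  proof (rule has_sum_finiteI)
    have "(\<Sum>k\<in>?B n. digit_decay b c (snd (n, k))) = (\<Sum>k\<in>?B n. real b powr (- c * real (Suc n)))"
      by (intro sum.cong refl) (simp add: digit_decay_def fl)
    also have "\<dots> = (real b ^ Suc n - real b ^ n) * real b powr (- c * real (Suc n))"
      using b by (simp add: of_nat_diff)
    also have "real b powr (- c * real (Suc n)) = 1 / (real b powr c) ^ Suc n"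
    proof -
      have "real b powr (- c * real (Suc n)) = inverse ((real b powr c) powr real (Suc n))"
        by (simp only: powr_powr powr_minus mult_minus_left)
      also have "(real b powr c) powr real (Suc n) = (real b powr c) ^ Suc n"
        using b by (intro powr_realpow) simp
      finally show ?thesis by (simp only: inverse_eq_divide)
    qed
    also have "(real b ^ Suc n - real b ^ n) * (1 / (real b powr c) ^ Suc n) = ?g n"
      by (simp add: power_divide field_simps)
    finally show "?g n = (\<Sum>k\<in>?B n. digit_decay b c (snd (n, k)))" by simp
  qed simp
  have "?g sums ((real b - 1) / real b powr c * (1 / (1 - real b / real b powr c)))"
    by (intro sums_mult geometric_sums) (use b bc in auto)
  also have "(real b - 1) / real b powr c * (1 / (1 - real b / real b powr c)) = geo_const b c"
    using b bc by (simp add: geo_const_def divide_simps)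
  finally have sums: "?g sums geo_const b c" .
  have outer: "(?g has_sum geo_const b c) UNIV"
    by (rule norm_summable_imp_has_sum[OF _ sums]) (use sums_summable[OF sums] b in \<open>simp add: norm_mult norm_power norm_divide\<close>)
  have "((\<lambda>x. digit_decay b c (snd x)) has_sum geo_const b c) ?S"
  proof (rule has_sum_SigmaI[OF inner outer])
    show "(\<lambda>x. digit_decay b c (snd x)) summable_on ?S"
      by (rule summable_on_SigmaI[OF inner has_sum_imp_summable[OF outer]]) simp
  qed
  moreover have "bij_betw snd ?S {1..}"
  proof (rule bij_betw_imageI)
    show "inj_on snd ?S"
    proof (rule inj_onI)
      fix x y assume xy: "x \<in> ?S" "y \<in> ?S" "snd x = snd y"
      have "floorlog b (snd z) = Suc (fst z)" if "z \<in> ?S" for z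
        using that fl by (cases z) simp
      from this[OF xy(1)] this[OF xy(2)] show "x = y" using xy(3) by (simp add: prod_eq_iff)
    qed
    show "snd ` ?S = {1..}"
    proof (intro equalityI subsetI)
      fix k assume "k \<in> snd ` ?S"
      then obtain n where "b ^ n \<le> k" by auto
      moreover have "1 \<le> b ^ n" using b by simp
      ultimately show "k \<in> {1..}" by simp
    next
      fix k :: nat assume "k \<in> {1..}"
      then have k: "k > 0" by simp
      then have "floorlog b k > 0" using b by (simp add: floorlog_def)
      then have "k \<in> ?B (floorlog b k - 1)" using floorlog_bounds[OF k, of b] b by simp
      then show "k \<in> snd ` ?S" by (intro image_eqI[of _ _ "(floorlog b k - 1, k)"]) auto
    qed
  qed
  ultimately show ?thesis
    using has_sum_reindex_bij_betw[of snd ?S "{1..}" "digit_decay b c"] by simp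
qed

text \<open>Multiplication by \<open>p\<close> maps the positive numbers onto the multiples and
  lengthens each by \<open>m\<close> digits, which scales the full sum.\<close>

lemma has_sum_digit_decay_dvd:
  fixes p :: "'b::prime_card mod_ring poly"
  assumes c: "c > 1" and p: "p \<in> monic_irreducibles m"
  shows "(digit_decay CARD('b) c has_sum (real CARD('b) powr (- c * real m) * geo_const CARD('b) c)) {n\<in>{1..}. p dvd nat_poly n}"
proof -
  have p0: "p \<noteq> 0" "degree p = m" using p by (auto simp: monic_irreducibles_def)
  have b: "2 \<le> CARD('b)" using card_gt_1[where 'b='b] by simp
  \<comment> \<open>Multiplication by \<open>p\<close>, transported to numbers along
    \<open>nat_poly\<close>.\<close>
  define f where "f n = inv_into UNIV nat_poly (p * nat_poly n)" for n
  have f: "nat_poly (f n) = p * nat_poly n" for n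
    unfolding f_def by (rule surj_f_inv_f[OF bij_is_surj[OF bij_nat_poly]])
  have f0: "f n = 0 \<longleftrightarrow> n = 0" for n
    using f[of n] p0 by (metis mult_eq_0_iff nat_poly_eq_0_iff)
  have bij: "bij_betw f {1..} {n\<in>{1..}. p dvd nat_poly n}"
  proof (rule bij_betw_imageI)
    show "inj_on f {1..}"
    proof (rule inj_onI)
      fix x y assume "f x = f y"
      then have "p * nat_poly x = p * nat_poly y" using f by metis
      then show "x = y" using p0 by (simp add: nat_poly_eq_iff)
    qed
    show "f ` {1..} = {n\<in>{1..}. p dvd nat_poly n}"
    proof (intro equalityI subsetI)
      fix k assume "k \<in> f ` {1..}"
      then obtain n where "n \<ge> 1" "k = f n" by auto
      then show "k \<in> {n\<in>{1..}. p dvd nat_poly n}" using f0[of n] by (simp add: f Suc_le_eq One_nat_def)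
    next
      fix k assume k: "k \<in> {n\<in>{1..}. p dvd nat_poly n}"
      then have "p dvd nat_poly k" by simp
      then obtain r where r: "nat_poly k = p * r" by (rule dvdE)
      obtain n where n: "r = nat_poly n" using bij_nat_poly by (metis bij_pointE)
      have "nat_poly k = (nat_poly (f n) :: 'b mod_ring poly)" using r n f by simp
      then have "k = f n" by (simp only: nat_poly_eq_iff)
      moreover have "n \<noteq> 0" using k f0[of n] \<open>k = f n\<close> by (metis (no_types, lifting) atLeast_iff mem_Collect_eq not_one_le_zero)
      ultimately show "k \<in> f ` {1..}" by (simp add: One_nat_def)
    qed
  qed
  have "digit_decay CARD('b) c (f n) = real CARD('b) powr (- c * real m) * digit_decay CARD('b) c n" if "n \<in> {1..}" for n
  proof -
    have n: "n \<noteq> 0" "f n \<noteq> 0" using that f0[of n] by auto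
    have "floorlog CARD('b) (f n) = m + floorlog CARD('b) n"
      using n p0 by (simp add: floorlog_eq_degree[where 'b='b] f degree_mult_eq)
    then show ?thesis by (simp add: digit_decay_def distrib_left powr_add[symmetric])
  qed
  then have "((\<lambda>n. digit_decay CARD('b) c (f n)) has_sum (real CARD('b) powr (- c * real m) * geo_const CARD('b) c)) {1..}"
    using has_sum_cmult_right[OF has_sum_digit_decay[OF b c], of "real CARD('b) powr (- c * real m)"]
    by (subst has_sum_cong) auto
  then show ?thesis using has_sum_reindex_bij_betw[OF bij] by blast
qed

section \<open>Product weights on frequency vectors\<close>

definition coord_weight :: "nat \<Rightarrow> real \<Rightarrow> real \<Rightarrow> nat \<Rightarrow> real" where
  "coord_weight b c g n = (if n = 0 then 1 else g * digit_decay b c n)"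

text \<open>For \<open>c = \<alpha> / lam\<close> and \<open>g j = \<gamma> j powr (1 / lam)\<close>
  this is the \<open>1 / lam\<close>-th power of the inverse of \<open>r_wal\<close>, see
  \<open>inverse_r_wal\<close>.\<close>

definition vec_weight :: "nat \<Rightarrow> real \<Rightarrow> (nat \<Rightarrow> real) \<Rightarrow> nat \<Rightarrow> (nat \<Rightarrow> nat) \<Rightarrow> real" where
  "vec_weight b c g l k = (\<Prod>j\<in>{1..l}. coord_weight b c (g j) (k j))"

text \<open>The sum of \<open>vec_weight\<close> over all vectors. The zero vector accounts for 1,
  so the weight sum is \<open>total_weight - 1\<close>.\<close>

definition total_weight :: "nat \<Rightarrow> real \<Rightarrow> (nat \<Rightarrow> real) \<Rightarrow> nat \<Rightarrow> real" where
  "total_weight b c g l = (\<Prod>j\<in>{1..l}. 1 + g j * geo_const b c)"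

lemma coord_weight_nonneg: "0 \<le> g \<Longrightarrow> 0 \<le> coord_weight b c g n"
  by (simp add: coord_weight_def)

lemma vec_weight_nonneg: "(\<And>j. j \<ge> 1 \<Longrightarrow> 0 \<le> g j) \<Longrightarrow> 0 \<le> vec_weight b c g l k"
  unfolding vec_weight_def by (intro prod_nonneg) (auto intro: coord_weight_nonneg)

lemma has_sum_coord_weight:
  assumes "b \<ge> 2" "c > 1"
  shows "(coord_weight b c g has_sum (1 + g * geo_const b c)) UNIV"
proof -
  have "((\<lambda>n. g * digit_decay b c n) has_sum (g * geo_const b c)) {1..}"
    by (rule has_sum_cmult_right[OF has_sum_digit_decay[OF assms]])
  then have "(coord_weight b c g has_sum (g * geo_const b c)) {1..}"
    by (rule iffD1[OF has_sum_cong, rotated]) (auto simp: coord_weight_def)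
  then have "(coord_weight b c g has_sum (coord_weight b c g 0 + g * geo_const b c)) (insert 0 {1..})"
    by (intro has_sum_insert) auto
  moreover have "insert 0 {1..} = (UNIV :: nat set)" by (auto simp: One_nat_def)
  ultimately show ?thesis by (simp add: coord_weight_def)
qed

lemma total_weight_ge_1:
  assumes "b \<ge> 2" "c > 1" "\<And>j. j \<ge> 1 \<Longrightarrow> 0 \<le> g j"
  shows "1 \<le> total_weight b c g l"
  unfolding total_weight_def using assms geo_const_pos[OF assms(1,2)]
  by (intro prod_ge_1) auto

lemma has_sum_vec_weight:
  assumes b: "b \<ge> 2" "c > 1" and g: "\<And>j. j \<ge> 1 \<Longrightarrow> 0 \<le> g j"
  shows "(vec_weight b c g l has_sum total_weight b c g l) (nat_vecs l)"
proof -
  have sm: "coord_weight b c (g j) summable_on UNIV" for j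
    by (rule has_sum_imp_summable[OF has_sum_coord_weight[OF b]])
  have "infsum (\<lambda>k. \<Prod>j\<in>{1..l}. coord_weight b c (g j) (k j)) (nat_vecs l) = (\<Prod>j\<in>{1..l}. infsum (coord_weight b c (g j)) UNIV)"
    by (rule infsum_prod_PiE_abs) (use sm g in \<open>auto simp: coord_weight_nonneg\<close>)
  also have "\<dots> = total_weight b c g l"
    by (simp add: total_weight_def infsumI[OF has_sum_coord_weight[OF b]])
  finally have eq: "infsum (vec_weight b c g l) (nat_vecs l) = total_weight b c g l"
    by (simp add: vec_weight_def[abs_def])
  \<comment> \<open>\<open>infsum\<close> is 0 for families that are not summable, so a nonzero
    value proves summability.\<close>
  moreover have "total_weight b c g l \<noteq> 0" using total_weight_ge_1[OF b, of g l, OF g] by simp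
  ultimately have "vec_weight b c g l summable_on nat_vecs l"
    by (metis infsum_not_exists)
  then show ?thesis using eq by (metis has_sum_infsum)
qed

text \<open>The set \<open>N\<close> of last entries is kept general: \<open>{1..}\<close> describes
  the frequencies that a new component adds, \<open>{0}\<close> the old ones.\<close>

lemma bij_betw_vec_Suc:
  "bij_betw (\<lambda>(k, n). k(Suc l := n)) (nat_vecs l \<times> N) {k \<in> nat_vecs (Suc l). k (Suc l) \<in> N}"
proof (rule bij_betw_byWitness[where f' = "\<lambda>k. (restrict k {1..l}, k (Suc l))"])
  show "\<forall>x\<in>nat_vecs l \<times> N. (\<lambda>k. (restrict k {1..l}, k (Suc l))) ((\<lambda>(k, n). k(Suc l := n)) x) = x"
    by (auto simp: fun_eq_iff PiE_def extensional_def)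
  show "\<forall>k\<in>{k \<in> nat_vecs (Suc l). k (Suc l) \<in> N}. (\<lambda>(k, n). k(Suc l := n)) (restrict k {1..l}, k (Suc l)) = k"
    by (auto simp: fun_eq_iff PiE_def extensional_def)
  show "(\<lambda>(k, n). k(Suc l := n)) ` (nat_vecs l \<times> N) \<subseteq> {k \<in> nat_vecs (Suc l). k (Suc l) \<in> N}"
    by (auto simp: PiE_def extensional_def)
  show "(\<lambda>k. (restrict k {1..l}, k (Suc l))) ` {k \<in> nat_vecs (Suc l). k (Suc l) \<in> N} \<subseteq> nat_vecs l \<times> N"
    by auto
qed

lemma vec_weight_Suc: "vec_weight b c g (Suc l) (k(Suc l := n)) = vec_weight b c g l k * coord_weight b c (g (Suc l)) n"
  by (simp add: vec_weight_def One_nat_def)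

lemma total_weight_Suc: "total_weight b c g (Suc l) = total_weight b c g l * (1 + g (Suc l) * geo_const b c)"
  by (simp add: total_weight_def One_nat_def)

lemma dual_lattice_Suc_iff:
  assumes "k \<in> nat_vecs l"
  shows "k(Suc l := n) \<in> dual_lattice (Suc l) p (q(Suc l := z)) \<longleftrightarrow>
    p dvd (\<Sum>j\<in>{1..l}. nat_poly (k j) * q j) + nat_poly n * z"
proof -
  have "k(Suc l := n) \<in> nat_vecs (Suc l)"
    using assms by (auto simp: PiE_def extensional_def)
  moreover have "(\<Sum>j\<in>{1..Suc l}. nat_poly ((k(Suc l := n)) j) * (q(Suc l := z)) j) =
      (\<Sum>j\<in>{1..l}. nat_poly (k j) * q j) + nat_poly n * z"
    by (simp add: One_nat_def)
  ultimately show ?thesis by (simp only: dual_lattice_iff simp_thms)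
qed

text \<open>
  If \<open>p\<close> divides \<open>H\<close>, only multiples \<open>nat_poly n\<close> of \<open>p\<close> contribute, each of them for all
  \<open>z\<close>, but these carry at most the fraction \<open>CARD('b) powr (- m)\<close> of the total weight; otherwise
  every \<open>n\<close> contributes for at most one \<open>z\<close>.
\<close>
lemma infsum_digit_decay_solutions:
  fixes p H :: "'b::prime_card mod_ring poly"
  assumes c: "c > 1" and p: "p \<in> monic_irreducibles m"
  defines "N n \<equiv> card {z \<in> gen_polys m. p dvd H + nat_poly n * z}"
  shows "infsum (\<lambda>n. digit_decay CARD('b) c n * real (N n)) {1..} \<le> geo_const CARD('b) c"
proof -
  let ?h = "digit_decay CARD('b) c" and ?M = "CARD('b) ^ m - 1"
  have b: "2 \<le> CARD('b)" using card_gt_1[where 'b='b] by simp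
  note hs = has_sum_digit_decay[OF b c]
  show ?thesis
  proof (cases "p dvd H")
    case True
    have N: "N n = (if p dvd nat_poly n then ?M else 0)" for n
    proof -
      have pe: "prime_elem p"
        using p by (intro field_poly_irreducible_imp_prime) (simp add: monic_irreducibles_def)
      have "p dvd H + nat_poly n * z \<longleftrightarrow> p dvd nat_poly n" if "z \<in> gen_polys m" for z
        using True gen_polys_not_dvd[OF p that] prime_elem_dvd_mult_iff[OF pe]
        by (simp add: dvd_add_right_iff)
      then have "{z \<in> gen_polys m. p dvd H + nat_poly n * z} = (if p dvd nat_poly n then gen_polys m else {})"
        by auto
      then show ?thesis by (simp add: N_def card_gen_polys)
    qed
    have "infsum (\<lambda>n. ?h n * real (N n)) {1..} = infsum (\<lambda>n. ?h n * real ?M) {n\<in>{1..}. p dvd nat_poly n}"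
      by (rule infsum_cong_neutral) (auto simp: N)
    also have "\<dots> = real CARD('b) powr (- c * real m) * geo_const CARD('b) c * real ?M"
      by (rule infsumI[OF has_sum_cmult_left[OF has_sum_digit_decay_dvd[OF c p]]])
    also have "\<dots> \<le> real CARD('b) powr (- real m) * geo_const CARD('b) c * real CARD('b) ^ m"
    proof (intro mult_mono)
      have "real m \<le> c * real m" using c by (simp add: mult_le_cancel_right1)
      then show "real CARD('b) powr (- c * real m) \<le> real CARD('b) powr (- real m)"
        using b by (intro powr_mono) simp_all
      show "real ?M \<le> real CARD('b) ^ m" by (metis diff_le_self of_nat_le_iff of_nat_power)
    qed (use geo_const_pos[OF b c] in simp_all)
    also have "\<dots> = geo_const CARD('b) c"
      using b by (simp add: powr_minus powr_realpow)
    finally show ?thesis .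
  next
    case False
    have N1: "N n \<le> 1" for n
    proof (cases "p dvd nat_poly n")
      case True
      then have "{z \<in> gen_polys m. p dvd H + nat_poly n * z} = {}"
        using False by (simp add: dvd_add_left_iff)
      then have "N n = 0" unfolding N_def by (simp only: card.empty)
      then show ?thesis by simp
    next
      case False
      have "finite {z \<in> gen_polys m. p dvd H + nat_poly n * z}"
        by (rule finite_subset[OF _ finite_gen_polys[of m]]) auto
      then show ?thesis
        unfolding N_def One_nat_def card_le_Suc0_iff_eq[OF \<open>finite _\<close>]
        using gen_polys_unique_root[OF p False] by blast
    qed
    have le: "?h n * real (N n) \<le> ?h n" for n
      using mult_left_mono[of "real (N n)" 1 "?h n"] N1[of n] by simp
    have "(\<lambda>n. ?h n * real (N n)) summable_on {1..}"
      by (rule summable_on_comparison_test[OF has_sum_imp_summable[OF hs]]) (use le in auto)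
    then have "infsum (\<lambda>n. ?h n * real (N n)) {1..} \<le> infsum ?h {1..}"
      by (rule infsum_mono[OF _ has_sum_imp_summable[OF hs] le])
    then show ?thesis using infsumI[OF hs] by simp
  qed
qed

text \<open>After exchanging the sums, each pair of an old vector \<open>k\<close> and a new entry
  \<open>n\<close> is weighted by the number of \<open>z\<close> that make it dual;
  \<open>infsum_digit_decay_solutions\<close> bounds the sum over \<open>n\<close> uniformly in
  \<open>k\<close>.\<close>

lemma sum_new_dual_weights:
  fixes p :: "'b::prime_card mod_ring poly"
  assumes c: "c > 1" and p: "p \<in> monic_irreducibles m" and g: "\<And>j. j \<ge> 1 \<Longrightarrow> 0 \<le> g j"
  shows "(\<Sum>z\<in>gen_polys m. infsum (vec_weight CARD('b) c g (Suc l))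
      {k \<in> dual_lattice (Suc l) p (q(Suc l := z)). k (Suc l) \<noteq> 0})
    \<le> total_weight CARD('b) c g l * (g (Suc l) * geo_const CARD('b) c)"
proof -
  let ?b = "CARD('b)" and ?a = "g (Suc l)" and ?G = "gen_polys m :: 'b mod_ring poly set"
  let ?V = "vec_weight ?b c g" and ?h = "digit_decay ?b c"
  let ?P = "nat_vecs l \<times> {1::nat..}"
  define H where "H k = (\<Sum>j\<in>{1..l}. nat_poly (k j) * q j)" for k
  define F where "F = (\<lambda>(k, n). ?V l k * (?a * ?h n))"
  \<comment> \<open>Extending by 0 gives an index set common to all \<open>z\<close>, as required
    for exchanging the sums.\<close>
  define F' where "F' z x = (if p dvd H (fst x) + nat_poly (snd x) * z then F x else 0)" for z x
  define N where "N k n = card {z \<in> ?G. p dvd H k + nat_poly n * z}" for k n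
  have b: "2 \<le> ?b" using card_gt_1[where 'b='b] by simp
  have a0: "0 \<le> ?a" using g[of "Suc l"] by simp
  have V0: "0 \<le> ?V l' k" for l' k by (rule vec_weight_nonneg[OF g])
  have F0: "0 \<le> F x" for x unfolding F_def using a0 V0 by (cases x) simp
  have up: "?V (Suc l) (k(Suc l := n)) = F (k, n)" if "n \<in> {1..}" for k n
    using that unfolding vec_weight_Suc F_def by (simp add: coord_weight_def)
  have "?V (Suc l) summable_on {k \<in> nat_vecs (Suc l). k (Suc l) \<in> {1::nat..}}"
    by (rule summable_on_subset_banach[OF has_sum_imp_summable[OF has_sum_vec_weight[OF b c g]]]) auto
  then have "(\<lambda>x. ?V (Suc l) ((\<lambda>(k, n). k(Suc l := n)) x)) summable_on ?P"
    using summable_on_reindex_bij_betw[OF bij_betw_vec_Suc[of l "{1..}"], of "?V (Suc l)"] by blast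
  then have Fs: "F summable_on ?P"
    by (rule iffD1[OF summable_on_cong, rotated]) (use up in auto)
  have F's: "F' z summable_on ?P" for z
    by (rule summable_on_comparison_test[OF Fs]) (use F0 in \<open>auto simp: F'_def\<close>)
  have eq: "infsum (?V (Suc l)) {k \<in> dual_lattice (Suc l) p (q(Suc l := z)). k (Suc l) \<noteq> 0} = infsum (F' z) ?P" for z
  proof -
    let ?D = "dual_lattice (Suc l) p (q(Suc l := z))"
    have "infsum (?V (Suc l)) {k \<in> ?D. k (Suc l) \<noteq> 0}
        = infsum (\<lambda>k. if k \<in> ?D then ?V (Suc l) k else 0) {k \<in> nat_vecs (Suc l). k (Suc l) \<in> {1::nat..}}"
      by (rule infsum_cong_neutral) (auto simp: dual_lattice_iff One_nat_def)
    also have "\<dots> = infsum (\<lambda>x. (\<lambda>k. if k \<in> ?D then ?V (Suc l) k else 0) ((\<lambda>(k, n). k(Suc l := n)) x)) ?P"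
      by (rule infsum_reindex_bij_betw[OF bij_betw_vec_Suc, symmetric])
    also have "\<dots> = infsum (F' z) ?P"
    proof (rule infsum_cong)
      fix x :: "(nat \<Rightarrow> nat) \<times> nat" assume "x \<in> ?P"
      then obtain k n where x: "x = (k, n)" "k \<in> nat_vecs l" "n \<in> {1..}" by (cases x) auto
      show "(if (case x of (k, n) \<Rightarrow> k(Suc l := n)) \<in> ?D then ?V (Suc l) (case x of (k, n) \<Rightarrow> k(Suc l := n)) else 0) = F' z x"
        using x up[OF x(3)] dual_lattice_Suc_iff[OF x(2), of n p q z] by (simp add: F'_def H_def)
    qed
    finally show ?thesis .
  qed
  have FN: "(\<Sum>z\<in>?G. F' z (k, n)) = ?V l k * ?a * (?h n * real (N k n))" for k n
  proof -
    have "(\<Sum>z\<in>?G. F' z (k, n)) = (\<Sum>z\<in>{z \<in> ?G. p dvd H k + nat_poly n * z}. F (k, n))"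
      unfolding F'_def fst_conv snd_conv by (rule sum.inter_filter[OF finite_gen_polys, symmetric])
    then show ?thesis by (simp add: N_def F_def mult_ac)
  qed
  have has: "((\<lambda>x. \<Sum>z\<in>?G. F' z x) has_sum (\<Sum>z\<in>?G. infsum (F' z) ?P)) ?P"
    by (intro has_sum_finite_sum has_sum_infsum F's)
  have sm: "(\<lambda>(k, n). ?V l k * ?a * (?h n * real (N k n))) summable_on ?P"
    using has_sum_imp_summable[OF has] by (rule iffD1[OF summable_on_cong, rotated]) (auto simp: FN)
  have "(\<Sum>z\<in>?G. infsum (F' z) ?P) = infsum (\<lambda>x. \<Sum>z\<in>?G. F' z x) ?P"
    using has by (simp add: infsumI)
  also have "\<dots> = infsum (\<lambda>(k, n). ?V l k * ?a * (?h n * real (N k n))) ?P"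
    by (intro infsum_cong) (auto simp: FN)
  also have "\<dots> = infsum (\<lambda>k. infsum (\<lambda>n. ?V l k * ?a * (?h n * real (N k n))) {1..}) (nat_vecs l)"
    by (rule infsum_Sigma'_banach[OF sm, symmetric])
  also have "\<dots> \<le> infsum (\<lambda>k. ?V l k * (?a * geo_const ?b c)) (nat_vecs l)"
  proof (rule infsum_mono)
    show "(\<lambda>k. infsum (\<lambda>n. ?V l k * ?a * (?h n * real (N k n))) {1..}) summable_on nat_vecs l"
      using summable_on_Sigma_banach[OF sm] by simp
    show "(\<lambda>k. ?V l k * (?a * geo_const ?b c)) summable_on nat_vecs l"
      by (rule has_sum_imp_summable[OF has_sum_cmult_left[OF has_sum_vec_weight[OF b c g]]])
    fix k
    have "infsum (\<lambda>n. ?V l k * ?a * (?h n * real (N k n))) {1..} = ?V l k * ?a * infsum (\<lambda>n. ?h n * real (N k n)) {1..}"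
      by (rule infsum_cmult_right')
    also have "\<dots> \<le> ?V l k * ?a * geo_const ?b c"
      unfolding N_def using a0 V0 by (intro mult_left_mono infsum_digit_decay_solutions[OF c p]) simp
    finally show "infsum (\<lambda>n. ?V l k * ?a * (?h n * real (N k n))) {1..} \<le> ?V l k * (?a * geo_const ?b c)"
      by (simp add: mult.assoc)
  qed
  also have "\<dots> = total_weight ?b c g l * (?a * geo_const ?b c)"
    by (rule infsumI[OF has_sum_cmult_left[OF has_sum_vec_weight[OF b c g]]])
  finally show ?thesis unfolding eq .
qed

text \<open>The product is expanded over subsets; the empty set yields the 1 that is
  subtracted.\<close>

lemma weight_sum_eq:
  assumes "\<And>j. j \<ge> 1 \<Longrightarrow> 0 \<le> \<gamma> j"
  shows "weight_sum b s \<alpha> \<gamma> lam = total_weight b (\<alpha> / lam) (\<lambda>j. \<gamma> j powr (1 / lam)) s - 1"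
proof -
  let ?v = "geo_const b (\<alpha> / lam)" and ?g = "\<lambda>j. \<gamma> j powr (1 / lam)"
  have "total_weight b (\<alpha> / lam) ?g s = (\<Sum>u\<in>Pow {1..s}. (\<Prod>j\<in>u. ?g j * ?v))"
    using prod_add[of "{1..s}" "\<lambda>j. ?g j * ?v" "\<lambda>_. 1"] by (simp add: total_weight_def add.commute)
  also have "\<dots> = 1 + (\<Sum>u\<in>Pow {1..s} - {{}}. (\<Prod>j\<in>u. ?g j * ?v))"
    by (subst sum.remove[of _ "{}"]) auto
  also have "(\<Sum>u\<in>Pow {1..s} - {{}}. (\<Prod>j\<in>u. ?g j * ?v)) = weight_sum b s \<alpha> \<gamma> lam"
    unfolding weight_sum_def
  proof (intro sum.cong refl)
    fix u assume "u \<in> Pow {1..s} - {{}}"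
    then have "u \<subseteq> {1..s}" by auto
    then have "\<And>j. j \<in> u \<Longrightarrow> 0 \<le> \<gamma> j" using assms by auto
    then show "(\<Prod>j\<in>u. ?g j * ?v) = (\<Prod>j\<in>u. \<gamma> j) powr (1 / lam) * ((real b - 1) / (real b powr (\<alpha> / lam) - real b)) ^ card u"
      unfolding prod.distrib prod_constant geo_const_def by (simp add: prod_powr_distrib)
  qed
  finally show ?thesis by simp
qed

text \<open>If \<open>k j \<noteq> 0\<close> and \<open>\<gamma> j = 0\<close> for some component,
  both sides are 0, so the identity covers vanishing weights.\<close>

lemma inverse_r_wal:
  assumes b: "b \<ge> 2" and lam: "lam > 0" and \<gamma>: "\<And>j. j \<ge> 1 \<Longrightarrow> 0 \<le> \<gamma> j"
  shows "inverse (r_wal b \<alpha> \<gamma> s k) = vec_weight b (\<alpha> / lam) (\<lambda>j. \<gamma> j powr (1 / lam)) s k powr lam"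
proof -
  have "inverse (r_wal b \<alpha> \<gamma> s k) = (\<Prod>j\<in>{j\<in>{1..s}. k j \<noteq> 0}. \<gamma> j * real b powr (- (\<alpha> * real (floorlog b (k j)))))"
    unfolding r_wal_def prod_inversef[symmetric] by (intro prod.cong refl) (simp add: powr_minus divide_inverse)
  also have "\<dots> = (\<Prod>j\<in>{1..s}. if k j \<noteq> 0 then \<gamma> j * real b powr (- (\<alpha> * real (floorlog b (k j)))) else 1)"
    by (rule prod.inter_filter) simp
  also have "\<dots> = (\<Prod>j\<in>{1..s}. coord_weight b (\<alpha> / lam) (\<gamma> j powr (1 / lam)) (k j) powr lam)"
  proof (intro prod.cong refl)
    fix j assume "j \<in> {1..s}"
    then have "0 \<le> \<gamma> j" using \<gamma> by simp
    then show "(if k j \<noteq> 0 then \<gamma> j * real b powr (- (\<alpha> * real (floorlog b (k j)))) else 1)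
        = coord_weight b (\<alpha> / lam) (\<gamma> j powr (1 / lam)) (k j) powr lam"
      using lam b by (simp add: coord_weight_def digit_decay_def powr_mult powr_powr)
  qed
  also have "\<dots> = vec_weight b (\<alpha> / lam) (\<lambda>j. \<gamma> j powr (1 / lam)) s k powr lam"
    unfolding vec_weight_def by (rule prod_powr_distrib[symmetric])
  finally show ?thesis .
qed

lemma R_wal_eq:
  fixes p :: "'b::prime_card mod_ring poly"
  assumes "lam > 0" and "\<And>j. j \<ge> 1 \<Longrightarrow> 0 \<le> \<gamma> j"
  shows "R_wal \<alpha> \<gamma> l p q = infsum (\<lambda>k. vec_weight CARD('b) (\<alpha> / lam) (\<lambda>j. \<gamma> j powr (1 / lam)) l k powr (2 * lam))
    (dual_lattice l p q - {\<lambda>j\<in>{1..l}. 0})"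
proof -
  have "2 \<le> CARD('b)" using card_gt_1[where 'b='b] by simp
  from inverse_r_wal[OF this assms] show ?thesis
    by (simp add: R_wal_def power2_eq_square flip: powr_add)
qed

lemma bij_betw_dual_lattice_zero:
  "bij_betw (\<lambda>k. k(Suc l := 0)) (dual_lattice l p q - {\<lambda>j\<in>{1..l}. 0})
    {k \<in> dual_lattice (Suc l) p (q(Suc l := z)) - {\<lambda>j\<in>{1..Suc l}. 0}. k (Suc l) = 0}"
    (is "bij_betw ?f ?A ?B")
proof -
  have mem: "k \<in> dual_lattice l p q \<longleftrightarrow> k(Suc l := 0) \<in> dual_lattice (Suc l) p (q(Suc l := z))" if "k \<in> nat_vecs l" for k
    unfolding dual_lattice_Suc_iff[OF that] using that by (simp add: dual_lattice_iff)
  have zero: "(\<lambda>j\<in>{1..l}. 0)(Suc l := 0) = (\<lambda>j\<in>{1..Suc l}. 0 :: nat)"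
    by (auto simp: fun_eq_iff)
  have bij: "bij_betw (\<lambda>(k, n). k(Suc l := n)) (nat_vecs l \<times> {0}) {k \<in> nat_vecs (Suc l). k (Suc l) \<in> {0}}"
    by (rule bij_betw_vec_Suc)
  have inj: "inj_on ?f (nat_vecs l)"
    using bij_betw_imp_inj_on[OF bij] by (auto simp: inj_on_def)
  have im: "?f ` nat_vecs l = {k \<in> nat_vecs (Suc l). k (Suc l) = 0}"
  proof -
    have "nat_vecs l \<times> {0 :: nat} = (\<lambda>k. (k, 0)) ` nat_vecs l" by auto
    with bij_betw_imp_surj_on[OF bij] show ?thesis by (simp add: image_image)
  qed
  have sub: "?A \<subseteq> nat_vecs l" by (auto simp: dual_lattice_def)
  show ?thesis
  proof (rule bij_betw_imageI)
    show "inj_on ?f ?A" by (rule inj_on_subset[OF inj sub])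
    have z0: "(\<lambda>j\<in>{1..l}. 0 :: nat) \<in> nat_vecs l" by auto
    show "?f ` ?A = ?B"
    proof (intro equalityI subsetI)
      fix k' assume "k' \<in> ?f ` ?A"
      then obtain k where k: "k \<in> ?A" "k' = ?f k" by blast
      then have kn: "k \<in> nat_vecs l" using sub by blast
      have "k' \<noteq> (\<lambda>j\<in>{1..Suc l}. 0)"
      proof
        assume "k' = (\<lambda>j\<in>{1..Suc l}. 0)"
        then have "?f k = ?f (\<lambda>j\<in>{1..l}. 0)" by (simp only: k(2) zero)
        then have "k = (\<lambda>j\<in>{1..l}. 0)" by (rule inj_onD[OF inj _ kn z0])
        with k(1) show False by simp
      qed
      then show "k' \<in> ?B" using k mem[OF kn] by simp
    next
      fix k' assume k': "k' \<in> ?B"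
      then have "k' \<in> {k \<in> nat_vecs (Suc l). k (Suc l) = 0}" by (simp add: dual_lattice_iff)
      then obtain k where k: "k \<in> nat_vecs l" "k' = ?f k" using im by blast
      have "k \<noteq> (\<lambda>j\<in>{1..l}. 0)" using k k' zero by auto
      then show "k' \<in> ?f ` ?A" using k k' mem[OF k(1)] by blast
    qed
  qed
qed

text \<open>Dual vectors ending in 0 reproduce the previous criterion whatever \<open>z\<close> is.
  Ranking the candidates by \<open>R_wal\<close> is therefore the same as ranking them by the second
  summand.\<close>

lemma R_wal_Suc:
  fixes p :: "'b::prime_card mod_ring poly"
  assumes lam: "lam > 1/2" "lam < \<alpha>" and \<gamma>: "\<And>j. j \<ge> 1 \<Longrightarrow> 0 \<le> \<gamma> j"
  defines "V \<equiv> vec_weight CARD('b) (\<alpha> / lam) (\<lambda>j. \<gamma> j powr (1 / lam))"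
  shows "R_wal \<alpha> \<gamma> (Suc l) p (q(Suc l := z)) = R_wal \<alpha> \<gamma> l p q +
    infsum (\<lambda>k. V (Suc l) k powr (2 * lam)) {k \<in> dual_lattice (Suc l) p (q(Suc l := z)). k (Suc l) \<noteq> 0}"
proof -
  let ?D = "dual_lattice (Suc l) p (q(Suc l := z))" and ?z = "\<lambda>j\<in>{1..Suc l}. 0 :: nat"
  let ?A = "{k \<in> ?D - {?z}. k (Suc l) = 0}" and ?B = "{k \<in> ?D. k (Suc l) \<noteq> 0}"
  let ?f = "\<lambda>k. V (Suc l) k powr (2 * lam)"
  have b: "2 \<le> CARD('b)" using card_gt_1[where 'b='b] by simp
  have c: "\<alpha> / lam > 1" using lam by simp
  have lam0: "lam > 0" using lam by simp
  have sm: "?f summable_on nat_vecs (Suc l)"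
    unfolding V_def
    by (rule infsum_powr_le(1)[OF has_sum_imp_summable[OF has_sum_vec_weight[OF b c]]])
      (use lam in \<open>auto intro: vec_weight_nonneg\<close>)
  have DA: "?A \<subseteq> nat_vecs (Suc l)" "?B \<subseteq> nat_vecs (Suc l)" by (auto simp: dual_lattice_def)
  have Req: "R_wal \<alpha> \<gamma> l p q = infsum (\<lambda>k. V l k powr (2 * lam)) (dual_lattice l p q - {\<lambda>j\<in>{1..l}. 0})" for l q
    unfolding V_def by (rule R_wal_eq) (use lam0 \<gamma> in simp_all)
  have un: "?D - {?z} = ?A \<union> ?B" by auto
  have "R_wal \<alpha> \<gamma> (Suc l) p (q(Suc l := z)) = infsum ?f (?A \<union> ?B)"
    unfolding Req by (rule arg_cong[OF un])
  also have "\<dots> = infsum ?f ?A + infsum ?f ?B"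
    by (intro infsum_Un_disjoint summable_on_subset_banach[OF sm] DA) auto
  also have "infsum ?f ?A = infsum (\<lambda>k. ?f (k(Suc l := 0))) (dual_lattice l p q - {\<lambda>j\<in>{1..l}. 0})"
    by (rule infsum_reindex_bij_betw[OF bij_betw_dual_lattice_zero, symmetric])
  also have "\<dots> = R_wal \<alpha> \<gamma> l p q"
    unfolding Req V_def vec_weight_Suc by (simp add: coord_weight_def)
  finally show ?thesis .
qed

section \<open>The component-by-component bound\<close>

text \<open>
  Markov's inequality: at least \<open>(1 - \<tau>) (b\<^sup>m - 1)\<close> polynomials have a value of the criterion that is
  not smaller than the value of the chosen one.
\<close>
lemma cbc_step_bound:
  fixes p :: "'b::prime_card mod_ring poly"
  assumes lam: "lam > 1/2" "lam < \<alpha>" and \<gamma>: "\<And>j. j \<ge> 1 \<Longrightarrow> 0 \<le> \<gamma> j"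
    and \<tau>: "0 < \<tau>" "\<tau> < 1" and m: "m \<ge> 1" and p: "p \<in> monic_irreducibles m"
    and y: "y \<in> cbc_candidates ord m \<alpha> \<gamma> \<tau> p (Suc l) q"
  defines "T \<equiv> total_weight CARD('b) (\<alpha> / lam) (\<lambda>j. \<gamma> j powr (1 / lam))"
  shows "R_wal \<alpha> \<gamma> (Suc l) p (q(Suc l := y)) \<le> R_wal \<alpha> \<gamma> l p q +
    ((T (Suc l) - T l) / ((1 - \<tau>) * (real CARD('b) ^ m - 1))) powr (2 * lam)"
proof -
  let ?M = "real CARD('b) ^ m - 1" and ?G = "gen_polys m :: 'b mod_ring poly set"
  let ?g = "\<lambda>j. \<gamma> j powr (1 / lam)"
  let ?V = "vec_weight CARD('b) (\<alpha> / lam) ?g (Suc l)"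
  let ?D = "\<lambda>z. {k \<in> dual_lattice (Suc l) p (q(Suc l := z)). k (Suc l) \<noteq> 0}"
  define \<theta> where "\<theta> z = infsum (\<lambda>k. ?V k powr (2 * lam)) (?D z)" for z
  have b: "2 \<le> CARD('b)" using card_gt_1[where 'b='b] by simp
  have c: "\<alpha> / lam > 1" using lam by simp
  have b1: "1 < CARD('b) ^ m" using b m by (intro one_less_power) auto
  then have M0: "?M > 0" by (metis diff_gt_0_iff_gt of_nat_1 of_nat_less_iff of_nat_power)
  have cardG: "real (card ?G) = ?M" using b1 by (simp add: card_gen_polys of_nat_diff)
  have V0: "0 \<le> ?V k" for k by (rule vec_weight_nonneg) simp
  have Vs: "?V summable_on ?D z" for z
    by (rule summable_on_subset_banach[OF has_sum_imp_summable[OF has_sum_vec_weight[OF b c]]])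
      (auto simp: dual_lattice_iff)
  have R: "R_wal \<alpha> \<gamma> (Suc l) p (q(Suc l := z)) = R_wal \<alpha> \<gamma> l p q + \<theta> z" for z
    unfolding \<theta>_def by (rule R_wal_Suc[OF lam \<gamma>])
  have \<theta>0: "0 \<le> \<theta> z" for z unfolding \<theta>_def by (rule infsum_nonneg) simp
  \<comment> \<open>The root replaces \<open>\<theta>\<close> by a sum linear in the weights, whose
    total over all \<open>z\<close> is known from \<open>sum_new_dual_weights\<close>.\<close>
  have \<theta>_le: "\<theta> z powr (1 / (2 * lam)) \<le> infsum ?V (?D z)" for z
  proof -
    have "\<theta> z \<le> infsum ?V (?D z) powr (2 * lam)"
      unfolding \<theta>_def by (rule infsum_powr_le(2)[OF Vs]) (use V0 lam in auto)
    then have "\<theta> z powr (1 / (2 * lam)) \<le> (infsum ?V (?D z) powr (2 * lam)) powr (1 / (2 * lam))"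
      using \<theta>0 lam by (intro powr_mono2) auto
    also have "\<dots> = infsum ?V (?D z)"
    proof -
      have "0 \<le> infsum ?V (?D z)" by (rule infsum_nonneg) (rule V0)
      then show ?thesis using lam by (simp add: powr_powr)
    qed
    finally show ?thesis .
  qed
  let ?S = "{z \<in> ?G. \<theta> y \<le> \<theta> z}"
  have "card ?G < card {z \<in> ?G. R_wal \<alpha> \<gamma> (Suc l) p (q(Suc l := y)) \<le> R_wal \<alpha> \<gamma> (Suc l) p (q(Suc l := z))} + nat \<lceil>\<tau> * ?M\<rceil>"
    by (rule card_ge_smallest[OF finite_gen_polys]) (use y in \<open>simp only: cbc_candidates_def\<close>)
  then have "card ?G < card ?S + nat \<lceil>\<tau> * ?M\<rceil>" by (simp add: R)
  \<comment> \<open>The strict inequality between integers supplies a 1 that makes up for the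
    rounding in \<open>\<lceil>\<tau> * ?M\<rceil>\<close>.\<close>
  then have "real (card ?G + 1) \<le> real (card ?S + nat \<lceil>\<tau> * ?M\<rceil>)"
    by (simp only: of_nat_le_iff)
  then have "?M + 1 \<le> real (card ?S) + real (nat \<lceil>\<tau> * ?M\<rceil>)"
    by (simp only: of_nat_add cardG of_nat_1)
  moreover have "0 \<le> \<tau> * ?M" using \<tau> M0 by simp
  then have "real (nat \<lceil>\<tau> * ?M\<rceil>) < \<tau> * ?M + 1" by linarith
  ultimately have card: "(1 - \<tau>) * ?M \<le> real (card ?S)" by (simp add: algebra_simps)
  have "(1 - \<tau>) * ?M * \<theta> y powr (1 / (2 * lam)) \<le> real (card ?S) * \<theta> y powr (1 / (2 * lam))"
    by (rule mult_right_mono[OF card]) simp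
  also have "\<dots> = (\<Sum>z\<in>?S. \<theta> y powr (1 / (2 * lam)))" by simp
  also have "\<dots> \<le> (\<Sum>z\<in>?S. infsum ?V (?D z))"
  proof (rule sum_mono)
    fix z assume "z \<in> ?S"
    then have "\<theta> y powr (1 / (2 * lam)) \<le> \<theta> z powr (1 / (2 * lam))"
      using \<theta>0 lam by (intro powr_mono2) auto
    then show "\<theta> y powr (1 / (2 * lam)) \<le> infsum ?V (?D z)" using \<theta>_le[of z] by linarith
  qed
  also have "\<dots> \<le> (\<Sum>z\<in>?G. infsum ?V (?D z))"
    by (rule sum_mono2) (auto simp: finite_gen_polys infsum_nonneg V0)
  also have "\<dots> \<le> T l * (?g (Suc l) * geo_const CARD('b) (\<alpha> / lam))"
    unfolding T_def by (rule sum_new_dual_weights[OF c p]) simp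
  also have "\<dots> = T (Suc l) - T l" by (simp add: T_def total_weight_Suc algebra_simps)
  finally have "\<theta> y powr (1 / (2 * lam)) \<le> (T (Suc l) - T l) / ((1 - \<tau>) * ?M)"
  proof -
    assume *: "(1 - \<tau>) * ?M * \<theta> y powr (1 / (2 * lam)) \<le> T (Suc l) - T l"
    have "0 < (1 - \<tau>) * ?M" using \<tau> M0 by simp
    with * show ?thesis by (simp only: pos_le_divide_eq mult.commute)
  qed
  then have "(\<theta> y powr (1 / (2 * lam))) powr (2 * lam) \<le> ((T (Suc l) - T l) / ((1 - \<tau>) * ?M)) powr (2 * lam)"
    using lam by (intro powr_mono2) auto
  then show ?thesis using lam \<theta>0 by (simp add: R powr_powr)
qed

text \<open>Each component adds the \<open>2 * lam\<close>-th power of an increment of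
  \<open>total_weight\<close>. Such powers are superadditive, so the increments may be collected
  inside the power, where they telescope.\<close>

lemma cbc_bound:
  fixes p :: "'b::prime_card mod_ring poly"
  assumes lam: "lam > 1/2" "lam < \<alpha>" and \<gamma>: "\<And>j. j \<ge> 1 \<Longrightarrow> 0 \<le> \<gamma> j"
    and \<tau>: "0 < \<tau>" "\<tau> < 1" and m: "m \<ge> 1" and p: "p \<in> monic_irreducibles m"
    and q: "cbc_reachable ord m \<alpha> \<gamma> \<tau> p l q"
  shows "R_wal \<alpha> \<gamma> l p q \<le>
    ((total_weight CARD('b) (\<alpha> / lam) (\<lambda>j. \<gamma> j powr (1 / lam)) l - 1) / ((1 - \<tau>) * (real CARD('b) ^ m - 1))) powr (2 * lam)"
  using q
proof (induction rule: cbc_reachable.induct)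
  let ?M = "real CARD('b) ^ m - 1" and ?b = "CARD('b)" and ?c = "\<alpha> / lam"
  let ?g = "\<lambda>j. \<gamma> j powr (1 / lam)"
  let ?T = "total_weight ?b ?c ?g"
  have b: "2 \<le> ?b" using card_gt_1[where 'b='b] by simp
  have c: "?c > 1" using lam by simp
  have b1: "1 < ?b ^ m" using b m by (intro one_less_power) auto
  then have M0: "?M > 0" by (metis diff_gt_0_iff_gt of_nat_1 of_nat_less_iff of_nat_power)
  {
    case first
    let ?q = "\<lambda>j\<in>{1}. 1 :: 'b mod_ring poly"
    let ?V = "vec_weight ?b ?c ?g 1"
    let ?D = "dual_lattice 1 p ?q - {\<lambda>j\<in>{1..1}. 0}"
    let ?E = "{n\<in>{1..}. p dvd nat_poly n}"
    have V0: "0 \<le> ?V k" for k by (rule vec_weight_nonneg) simp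
    \<comment> \<open>As the first component is 1, the one-dimensional dual lattice consists of the
      multiples of \<open>p\<close>, whose share \<open>b powr (- c * m)\<close> of the weight is
      below \<open>1 / ((1 - \<tau>) * ?M)\<close>.\<close>
    have bij: "bij_betw (\<lambda>n. \<lambda>j\<in>{1}. n) ?E ?D"
    proof (rule bij_betw_byWitness[where f' = "\<lambda>k. k 1"])
      show "\<forall>k\<in>?D. (\<lambda>j\<in>{1}. k 1) = k"
        by (auto simp: dual_lattice_iff PiE_def extensional_def fun_eq_iff)
      show "(\<lambda>n. \<lambda>j\<in>{1}. n) ` ?E \<subseteq> ?D"
      proof (intro image_subsetI)
        fix n assume n: "n \<in> ?E"
        then have "(\<lambda>j\<in>{1::nat}. n) \<noteq> (\<lambda>j\<in>{1}. 0)"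
          by (auto simp: fun_eq_iff)
        then show "(\<lambda>j\<in>{1}. n) \<in> ?D" using n by (simp add: dual_lattice_iff restrict_PiE_iff)
      qed
      show "(\<lambda>k. k 1) ` ?D \<subseteq> ?E"
      proof (intro image_subsetI)
        fix k assume k: "k \<in> ?D"
        then have "k 1 \<noteq> 0" by (auto simp: dual_lattice_iff PiE_def extensional_def fun_eq_iff split: if_splits)
        then show "k 1 \<in> ?E" using k by (simp add: dual_lattice_iff One_nat_def)
      qed
    qed simp
    have Vs: "?V summable_on ?D"
      by (rule summable_on_subset_banach[OF has_sum_imp_summable[OF has_sum_vec_weight[OF b c]]])
        (auto simp: dual_lattice_iff)
    have "R_wal \<alpha> \<gamma> 1 p ?q = infsum (\<lambda>k. ?V k powr (2 * lam)) ?D"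
      by (rule R_wal_eq) (use lam \<gamma> in auto)
    also have "\<dots> \<le> infsum ?V ?D powr (2 * lam)"
      by (rule infsum_powr_le(2)[OF Vs]) (use V0 lam in auto)
    also have "infsum ?V ?D = infsum (\<lambda>n. ?V (\<lambda>j\<in>{1}. n)) ?E"
      by (rule infsum_reindex_bij_betw[OF bij, symmetric])
    also have "\<dots> = infsum (\<lambda>n. ?g 1 * digit_decay ?b ?c n) ?E"
      by (intro infsum_cong) (auto simp: vec_weight_def coord_weight_def)
    also have "\<dots> = ?g 1 * (real ?b powr (- ?c * real m) * geo_const ?b ?c)"
      by (rule infsumI[OF has_sum_cmult_right[OF has_sum_digit_decay_dvd[OF c p]]])
    also have "\<dots> powr (2 * lam) \<le> ((?T 1 - 1) / ((1 - \<tau>) * ?M)) powr (2 * lam)"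
    proof (rule powr_mono2)
      have "real m \<le> ?c * real m" using c by (simp only: mult_le_cancel_right1) simp
      then have "real ?b powr (- ?c * real m) \<le> real ?b powr (- real m)"
        using b by (intro powr_mono) simp_all
      also have "\<dots> = 1 / real ?b ^ m" using b by (simp add: powr_minus powr_realpow divide_inverse)
      also have "\<dots> \<le> 1 / ((1 - \<tau>) * ?M)"
      proof (rule divide_left_mono)
        have "(1 - \<tau>) * ?M \<le> 1 * ?M" using \<tau> M0 by (intro mult_right_mono) auto
        also have "\<dots> \<le> real ?b ^ m" by simp
        finally show "(1 - \<tau>) * ?M \<le> real ?b ^ m" .
      qed (use \<tau> M0 in auto)
      finally have "?g 1 * (real ?b powr (- ?c * real m) * geo_const ?b ?c) \<le> ?g 1 * (1 / ((1 - \<tau>) * ?M) * geo_const ?b ?c)"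
        using geo_const_pos[OF b c] by (intro mult_left_mono mult_right_mono) auto
      then show "?g 1 * (real ?b powr (- ?c * real m) * geo_const ?b ?c) \<le> (?T 1 - 1) / ((1 - \<tau>) * ?M)"
        by (simp add: total_weight_def)
    qed (use lam geo_const_pos[OF b c] in auto)
    finally show ?case .
  next
    case (step l q z)
    let ?X = "(?T l - 1) / ((1 - \<tau>) * ?M)" and ?Y = "(?T (Suc l) - ?T l) / ((1 - \<tau>) * ?M)"
    have g0: "0 \<le> ?g j" for j by simp
    have T1: "1 \<le> ?T l" by (rule total_weight_ge_1[OF b c]) simp
    have "0 \<le> ?T l * (?g (Suc l) * geo_const ?b ?c)"
      using T1 geo_const_pos[OF b c] by (intro mult_nonneg_nonneg) auto
    then have T2: "?T l \<le> ?T (Suc l)" by (simp add: total_weight_Suc distrib_left)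
    have "R_wal \<alpha> \<gamma> (Suc l) p (q(Suc l := z)) \<le> R_wal \<alpha> \<gamma> l p q + ?Y powr (2 * lam)"
      by (rule cbc_step_bound[OF lam \<gamma> \<tau> m p step.hyps(2)])
    also have "\<dots> \<le> ?X powr (2 * lam) + ?Y powr (2 * lam)" using step.IH by simp
    also have "\<dots> \<le> (?X + ?Y) powr (2 * lam)"
      using T1 T2 \<tau> M0 lam by (intro powr_superadditive) auto
    also have "?X + ?Y = (?T (Suc l) - 1) / ((1 - \<tau>) * ?M)"
      by (simp flip: add_divide_distrib)
    finally show ?case .
  }
qed

text \<open>A single term is at most the whole criterion, and \<open>2 * lam\<close>-th powers are
  compared. Read contrapositively, vectors of large weight are never dual.\<close>

lemma dual_weight_bound:
  fixes p :: "'b::prime_card mod_ring poly"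
  assumes lam: "lam > 1/2" "lam < \<alpha>" and \<gamma>: "\<And>j. j \<ge> 1 \<Longrightarrow> 0 \<le> \<gamma> j"
    and \<tau>: "0 < \<tau>" "\<tau> < 1" and m: "m \<ge> 1" and p: "p \<in> monic_irreducibles m"
    and q: "q \<in> cbc_vectors ord m s \<alpha> \<gamma> \<tau> p"
    and k: "k \<in> dual_lattice s p q" "k \<noteq> (\<lambda>j\<in>{1..s}. 0)"
  defines "g \<equiv> \<lambda>j. \<gamma> j powr (1 / lam)"
  shows "vec_weight CARD('b) (\<alpha> / lam) g s k \<le>
    (total_weight CARD('b) (\<alpha> / lam) g s - 1) / ((1 - \<tau>) * (real CARD('b) ^ m - 1))"
proof -
  let ?V = "vec_weight CARD('b) (\<alpha> / lam) g s"
  let ?X = "(total_weight CARD('b) (\<alpha> / lam) g s - 1) / ((1 - \<tau>) * (real CARD('b) ^ m - 1))"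
  let ?D = "dual_lattice s p q - {\<lambda>j\<in>{1..s}. 0}"
  have b: "2 \<le> CARD('b)" using card_gt_1[where 'b='b] by simp
  have c: "\<alpha> / lam > 1" using lam by simp
  have V0: "0 \<le> ?V k" for k by (rule vec_weight_nonneg) (simp add: g_def)
  have "?V summable_on nat_vecs s"
    by (rule has_sum_imp_summable[OF has_sum_vec_weight[OF b c]]) (simp add: g_def)
  moreover have "?D \<subseteq> nat_vecs s" by (auto simp: dual_lattice_def)
  ultimately have Vs: "?V summable_on ?D" by (rule summable_on_subset_banach)
  have "?V k powr (2 * lam) = (\<Sum>k\<in>{k}. ?V k powr (2 * lam))" by simp
  also have "\<dots> \<le> infsum (\<lambda>k. ?V k powr (2 * lam)) ?D"
    by (rule finite_sum_le_infsum[OF infsum_powr_le(1)[OF Vs]]) (use V0 lam k in simp_all)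
  also have "\<dots> = R_wal \<alpha> \<gamma> s p q"
    unfolding g_def by (rule R_wal_eq[symmetric]) (use lam \<gamma> in auto)
  also have "\<dots> \<le> ?X powr (2 * lam)"
    unfolding g_def by (rule cbc_bound[OF lam \<gamma> \<tau> m p]) (use q in \<open>auto simp: cbc_vectors_def\<close>)
  finally have le: "?V k powr (2 * lam) \<le> ?X powr (2 * lam)" .
  show ?thesis
  proof (rule ccontr)
    assume "\<not> ?V k \<le> ?X"
    moreover have "0 \<le> ?X"
    proof (intro divide_nonneg_nonneg mult_nonneg_nonneg)
      show "0 \<le> total_weight CARD('b) (\<alpha> / lam) g s - 1"
        using total_weight_ge_1[OF b c, of g s] by (simp add: g_def)
      show "0 \<le> real CARD('b) ^ m - 1" using b by (simp add: one_le_power)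
    qed (use \<tau> in simp)
    ultimately have "?X powr (2 * lam) < ?V k powr (2 * lam)"
      using lam by (intro powr_less_mono2) auto
    with le show False by simp
  qed
qed

section \<open>The randomized error\<close>

text \<open>As all coordinate weights are at most 1, one may be kept. This ties the weight to the
  digit count of the same coordinate that occurs in \<open>dual_prob_le\<close>.\<close>

lemma vec_weight_le_digit_decay:
  assumes b: "b \<ge> 2" and c: "c > 0" and g: "\<And>j. j \<ge> 1 \<Longrightarrow> 0 \<le> g j \<and> g j \<le> 1"
    and i: "i \<in> {1..l}" "k i \<noteq> 0"
  shows "vec_weight b c g l k \<le> digit_decay b c (k i)"
proof -
  have d1: "digit_decay b c n \<le> 1" for n
    unfolding digit_decay_def using b c powr_mono[of "- c * real (floorlog b n)" 0 "real b"] by simp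
  have w1: "0 \<le> coord_weight b c (g j) n \<and> coord_weight b c (g j) n \<le> digit_decay b c n \<or> n = 0" if "j \<ge> 1" for j n
    using g[OF that] mult_right_mono[of "g j" 1 "digit_decay b c n"] by (auto simp: coord_weight_def)
  have w: "0 \<le> coord_weight b c (g j) n" "coord_weight b c (g j) n \<le> 1" if "j \<ge> 1" for j n
    using w1[OF that, of n] d1[of n] by (auto simp: coord_weight_def)
  have "vec_weight b c g l k = coord_weight b c (g i) (k i) * (\<Prod>j\<in>{1..l} - {i}. coord_weight b c (g j) (k j))"
    unfolding vec_weight_def using i by (intro prod.remove) auto
  also have "\<dots> \<le> digit_decay b c (k i) * 1"
    using w w1[of i "k i"] i by (intro mult_mono prod_le_1 prod_nonneg) auto
  finally show ?thesis by simp
qed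

text \<open>From \<open>y * exp (- y) \<le> 1\<close> with \<open>y = a * ln 2 * x\<close>; passing
  from \<open>ln B\<close> to \<open>ln 2\<close> makes the bound independent of the prime.\<close>

lemma mult_powr_neg_le:
  fixes x :: real
  assumes "a > 0" "B \<ge> 2" "x \<ge> 0"
  shows "x * B powr (- (a * x)) \<le> 1 / (a * ln 2)"
proof -
  have l: "0 < ln (2::real)" "ln 2 \<le> ln B" using assms by simp_all
  let ?y = "a * ln 2 * x"
  have y: "?y \<le> a * ln B * x" using assms l by (intro mult_right_mono mult_left_mono) auto
  have "B powr (- (a * x)) = exp (- (a * ln B * x))" using assms by (simp add: powr_def mult_ac)
  also have "\<dots> \<le> exp (- ?y)" using y by simp
  finally have "x * B powr (- (a * x)) \<le> x * exp (- ?y)" using assms by (intro mult_left_mono) auto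
  also have "\<dots> \<le> 1 / (a * ln 2)"
  proof -
    have "?y \<le> exp ?y" using exp_ge_add_one_self[of ?y] by linarith
    then have "?y * exp (- ?y) \<le> exp ?y * exp (- ?y)" by (rule mult_right_mono) simp
    then have "?y * exp (- ?y) \<le> 1" by (simp flip: exp_add)
    then show ?thesis using assms l by (simp add: pos_le_divide_eq mult_ac)
  qed
  finally show ?thesis .
qed

text \<open>The probability \<open>\<omega>(k)\<close> of the overview.\<close>

definition dual_prob ::
  "('b::prime_card mod_ring poly \<times> 'b mod_ring poly) set \<Rightarrow> nat \<Rightarrow> nat \<Rightarrow> real \<Rightarrow> (nat \<Rightarrow> real) \<Rightarrow> real \<Rightarrow> (nat \<Rightarrow> nat) \<Rightarrow> real"
  where "dual_prob ord m s \<alpha> \<gamma> \<tau> k =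
    1 / real (card (monic_irreducibles m :: 'b mod_ring poly set)) *
    (\<Sum>p\<in>(monic_irreducibles m :: 'b mod_ring poly set). 1 / real (card (cbc_vectors ord m s \<alpha> \<gamma> \<tau> p)) *
      real (card {q \<in> cbc_vectors ord m s \<alpha> \<gamma> \<tau> p. k \<in> dual_lattice s p q}))"

lemma dual_prob_nonneg: "0 \<le> dual_prob ord m s \<alpha> \<gamma> \<tau> k"
  unfolding dual_prob_def by (intro mult_nonneg_nonneg sum_nonneg) auto

lemma dual_prob_le:
  fixes ord :: "('b::prime_card mod_ring poly \<times> 'b mod_ring poly) set"
  assumes lin: "linear_order_on (gen_polys m) ord" and \<tau>: "0 < \<tau>" "\<tau> < 1" and m: "m \<ge> 1"
    and i: "i \<in> {1..s}" "k i \<noteq> 0"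
  shows "dual_prob ord m s \<alpha> \<gamma> \<tau> k \<le> (1 / \<tau> + 2) * real (floorlog CARD('b) (k i)) / (real CARD('b) ^ m - 1)"
proof -
  let ?P = "monic_irreducibles m :: 'b mod_ring poly set" and ?M = "real CARD('b) ^ m - 1"
  let ?Q = "\<lambda>p. cbc_vectors ord m s \<alpha> \<gamma> \<tau> p" and ?\<mu> = "floorlog CARD('b) (k i)"
  let ?N = "cbc_num TYPE('b) m \<tau>"
  have s: "s \<ge> 1" using i by simp
  have b: "2 \<le> CARD('b)" using card_gt_1[where 'b='b] by simp
  then have b1: "1 < CARD('b) ^ m" using m by (intro one_less_power) auto
  then have M0: "?M > 0" by (metis diff_gt_0_iff_gt of_nat_1 of_nat_less_iff of_nat_power)
  have \<tau>M: "0 < \<tau> * ?M" using \<tau> M0 by simp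
  have N: "\<tau> * ?M \<le> real ?N" unfolding cbc_num_def using \<tau>M by linarith
  have cP: "CARD('b) ^ m \<le> 2 * m * card ?P" by (rule card_monic_irreducibles_ge[OF m])
  have P0: "card ?P > 0" using cP b1 by (intro Nat.gr0I) simp
  have \<mu>: "?\<mu> = Suc (degree (nat_poly (k i) :: 'b mod_ring poly))" by (rule floorlog_eq_degree[OF i(2)])
  \<comment> \<open>The conditional probability given \<open>p\<close>; when \<open>p\<close>
    divides \<open>nat_poly (k i)\<close>, only the trivial bound 1 is used.\<close>
  have each: "1 / real (card (?Q p)) * real (card {q \<in> ?Q p. k \<in> dual_lattice s p q})
      \<le> 1 / (\<tau> * ?M) + (if p dvd nat_poly (k i) then 1 else 0)" if p: "p \<in> ?P" for p
  proof -
    let ?D = "{q \<in> ?Q p. k \<in> dual_lattice s p q}"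
    have N0: "?N > 0" using N \<tau>M by (intro Nat.gr0I) simp
    have cQ: "card (?Q p) > 0" unfolding card_cbc_vectors[OF lin less_imp_le[OF \<tau>(2)] m s] using N0 by simp
    have finQ: "finite (?Q p)" by (rule finite_cbc_vectors[OF m s])
    show ?thesis
    proof (cases "p dvd nat_poly (k i)")
      case True
      have "card ?D \<le> card (?Q p)" by (rule card_mono[OF finQ]) auto
      then have "1 / real (card (?Q p)) * real (card ?D) \<le> 1" using cQ by simp
      moreover have "0 \<le> 1 / (\<tau> * ?M)" using \<tau>M by simp
      ultimately have "1 / real (card (?Q p)) * real (card ?D) \<le> 1 / (\<tau> * ?M) + 1" by linarith
      then show ?thesis using True by (simp only: if_True)
    next
      case False
      let ?E = "{q \<in> ?Q p. p dvd (\<Sum>j\<in>{1..s}. nat_poly (k j) * q j)}"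
      have "card ?D \<le> card ?E"
        by (rule card_mono) (use finQ in \<open>auto simp: dual_lattice_iff\<close>)
      then have "?N * card ?D \<le> ?N * card ?E" by simp
      also have "\<dots> \<le> card (?Q p)"
        by (rule card_cbc_vectors_dual[OF lin less_imp_le[OF \<tau>(2)] m s p]) (use i False in blast)
      finally have "real ?N * real (card ?D) \<le> real (card (?Q p))" by (simp flip: of_nat_mult)
      moreover have "\<tau> * ?M * real (card ?D) \<le> real ?N * real (card ?D)" using N by (rule mult_right_mono) simp
      ultimately have "\<tau> * ?M * real (card ?D) \<le> real (card (?Q p))" by linarith
      then have "real (card ?D) / real (card (?Q p)) \<le> 1 / (\<tau> * ?M)"
        using cQ by (simp add: pos_le_divide_eq[OF \<tau>M] pos_divide_le_eq mult.commute)
      then show ?thesis using False by simp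
    qed
  qed
  have "dual_prob ord m s \<alpha> \<gamma> \<tau> k \<le> 1 / real (card ?P) * (\<Sum>p\<in>?P. 1 / (\<tau> * ?M) + (if p dvd nat_poly (k i) then 1 else 0))"
    unfolding dual_prob_def by (intro mult_left_mono sum_mono each) auto
  also have "(\<Sum>p\<in>?P. 1 / (\<tau> * ?M) + (if p dvd nat_poly (k i) then 1 else 0)) =
      real (card ?P) / (\<tau> * ?M) + real (card {p \<in> ?P. p dvd nat_poly (k i)})"
    by (simp add: sum.distrib flip: sum.inter_filter)
  also have "1 / real (card ?P) * \<dots> = 1 / (\<tau> * ?M) + real (card {p \<in> ?P. p dvd nat_poly (k i)}) / real (card ?P)"
  proof -
    have "1 / x * (x / A + B) = 1 / A + B / x" if "x > 0" for x A B :: real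
      using that by (simp add: distrib_left)
    from this[OF of_nat_0_less_iff[THEN iffD2, OF P0]] show ?thesis .
  qed
  \<comment> \<open>Since \<open>?\<mu> \<ge> 1\<close>, this summand can be brought to the form of
    the other one.\<close>
  also have "1 / (\<tau> * ?M) \<le> 1 / \<tau> * real ?\<mu> / ?M"
    using \<tau> M0 by (simp add: \<mu> field_simps)
  \<comment> \<open>The \<open>m\<close> gained in counting divisors of degree \<open>m\<close>
    cancels the \<open>m\<close> in the lower bound for the number of irreducibles, leaving the
    factor 2.\<close>
  also have "real (card {p \<in> ?P. p dvd nat_poly (k i)}) / real (card ?P) \<le> 2 * real ?\<mu> / ?M"
  proof -
    let ?C = "card {p \<in> ?P. p dvd nat_poly (k i)}"
    have "m * ?C \<le> ?\<mu>"
      using card_monic_irreducible_divisors[of "nat_poly (k i) :: 'b mod_ring poly" m] i(2) by (simp add: \<mu>)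
    have "CARD('b) ^ m * ?C \<le> (2 * m * card ?P) * ?C" using cP by (rule mult_right_mono) simp
    also have "\<dots> = 2 * card ?P * (m * ?C)" by simp
    also have "\<dots> \<le> 2 * card ?P * ?\<mu>" using \<open>m * ?C \<le> ?\<mu>\<close> by (rule mult_left_mono) simp
    finally have "real (CARD('b) ^ m * ?C) \<le> real (2 * card ?P * ?\<mu>)" by (simp only: of_nat_le_iff)
    moreover have "?M * real ?C \<le> real CARD('b) ^ m * real ?C" by (intro mult_right_mono) auto
    ultimately have "?M * real ?C \<le> 2 * real (card ?P) * real ?\<mu>" by simp
    then show ?thesis using P0 M0 by (simp add: pos_le_divide_eq pos_divide_le_eq mult_ac)
  qed
  finally show ?thesis by (simp add: add_divide_distrib distrib_right)
qed

lemma dual_prob_pos_weight: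
  fixes ord :: "('b::prime_card mod_ring poly \<times> 'b mod_ring poly) set"
  assumes lam: "lam > 1/2" "lam < \<alpha>" and \<gamma>: "\<And>j. j \<ge> 1 \<Longrightarrow> 0 \<le> \<gamma> j"
    and \<tau>: "0 < \<tau>" "\<tau> < 1" and m: "m \<ge> 1"
    and k: "k \<noteq> (\<lambda>j\<in>{1..s}. 0)" and pos: "dual_prob ord m s \<alpha> \<gamma> \<tau> k \<noteq> 0"
  defines "g \<equiv> \<lambda>j. \<gamma> j powr (1 / lam)"
  shows "vec_weight CARD('b) (\<alpha> / lam) g s k \<le>
    (total_weight CARD('b) (\<alpha> / lam) g s - 1) / ((1 - \<tau>) * (real CARD('b) ^ m - 1))"
proof -
  have "\<exists>p\<in>monic_irreducibles m. {q \<in> cbc_vectors ord m s \<alpha> \<gamma> \<tau> p. k \<in> dual_lattice s p q} \<noteq> {}"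
  proof (rule ccontr)
    assume "\<not> ?thesis"
    then have e: "{q \<in> cbc_vectors ord m s \<alpha> \<gamma> \<tau> p. k \<in> dual_lattice s p q} = {}" if "p \<in> monic_irreducibles m" for p
      using that by blast
    have "dual_prob ord m s \<alpha> \<gamma> \<tau> k = 0"
      unfolding dual_prob_def by (simp add: e cong: sum.cong)
    with pos show False by simp
  qed
  then obtain p q where pq: "p \<in> monic_irreducibles m" "q \<in> cbc_vectors ord m s \<alpha> \<gamma> \<tau> p" "k \<in> dual_lattice s p q"
    by blast
  then show ?thesis
    unfolding g_def by (intro dual_weight_bound[OF lam _ \<tau> m pq k]) (rule \<gamma>)
qed

text \<open>Averaging over \<open>p\<close> and \<open>q\<close> is a finite operation and commutes
  with the sum over \<open>k\<close>. Only finite partial sums have to be bounded, which is the form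
  in which Cauchy-Schwarz is applied.\<close>

lemma expected_error_le:
  fixes ord :: "('b::prime_card mod_ring poly \<times> 'b mod_ring poly) set"
  assumes m: "m \<ge> 1" "s \<ge> 1" and f: "f \<in> walsh_space CARD('b) s \<alpha> \<gamma>"
    and bound: "\<And>F. finite F \<Longrightarrow> F \<subseteq> nat_vecs s - {\<lambda>j\<in>{1..s}. 0} \<Longrightarrow>
      (\<Sum>k\<in>F. dual_prob ord m s \<alpha> \<gamma> \<tau> k * cmod (walsh_coeff CARD('b) s f k)) \<le> X"
  shows "1 / real (card (monic_irreducibles m :: 'b mod_ring poly set)) *
         (\<Sum>p\<in>(monic_irreducibles m :: 'b mod_ring poly set).
            1 / real (card (cbc_vectors ord m s \<alpha> \<gamma> \<tau> p)) *
            (\<Sum>q\<in>cbc_vectors ord m s \<alpha> \<gamma> \<tau> p.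
               \<bar>lattice_rule s m f p q - cube_integral s f\<bar>)) \<le> X"
proof -
  let ?P = "monic_irreducibles m :: 'b mod_ring poly set" and ?Q = "\<lambda>p. cbc_vectors ord m s \<alpha> \<gamma> \<tau> p"
  let ?c = "\<lambda>k. cmod (walsh_coeff CARD('b) s f k)" and ?z = "\<lambda>j\<in>{1..s}. 0 :: nat"
  let ?K = "nat_vecs s - {?z}"
  define I where "I p q k = (if k \<in> dual_lattice s p q then ?c k else 0)" for p :: "'b mod_ring poly" and q k
  have "?c summable_on nat_vecs s" using f by (simp add: walsh_space_def)
  then have cs: "?c summable_on ?K" by (rule summable_on_subset_banach) auto
  have Is: "I p q summable_on ?K" for p q
    by (rule summable_on_comparison_test[OF cs]) (auto simp: I_def)
  have err: "\<bar>lattice_rule s m f p q - cube_integral s f\<bar> \<le> infsum (I p q) ?K" if "p \<in> ?P" for p q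
  proof -
    have "\<bar>lattice_rule s m f p q - cube_integral s f\<bar> \<le> infsum ?c (dual_lattice s p q - {?z})"
      using that by (intro lattice_rule_error[OF f]) (auto simp: monic_irreducibles_def)
    also have "\<dots> = infsum (I p q) ?K"
      by (rule infsum_cong_neutral) (auto simp: I_def dual_lattice_iff)
    finally show ?thesis .
  qed
  define w where "w p = 1 / real (card (?Q p))" for p
  define E where "E = 1 / real (card ?P) * (\<Sum>p\<in>?P. w p * (\<Sum>q\<in>?Q p. infsum (I p q) ?K))"
  have "((\<lambda>k. 1 / real (card ?P) * (\<Sum>p\<in>?P. w p * (\<Sum>q\<in>?Q p. I p q k))) has_sum E) ?K"
    unfolding E_def by (intro has_sum_cmult_right has_sum_finite_sum has_sum_infsum Is)
  moreover have eq: "1 / real (card ?P) * (\<Sum>p\<in>?P. w p * (\<Sum>q\<in>?Q p. I p q k)) = dual_prob ord m s \<alpha> \<gamma> \<tau> k * ?c k" for k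
  proof -
    have "(\<Sum>q\<in>?Q p. I p q k) = real (card {q \<in> ?Q p. k \<in> dual_lattice s p q}) * ?c k" for p
      unfolding I_def using finite_cbc_vectors[OF m, of ord \<alpha> \<gamma> \<tau> p] by (simp flip: sum.inter_filter)
    then show ?thesis by (simp add: dual_prob_def w_def sum_distrib_right sum_distrib_left mult_ac)
  qed
  ultimately have "((\<lambda>k. dual_prob ord m s \<alpha> \<gamma> \<tau> k * ?c k) has_sum E) ?K" by (simp only:)
  then have "E \<le> X" by (rule has_sum_le_finite_sums[OF _ bound])
  moreover have "1 / real (card ?P) * (\<Sum>p\<in>?P. w p * (\<Sum>q\<in>?Q p. \<bar>lattice_rule s m f p q - cube_integral s f\<bar>)) \<le> E"
    unfolding E_def by (intro mult_left_mono sum_mono err) (simp_all add: w_def)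
  ultimately show ?thesis by (simp only: w_def)
qed

section \<open>The Cauchy-Schwarz argument and the final constant\<close>

lemma weighted_dual_prob_le:
  fixes ord :: "('b::prime_card mod_ring poly \<times> 'b mod_ring poly) set"
  assumes lam: "lam > 1/2" "lam < \<alpha>" and \<delta>: "0 < \<delta>" "\<delta> < lam - 1/2"
    and \<gamma>: "\<And>j. j \<ge> 1 \<Longrightarrow> 0 \<le> \<gamma> j \<and> \<gamma> j \<le> 1"
    and \<tau>: "0 < \<tau>" "\<tau> < 1" and m: "m \<ge> 1" and lin: "linear_order_on (gen_polys m) ord"
    and k: "k \<in> nat_vecs s" "k \<noteq> (\<lambda>j\<in>{1..s}. 0)"
  defines "g \<equiv> \<lambda>j. \<gamma> j powr (1 / lam)" and "M \<equiv> real CARD('b) ^ m - 1"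
  defines "V \<equiv> vec_weight CARD('b) (\<alpha> / lam) g s" and "W \<equiv> total_weight CARD('b) (\<alpha> / lam) g s - 1"
  shows "(dual_prob ord m s \<alpha> \<gamma> \<tau> k * V k powr lam)\<^sup>2 \<le>
    ((1 / \<tau> + 2) / (\<delta> * ln 2) / M)\<^sup>2 * (W / ((1 - \<tau>) * M)) powr (2 * lam - 2 * \<delta> - 1) * V k"
proof (cases "dual_prob ord m s \<alpha> \<gamma> \<tau> k = 0")
  case True
  have "0 \<le> V k" unfolding V_def by (rule vec_weight_nonneg) (simp add: g_def)
  then show ?thesis using True by simp
next
  case False
  let ?w = "dual_prob ord m s \<alpha> \<gamma> \<tau> k" and ?X = "W / ((1 - \<tau>) * M)" and ?K = "1 / \<tau> + 2"
  have b: "2 \<le> CARD('b)" using card_gt_1[where 'b='b] by simp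
  have "1 < CARD('b) ^ m" using b m by (intro one_less_power) auto
  then have M0: "M > 0" unfolding M_def by (metis diff_gt_0_iff_gt of_nat_1 of_nat_less_iff of_nat_power)
  have V0: "0 \<le> V k" unfolding V_def by (rule vec_weight_nonneg) (simp add: g_def)
  have VX: "V k \<le> ?X"
    unfolding V_def W_def M_def g_def
    by (rule dual_prob_pos_weight[OF lam _ \<tau> m k(2) False]) (use \<gamma> in simp)
  obtain i where i: "i \<in> {1..s}" "k i \<noteq> 0"
    using k by (auto simp: fun_eq_iff PiE_def extensional_def split: if_splits)
  let ?\<mu> = "real (floorlog CARD('b) (k i))"
  have w: "?w \<le> ?K * ?\<mu> / M" unfolding M_def by (rule dual_prob_le[where k = k and i = i, OF lin \<tau> m i])
  have c: "1 < \<alpha> / lam" using lam by simp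
  have g01: "0 \<le> g j \<and> g j \<le> 1" if "j \<ge> 1" for j
    using \<gamma>[OF that] lam powr_mono2[of "1 / lam" "\<gamma> j" 1] by (simp add: g_def)
  have "V k \<le> digit_decay CARD('b) (\<alpha> / lam) (k i)"
    unfolding V_def by (rule vec_weight_le_digit_decay[where k = k and i = i, OF b _ _ i]) (use c g01 in simp_all)
  also have "\<dots> \<le> real CARD('b) powr (- ?\<mu>)"
    unfolding digit_decay_def
  proof (rule powr_mono)
    have "1 * ?\<mu> \<le> \<alpha> / lam * ?\<mu>" using c by (intro mult_right_mono) auto
    then show "- (\<alpha> / lam) * ?\<mu> \<le> - ?\<mu>" by simp
  qed (use b in simp)
  finally have "V k powr \<delta> \<le> (real CARD('b) powr (- ?\<mu>)) powr \<delta>"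
    using V0 \<delta> by (intro powr_mono2) auto
  also have "\<dots> = real CARD('b) powr (- (\<delta> * ?\<mu>))" by (simp add: powr_powr mult.commute)
  finally have "?\<mu> * V k powr \<delta> \<le> ?\<mu> * real CARD('b) powr (- (\<delta> * ?\<mu>))" by (rule mult_left_mono) simp
  also have "\<dots> \<le> 1 / (\<delta> * ln 2)" using \<delta> b by (intro mult_powr_neg_le) auto
  finally have \<mu>V: "?\<mu> * V k powr \<delta> \<le> 1 / (\<delta> * ln 2)" .
  have K0: "0 \<le> ?K" using \<tau> by simp
  have split: "V k powr lam = V k powr \<delta> * V k powr (lam - \<delta>)" by (simp flip: powr_add)
  have "?w * V k powr lam \<le> ?K * ?\<mu> / M * V k powr lam" by (rule mult_right_mono[OF w]) simp
  also have "\<dots> = ?K / M * (?\<mu> * V k powr \<delta>) * V k powr (lam - \<delta>)" by (simp add: split)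
  also have "\<dots> \<le> ?K / M * (1 / (\<delta> * ln 2)) * V k powr (lam - \<delta>)"
    using \<mu>V K0 M0 by (intro mult_right_mono mult_left_mono) auto
  finally have "?w * V k powr lam \<le> ?K / (\<delta> * ln 2) / M * V k powr (lam - \<delta>)" by (simp add: mult_ac)
  then have "(?w * V k powr lam)\<^sup>2 \<le> (?K / (\<delta> * ln 2) / M * V k powr (lam - \<delta>))\<^sup>2"
    by (rule power_mono) (simp add: dual_prob_nonneg)
  also have "\<dots> = (?K / (\<delta> * ln 2) / M)\<^sup>2 * (V k powr (lam - \<delta>))\<^sup>2" by (simp only: power_mult_distrib)
  also have "\<dots> \<le> (?K / (\<delta> * ln 2) / M)\<^sup>2 * (?X powr (2 * lam - 2 * \<delta> - 1) * V k)"
  proof (rule mult_left_mono)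
    \<comment> \<open>The exponent \<open>2 * lam - 2 * \<delta>\<close> is split so that one factor
      \<open>V k\<close> survives for the summation over \<open>k\<close>; the rest has a positive
      exponent and is monotone, so the threshold \<open>?X\<close> applies.\<close>
    have "(V k powr (lam - \<delta>))\<^sup>2 = V k powr (1 + (2 * lam - 2 * \<delta> - 1))"
      by (simp add: power2_eq_square flip: powr_add)
    also have "\<dots> = V k * V k powr (2 * lam - 2 * \<delta> - 1)"
      using V0 by (simp only: powr_mult_base)
    also have "\<dots> \<le> V k * ?X powr (2 * lam - 2 * \<delta> - 1)"
      using V0 VX \<delta> by (intro mult_left_mono powr_mono2) auto
    finally show "(V k powr (lam - \<delta>))\<^sup>2 \<le> ?X powr (2 * lam - 2 * \<delta> - 1) * V k"
      by (simp only: mult.commute)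
  qed simp
  finally show ?thesis by (simp only: mult.assoc)
qed

text \<open>Used with \<open>x = lam - \<delta>\<close> and \<open>a = 1 - \<tau>\<close>. The
  exponent of \<open>M\<close> comes from \<open>2 + (2 * x - 1) = 2 * (x + 1/2)\<close>.\<close>

lemma squared_error_constant:
  fixes M a W K x :: real
  assumes M: "0 < M" and a: "0 < a" and W: "0 \<le> W"
  shows "(K / M)\<^sup>2 * (W / (a * M)) powr (2 * x - 1) * W =
    (K * a powr (- (x - 1/2)) / M powr (x + 1/2) * W powr x)\<^sup>2"
proof -
  have sq: "(z powr u)\<^sup>2 = z powr (2 * u)" for z u :: real
    by (simp only: power2_eq_square powr_add[symmetric] mult_2)
  have "W * W powr (2 * x - 1) = W powr (1 + (2 * x - 1))" by (rule powr_mult_base[OF W])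
  then have W2: "W powr (2 * x) = W * W powr (2 * x - 1)" by simp
  have "M powr (2 * (x + 1/2)) = M powr (2 + (2 * x - 1))" by (simp add: algebra_simps)
  also have "\<dots> = M\<^sup>2 * M powr (2 * x - 1)" using M by (simp only: powr_add) simp
  finally have M2: "M powr (2 * (x + 1/2)) = M\<^sup>2 * M powr (2 * x - 1)" .
  have "a powr (2 * (- (x - 1/2))) = a powr (- (2 * x - 1))" by (simp add: algebra_simps)
  then have a2: "a powr (2 * (- (x - 1/2))) = 1 / a powr (2 * x - 1)" by (simp only: powr_minus_divide)
  have q: "(W / (a * M)) powr (2 * x - 1) = W powr (2 * x - 1) / (a powr (2 * x - 1) * M powr (2 * x - 1))"
    using M a W by (simp only: powr_divide powr_mult mult_nonneg_nonneg less_imp_le)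
  show ?thesis
    unfolding power_mult_distrib power_divide sq W2 M2 a2 q by (simp add: mult_ac)
qed

lemma expected_error_bound:
  fixes ord :: "('b::prime_card mod_ring poly \<times> 'b mod_ring poly) set"
  assumes lam: "lam > 1/2" "lam < \<alpha>" and \<delta>: "0 < \<delta>" "\<delta> < lam - 1/2"
    and \<gamma>: "\<And>j. j \<ge> 1 \<Longrightarrow> 0 \<le> \<gamma> j \<and> \<gamma> j \<le> 1"
    and \<tau>: "0 < \<tau>" "\<tau> < 1" and m: "m \<ge> 1" and lin: "linear_order_on (gen_polys m) ord"
    and f: "f \<in> walsh_space CARD('b) s \<alpha> \<gamma>" "walsh_norm CARD('b) s \<alpha> \<gamma> f \<le> 1"
    and F: "finite F" "F \<subseteq> nat_vecs s - {\<lambda>j\<in>{1..s}. 0}"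
  defines "M \<equiv> real CARD('b) ^ m - 1"
  shows "(\<Sum>k\<in>F. dual_prob ord m s \<alpha> \<gamma> \<tau> k * cmod (walsh_coeff CARD('b) s f k)) \<le>
    ((1 / \<tau> + 2) / (\<delta> * ln 2) * (1 - \<tau>) powr (- (lam - \<delta> - 1/2))) / M powr (lam + 1/2 - \<delta>) *
      weight_sum CARD('b) s \<alpha> \<gamma> lam powr (lam - \<delta>)"
    (is "?lhs \<le> ?C / _ * _")
proof -
  let ?g = "\<lambda>j. \<gamma> j powr (1 / lam)"
  define V where "V = vec_weight CARD('b) (\<alpha> / lam) ?g s"
  define W where "W = weight_sum CARD('b) s \<alpha> \<gamma> lam"
  let ?w = "dual_prob ord m s \<alpha> \<gamma> \<tau>" and ?r = "r_wal CARD('b) \<alpha> \<gamma> s"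
  let ?c = "\<lambda>k. cmod (walsh_coeff CARD('b) s f k)" and ?z = "\<lambda>j\<in>{1..s}. 0 :: nat"
  let ?e = "2 * lam - 2 * \<delta> - 1" and ?K = "(1 / \<tau> + 2) / (\<delta> * ln 2)"
  have b: "2 \<le> CARD('b)" using card_gt_1[where 'b='b] by simp
  have "1 < CARD('b) ^ m" using b m by (intro one_less_power) auto
  then have M0: "M > 0" unfolding M_def by (metis diff_gt_0_iff_gt of_nat_1 of_nat_less_iff of_nat_power)
  have c: "\<alpha> / lam > 1" using lam by simp
  have W: "W = total_weight CARD('b) (\<alpha> / lam) ?g s - 1"
    unfolding W_def by (rule weight_sum_eq) (use \<gamma> in simp)
  have W0: "0 \<le> W" using total_weight_ge_1[OF b c, of ?g s] by (simp add: W)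
  have V0: "0 \<le> V k" for k unfolding V_def by (rule vec_weight_nonneg) simp
  have bnd: "(?w k * V k powr lam)\<^sup>2 \<le> (?K / M)\<^sup>2 * (W / ((1 - \<tau>) * M)) powr ?e * V k" if "k \<in> F" for k
    unfolding V_def W M_def
    by (rule weighted_dual_prob_le[OF lam \<delta> \<gamma> \<tau> m lin]) (use that F in auto)
  have sumV: "sum V F \<le> W"
  proof -
    have hs: "(V has_sum (W + 1)) (nat_vecs s)"
      unfolding V_def W using has_sum_vec_weight[OF b c, of ?g s] by simp
    \<comment> \<open>Including the zero vector, which has weight 1, improves the bound for the rest
      from \<open>W + 1\<close> to \<open>W\<close>.\<close>
    have "sum V (insert ?z F) \<le> W + 1"
      by (rule finite_sum_le_has_sum[OF hs]) (use F V0 in auto)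
    moreover have "sum V (insert ?z F) = V ?z + sum V F" using F by (intro sum.insert) auto
    moreover have "V ?z = 1" by (simp add: V_def vec_weight_def coord_weight_def)
    ultimately show ?thesis by linarith
  qed
  have inv: "inverse (?r k) = V k powr lam" for k
    unfolding V_def by (rule inverse_r_wal[OF b]) (use lam \<gamma> in simp_all)
  \<comment> \<open>The factor \<open>V k powr lam\<close> cancels \<open>?r k\<close> unless the
    latter is 0; in that case some \<open>\<gamma> j\<close> vanishes and the definition of the
    space makes the coefficient 0.\<close>
  have coeff: "?w k * ?c k = (?w k * V k powr lam) * (\<bar>?r k\<bar> * ?c k)" if "k \<in> F" for k
  proof (cases "?r k = 0")
    case True
    then obtain j where "j \<in> {1..s}" "k j \<noteq> 0" "\<gamma> j = 0"
      using b by (auto simp: r_wal_def)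
    then have "walsh_coeff CARD('b) s f k = 0"
      using f(1) that F unfolding walsh_space_def by blast
    then show ?thesis by simp
  next
    case False
    have "\<bar>?r k\<bar> = ?r k" using inv[of k] by (metis abs_of_nonneg inverse_nonnegative_iff_nonnegative powr_ge_zero)
    then show ?thesis using False by (simp flip: inv)
  qed
  have "(\<Sum>k\<in>F. (\<bar>?r k\<bar> * ?c k)\<^sup>2) \<le> 1"
  proof -
    have sm: "(\<lambda>k. (?r k)\<^sup>2 * (?c k)\<^sup>2) summable_on nat_vecs s" using f(1) by (simp add: walsh_space_def)
    have "(\<Sum>k\<in>F. (?r k)\<^sup>2 * (?c k)\<^sup>2) \<le> infsum (\<lambda>k. (?r k)\<^sup>2 * (?c k)\<^sup>2) (nat_vecs s)"
      by (rule finite_sum_le_infsum[OF sm]) (use F in auto)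
    also have "\<dots> \<le> 1" using f(2) by (simp add: walsh_norm_def)
    finally show ?thesis by (simp add: power_mult_distrib)
  qed
  moreover have "(\<Sum>k\<in>F. (?w k * V k powr lam)\<^sup>2) \<le> (?K / M)\<^sup>2 * (W / ((1 - \<tau>) * M)) powr ?e * W"
  proof -
    have "(\<Sum>k\<in>F. (?w k * V k powr lam)\<^sup>2) \<le> (\<Sum>k\<in>F. (?K / M)\<^sup>2 * (W / ((1 - \<tau>) * M)) powr ?e * V k)"
      by (rule sum_mono[OF bnd])
    also have "\<dots> = (?K / M)\<^sup>2 * (W / ((1 - \<tau>) * M)) powr ?e * sum V F" by (rule sum_distrib_left[symmetric])
    also have "\<dots> \<le> (?K / M)\<^sup>2 * (W / ((1 - \<tau>) * M)) powr ?e * W" using sumV by (rule mult_left_mono) simp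
    finally show ?thesis .
  qed
  moreover have "?lhs\<^sup>2 \<le> (\<Sum>k\<in>F. (?w k * V k powr lam)\<^sup>2) * (\<Sum>k\<in>F. (\<bar>?r k\<bar> * ?c k)\<^sup>2)"
  proof -
    have "?lhs = (\<Sum>k\<in>F. (?w k * V k powr lam) * (\<bar>?r k\<bar> * ?c k))"
      by (rule sum.cong[OF refl coeff])
    then show ?thesis by (simp only: Cauchy_Schwarz_ineq_sum)
  qed
  ultimately have "?lhs\<^sup>2 \<le> ((?K / M)\<^sup>2 * (W / ((1 - \<tau>) * M)) powr ?e * W) * 1"
    by (meson mult_mono order_trans sum_nonneg zero_le_power2)
  also have "\<dots> = (?C / M powr (lam + 1/2 - \<delta>) * W powr (lam - \<delta>))\<^sup>2"
    using squared_error_constant[of M "1 - \<tau>" W ?K "lam - \<delta>"] M0 \<tau> W0 by (simp add: algebra_simps)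
  finally have "?lhs\<^sup>2 \<le> (?C / M powr (lam + 1/2 - \<delta>) * W powr (lam - \<delta>))\<^sup>2" .
  then have "?lhs \<le> ?C / M powr (lam + 1/2 - \<delta>) * W powr (lam - \<delta>)"
    by (rule power2_le_imp_le) (use \<tau> \<delta> in simp)
  then show ?thesis by (simp only: W_def)
qed

theorem theorem5p11:
  fixes lam \<delta> \<tau> :: real
  assumes "0 < \<tau>" "\<tau> < 1" and "1/2 < lam" and "0 < \<delta>" "\<delta> < min (lam - 1/2) 1"
  shows "\<exists>C>0. \<forall>(m::nat) (s::nat) (\<alpha>::real) (\<gamma>::nat \<Rightarrow> real)
      (ord :: ('b::prime_card mod_ring poly \<times> 'b mod_ring poly) set).
    m \<ge> 1 \<longrightarrow> s \<ge> 1 \<longrightarrow> \<alpha> > 1/2 \<longrightarrow> lam < \<alpha> \<longrightarrow> (\<forall>j\<ge>1. \<gamma> j \<in> {0..1}) \<longrightarrow>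
    linear_order_on (gen_polys m) ord \<longrightarrow>
    real CARD('b) ^ m - 1 \<ge>
      (INF lam'\<in>{1/2..<\<alpha>}. 1 / (1 - \<tau>) * weight_sum CARD('b) s \<alpha> \<gamma> lam') \<longrightarrow>
    rand_error ord m s \<alpha> \<gamma> \<tau> \<le>
      ereal (C / (real CARD('b) ^ m - 1) powr (lam + 1/2 - \<delta>) *
        weight_sum CARD('b) s \<alpha> \<gamma> lam powr (lam - \<delta>))"
\<comment> \<open>In the witness, \<open>1 / \<tau> + 2\<close> stems from
  \<open>dual_prob_le\<close>, \<open>1 / (\<delta> * ln 2)\<close> from absorbing the digit count
  by \<open>mult_powr_neg_le\<close>, and the power of \<open>1 - \<tau>\<close> from the threshold
  on the weights.\<close>
proof (intro exI[of _ "(1 / \<tau> + 2) / (\<delta> * ln 2) * (1 - \<tau>) powr (- (lam - \<delta> - 1/2))"] conjI allI impI)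
  show "0 < (1 / \<tau> + 2) / (\<delta> * ln 2) * (1 - \<tau>) powr (- (lam - \<delta> - 1/2))"
    using assms by (intro mult_pos_pos divide_pos_pos add_pos_pos) auto
next
  fix m s :: nat and \<alpha> :: real and \<gamma> :: "nat \<Rightarrow> real"
    and ord :: "('b mod_ring poly \<times> 'b mod_ring poly) set"
  assume m: "m \<ge> 1" and s: "s \<ge> 1" and \<alpha>: "lam < \<alpha>" and \<gamma>: "\<forall>j\<ge>1. \<gamma> j \<in> {0..1}"
    and lin: "linear_order_on (gen_polys m) ord"
  show "rand_error ord m s \<alpha> \<gamma> \<tau> \<le>
      ereal ((1 / \<tau> + 2) / (\<delta> * ln 2) * (1 - \<tau>) powr (- (lam - \<delta> - 1/2)) / (real CARD('b) ^ m - 1) powr (lam + 1/2 - \<delta>) *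
        weight_sum CARD('b) s \<alpha> \<gamma> lam powr (lam - \<delta>))"
    unfolding rand_error_def
  proof (rule SUP_least, unfold ereal_less_eq)
    fix f assume f: "f \<in> {f \<in> walsh_space CARD('b) s \<alpha> \<gamma>. walsh_norm CARD('b) s \<alpha> \<gamma> f \<le> 1}"
    show "1 / real (card (monic_irreducibles m :: 'b mod_ring poly set)) *
         (\<Sum>p\<in>(monic_irreducibles m :: 'b mod_ring poly set).
            1 / real (card (cbc_vectors ord m s \<alpha> \<gamma> \<tau> p)) *
            (\<Sum>q\<in>cbc_vectors ord m s \<alpha> \<gamma> \<tau> p.
               \<bar>lattice_rule s m f p q - cube_integral s f\<bar>))
      \<le> (1 / \<tau> + 2) / (\<delta> * ln 2) * (1 - \<tau>) powr (- (lam - \<delta> - 1/2)) / (real CARD('b) ^ m - 1) powr (lam + 1/2 - \<delta>) *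
        weight_sum CARD('b) s \<alpha> \<gamma> lam powr (lam - \<delta>)"
    proof (rule expected_error_le[OF m s])
      show "f \<in> walsh_space CARD('b) s \<alpha> \<gamma>" using f by simp
      show "(\<Sum>k\<in>F. dual_prob ord m s \<alpha> \<gamma> \<tau> k * cmod (walsh_coeff CARD('b) s f k))
        \<le> (1 / \<tau> + 2) / (\<delta> * ln 2) * (1 - \<tau>) powr (- (lam - \<delta> - 1/2)) / (real CARD('b) ^ m - 1) powr (lam + 1/2 - \<delta>) *
          weight_sum CARD('b) s \<alpha> \<gamma> lam powr (lam - \<delta>)"
        if "finite F" "F \<subseteq> nat_vecs s - {\<lambda>j\<in>{1..s}. 0}" for F
        by (rule expected_error_bound) (use assms \<alpha> m \<gamma> lin f that in auto)
    qed
  qed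
qed

end
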